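(* For every non-zero $f\in K[x]_{\mu\text{-att}}$, one has $u_r(f)\in\Gamma_{r-1}$ and $$H_\mu(f)=x_r^{\,s_r(f)}\,p_r^{\,u_r(f)}\,R_r(f)(y_r)\quad\text{in }\mathcal G_\mu.$$
   Context: Let $(K,v)$ be a valued field with non-trivial value group $\Gamma$, residue field $k$, $\Gamma_{\mathbb Q}=\Gamma\otimes\mathbb Q$. For a valuation $\mu$ on $K[x]$: $\mathcal P_\alpha=\{g:\mu(g)\ge\alpha\}\supseteq\mathcal P^+_\alpha=\{g:\mu(g)>\alpha\}$, graded algebra $\mathcal G_\mu=\bigoplus_\alpha\mathcal P_\alpha/\mathcal P_\alpha^+$, $\Delta_\mu=\mathcal P_0/\mathcal P_0^+$, initial form $H_\mu(g)=g+\mathcal P^+_{\mu(g)}$ (multiplicative; extended multiplicatively to quotients); $h\mid_\mu g$ iff $H_\mu(h)\mid H_\mu(g)$. Key polynomial: monic $\phi$ with $H_\mu(\phi)\mathcal G_\mu$ non-zero prime and $\phi\nmid_\mu f$ for non-zero $f$ of smaller degree; $[\mu;\phi,\gamma](\sum a_s\phi^s)=\min(\mu(a_s)+s\gamma)$ for $\gamma>\mu(\phi)$. For $\mu\le\mu'$ in a chain, the canonical map $\mathcal G_\mu\to\mathcal G_{\mu'}$ sends $H_\mu(f)$ to $H_{\mu'}(f)$ if $\mu(f)=\mu'(f)$, else to $0$. MacLane chain $\mu_{-\infty}\xrightarrow{\phi_0,\gamma_0}\mu_0\to\cdots\xrightarrow{\phi_r,\gamma_r}\mu_r=\mu$: $\gamma_i\in\Gamma_{\mathbb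 Q}$, $\phi_0=x+a$, $\mu_0(\sum a_s\phi_0^s)=\min(v(a_s)+s\gamma_0)$, $\phi_i$ key polynomial for $\mu_{i-1}$, $\mu_i=[\mu_{i-1};\phi_i,\gamma_i]$, $\phi_{i+1}\nmid_{\mu_i}\phi_i$. $\mu_{-1}=v$, $\Gamma_{\mu_{-1}}=\Gamma$, $m_i=\deg\phi_i$, $e_i=(\Gamma_{\mu_i}:\Gamma_{\mu_{i-1}})$, $h_i=e_i\gamma_i\in\Gamma_{\mu_{i-1}}$. $\Delta_i=\Delta_{\mu_i}$; $\kappa_0$ = image of $k$ in $\Delta_0$, $\kappa_i$ = image of $\Delta_{i-1}\to\Delta_i$; one identifies $k=\kappa_0\subset\cdots\subset\kappa_r$, and $\Delta_i^*=\kappa_i^*$. Fix a finitely generated $\Gamma_{-1}\subseteq\Gamma$ with $h_i\in\Gamma_{-1}+\langle\gamma_0,\dots,\gamma_{i-1}\rangle$; $\Gamma_i=\langle\Gamma_{-1},\gamma_0,\dots,\gamma_i\rangle$ (free of rank $n$; $\Gamma_i\cap\Gamma_{\mu_{i-1}}=\Gamma_{i-1}$; $h_i\in\Gamma_{i-1}$). Bases: $\iota_{0,\cdot}$ of $\Gamma_{-1}$ fixed; recursively $\gamma_i=\sum_j(h_{i,j}/e_{i,j})\iota_{i,j}$ (coprime, $e_{i,j}>0$), $e'_{i,1}=d_{i,1}=1$, $e'_{i,j}=\prod_{t<j}e_{i,t}/\prod_{t<j}d_{i,t}$, $d_{i,j}=\gcd(e_{i,j},e'_{i,j})$, integers $\ell_{i,j}h_{i,j}e'_{i,j}+\ell'_{i,j}e_{i,j}=d_{i,j}$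 with $0\le\ell_{i,j}<e_{i,j}/d_{i,j}$, and $(\iota_{i+1,\cdot})=(\iota_{i,\cdot})Q_i$, $Q_i$ lower triangular, diagonal $d_{i,j}/e_{i,j}$, $(m,j)$-entry $\ell_{i,j}e'_{i,j}h_{i,m}/e_{i,m}$ ($m>j$); a basis of $\Gamma_i$. Rational functions: $\pi_{0,j}\in K^*$ with $v(\pi_{0,j})=\iota_{0,j}$; $\pi_{i+1,j}=(\phi_i\pi_{i,1}^{-h_{i,1}/e_{i,1}}\cdots\pi_{i,j-1}^{-h_{i,j-1}/e_{i,j-1}})^{\ell_{i,j}e'_{i,j}}\pi_{i,j}^{\ell'_{i,j}}$; $\pi_i^\alpha=\prod_j\pi_{i,j}^{n_j}$ for $\alpha=\sum n_j\iota_{i,j}\in\Gamma_{i-1}$; $Y_i=\phi_i^{e_i}\pi_i^{-h_i}$. Graded elements: $x_r=H_\mu(\phi_r)$, $y_r=H_\mu(Y_r)\in\Delta_\mu$, $p_r^\alpha=H_\mu(\pi_r^\alpha)\in\mathcal G_\mu^*$ for $\alpha\in\Gamma_{r-1}$. ($y_r$ is transcendental over $\kappa_r$ and $\Delta_\mu=\kappa_r[y_r]$.) Residual polynomial: for non-zero $f=\sum_sa_s\phi_r^s$ ($\deg a_s<m_r$), $N_r(f)$ is the lower convex hull in $\mathbb Q\times\Gamma_{\mathbb Q}$ of $Q_s=(s,\mu_{r-1}(a_s))$, $a_s\ne0$; $S_{\gamma_r}(f)$ is the set of $(s,u)\in N_r(f)$ minimizing $u+s\gamma_r$, with left endpoint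 $(s_r(f),u_r(f))$ and right endpoint $(s'_r(f),u'_r(f))$; $d=(s'_r(f)-s_r(f))/e_r\in\mathbb Z$, $s_j=s_r(f)+je_r$. $K[x]_{\mu\text{-att}}=\{0\}\cup\{g\ne0:\mu(g)\in\Gamma_r\}$. For non-zero $f\in K[x]_{\mu\text{-att}}$, $R_r(f)=\sum_{j=0}^dc_jy^j\in\kappa_r[y]$ with $c_j=p_r^{-\mu_{r-1}(a_{s_j})}H_\mu(a_{s_j})\in\kappa_r^*$ if $Q_{s_j}$ lies on $N_r(f)$ and $c_j=0$ otherwise; $R_r(0)=0$. *)

theory Defs
  imports "HOL-Computational_Algebra.Polynomial" "HOL-Computational_Algebra.Fraction_Field"
begin

definition nsmul :: "nat \<Rightarrow> 'g::ab_group_add \<Rightarrow> 'g" where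
  "nsmul k x = (\<Sum>_<k. x)"

definition zsmul :: "int \<Rightarrow> 'g::ab_group_add \<Rightarrow> 'g" where
  "zsmul k x = (if 0 \<le> k then nsmul (nat k) x else - nsmul (nat (- k)) x)"

text \<open>Rational multiple q*x = the unique y with denom(q)*y = numer(q)*x
  (meaningful in a divisible torsion-free group).\<close>
definition qmul :: "rat \<Rightarrow> 'g::linordered_ab_group_add \<Rightarrow> 'g" where
  "qmul q x = (THE y. nsmul (nat (snd (quotient_of q))) y = zsmul (fst (quotient_of q)) x)"

definition divisible_type :: "'g::linordered_ab_group_add itself \<Rightarrow> bool" where
  "divisible_type _ \<longleftrightarrow> (\<forall>(x::'g) k. 0 < k \<longrightarrow> (\<exists>y. nsmul k y = x))"

text \<open>Gamma_Q: the divisible hull of Gamma inside the (divisible) ambient group.\<close>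
definition GammaQ :: "'g::linordered_ab_group_add set \<Rightarrow> 'g set" where
  "GammaQ G = {x. \<exists>k>0. nsmul k x \<in> G}"

definition zspan :: "'g::ab_group_add set \<Rightarrow> 'g set" where
  "zspan S = {\<Sum>s\<in>F. zsmul (c s) s | F c. finite F \<and> F \<subseteq> S}"

definition gindex :: "'g::ab_group_add set \<Rightarrow> 'g set \<Rightarrow> nat" where
  "gindex A B = card ((\<lambda>a. (\<lambda>b. a + b) ` B) ` A)"

definition is_valuation_field :: "('k::field \<Rightarrow> 'g::linordered_ab_group_add) \<Rightarrow> bool" where
  "is_valuation_field v \<longleftrightarrow>
     (\<forall>a b. a \<noteq> 0 \<longrightarrow> b \<noteq> 0 \<longrightarrow> v (a * b) = v a + v b) \<and>
     (\<forall>a b. a \<noteq> 0 \<longrightarrow> b \<noteq> 0 \<longrightarrow> a + b \<noteq> 0 \<longrightarrow> min (v a) (v b) \<le> v (a + b))"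

text \<open>Value group of v (values at non-zero elements; v 0 = infinity is not represented).\<close>
definition valgroup_K :: "('k::field \<Rightarrow> 'g) \<Rightarrow> 'g set" where
  "valgroup_K v = v ` {a. a \<noteq> 0}"

definition valgroup :: "('k::field poly \<Rightarrow> 'g) \<Rightarrow> 'g set" where
  "valgroup \<mu> = \<mu> ` {f. f \<noteq> 0}"

text \<open>mu f is only meaningful for f \<noteq> 0; mu 0 = infinity is encoded by the disjunct g = 0.\<close>
definition Pge :: "('k::field poly \<Rightarrow> 'g::linordered_ab_group_add) \<Rightarrow> 'g \<Rightarrow> 'k poly set" where
  "Pge \<mu> \<alpha> = {g. g = 0 \<or> \<alpha> \<le> \<mu> g}"

definition Pgt :: "('k::field poly \<Rightarrow> 'g::linordered_ab_group_add) \<Rightarrow> 'g \<Rightarrow> 'k poly set" where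
  "Pgt \<mu> \<alpha> = {g. g = 0 \<or> \<alpha> < \<mu> g}"

definition cls :: "('k::field poly \<Rightarrow> 'g::linordered_ab_group_add) \<Rightarrow> 'g \<Rightarrow> 'k poly \<Rightarrow> 'k poly set" where
  "cls \<mu> \<alpha> g = {g + p | p. p \<in> Pgt \<mu> \<alpha>}"

text \<open>An element of G_mu = direct sum of P_alpha/P^+_alpha is a family of classes, almost all zero.\<close>
type_synonym ('k, 'g) gelem = "'g \<Rightarrow> 'k poly set"

definition Gsupp :: "('k::field poly \<Rightarrow> 'g::linordered_ab_group_add) \<Rightarrow> ('k,'g) gelem \<Rightarrow> 'g set" where
  "Gsupp \<mu> F = {\<alpha>. F \<alpha> \<noteq> Pgt \<mu> \<alpha>}"

definition Gcarrier :: "('k::field poly \<Rightarrow> 'g::linordered_ab_group_add) \<Rightarrow> ('k,'g) gelem set" where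
  "Gcarrier \<mu> = {F. (\<forall>\<alpha>. \<exists>g\<in>Pge \<mu> \<alpha>. F \<alpha> = cls \<mu> \<alpha> g) \<and> finite (Gsupp \<mu> F)}"

definition rep :: "'k poly set \<Rightarrow> 'k::field poly" where
  "rep X = (SOME g. g \<in> X)"

definition Gzero :: "('k::field poly \<Rightarrow> 'g::linordered_ab_group_add) \<Rightarrow> ('k,'g) gelem" where
  "Gzero \<mu> = (\<lambda>\<alpha>. Pgt \<mu> \<alpha>)"

definition Gadd :: "('k::field poly \<Rightarrow> 'g::linordered_ab_group_add) \<Rightarrow> ('k,'g) gelem \<Rightarrow> ('k,'g) gelem \<Rightarrow> ('k,'g) gelem" where
  "Gadd \<mu> F G = (\<lambda>\<alpha>. cls \<mu> \<alpha> (rep (F \<alpha>) + rep (G \<alpha>)))"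

definition Gmul :: "('k::field poly \<Rightarrow> 'g::linordered_ab_group_add) \<Rightarrow> ('k,'g) gelem \<Rightarrow> ('k,'g) gelem \<Rightarrow> ('k,'g) gelem" where
  "Gmul \<mu> F G = (\<lambda>\<gamma>. cls \<mu> \<gamma> (\<Sum>\<alpha>\<in>Gsupp \<mu> F. rep (F \<alpha>) * rep (G (\<gamma> - \<alpha>))))"

definition Hmu :: "('k::field poly \<Rightarrow> 'g::linordered_ab_group_add) \<Rightarrow> 'k poly \<Rightarrow> ('k,'g) gelem" where
  "Hmu \<mu> f = (\<lambda>\<alpha>. if f \<noteq> 0 \<and> \<alpha> = \<mu> f then cls \<mu> \<alpha> f else Pgt \<mu> \<alpha>)"

definition Gone :: "('k::field poly \<Rightarrow> 'g::linordered_ab_group_add) \<Rightarrow> ('k,'g) gelem" where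
  "Gone \<mu> = Hmu \<mu> 1"

primrec Gpow :: "('k::field poly \<Rightarrow> 'g::linordered_ab_group_add) \<Rightarrow> ('k,'g) gelem \<Rightarrow> nat \<Rightarrow> ('k,'g) gelem" where
  "Gpow \<mu> F 0 = Gone \<mu>"
| "Gpow \<mu> F (Suc k) = Gmul \<mu> F (Gpow \<mu> F k)"

primrec Gsum :: "('k::field poly \<Rightarrow> 'g::linordered_ab_group_add) \<Rightarrow> (nat \<Rightarrow> ('k,'g) gelem) \<Rightarrow> nat \<Rightarrow> ('k,'g) gelem" where
  "Gsum \<mu> c 0 = c 0"
| "Gsum \<mu> c (Suc k) = Gadd \<mu> (Gsum \<mu> c k) (c (Suc k))"

definition Gunit :: "('k::field poly \<Rightarrow> 'g::linordered_ab_group_add) \<Rightarrow> ('k,'g) gelem \<Rightarrow> bool" where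
  "Gunit \<mu> X \<longleftrightarrow> (\<exists>Y\<in>Gcarrier \<mu>. Gmul \<mu> X Y = Gone \<mu>)"

definition Ginv :: "('k::field poly \<Rightarrow> 'g::linordered_ab_group_add) \<Rightarrow> ('k,'g) gelem \<Rightarrow> ('k,'g) gelem" where
  "Ginv \<mu> X = (SOME Y. Y \<in> Gcarrier \<mu> \<and> Gmul \<mu> X Y = Gone \<mu>)"

definition Hq :: "('k::field poly \<Rightarrow> 'g::linordered_ab_group_add) \<Rightarrow> 'k poly fract \<Rightarrow> ('k,'g) gelem" where
  "Hq \<mu> q = (SOME X. \<exists>a b. b \<noteq> 0 \<and> q = Fract a b \<and> Gunit \<mu> (Hmu \<mu> b) \<and>
                          X = Gmul \<mu> (Hmu \<mu> a) (Ginv \<mu> (Hmu \<mu> b)))"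

definition Gideal :: "('k::field poly \<Rightarrow> 'g::linordered_ab_group_add) \<Rightarrow> ('k,'g) gelem \<Rightarrow> ('k,'g) gelem set" where
  "Gideal \<mu> X = {Gmul \<mu> X Z | Z. Z \<in> Gcarrier \<mu>}"

definition Gprime_ideal :: "('k::field poly \<Rightarrow> 'g::linordered_ab_group_add) \<Rightarrow> ('k,'g) gelem set \<Rightarrow> bool" where
  "Gprime_ideal \<mu> I \<longleftrightarrow> I \<noteq> Gcarrier \<mu> \<and>
     (\<forall>X\<in>Gcarrier \<mu>. \<forall>Y\<in>Gcarrier \<mu>. Gmul \<mu> X Y \<in> I \<longrightarrow> X \<in> I \<or> Y \<in> I)"

definition Gdvd :: "('k::field poly \<Rightarrow> 'g::linordered_ab_group_add) \<Rightarrow> ('k,'g) gelem \<Rightarrow> ('k,'g) gelem \<Rightarrow> bool" where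
  "Gdvd \<mu> X Y \<longleftrightarrow> (\<exists>Z\<in>Gcarrier \<mu>. Y = Gmul \<mu> X Z)"

definition mu_dvd :: "('k::field poly \<Rightarrow> 'g::linordered_ab_group_add) \<Rightarrow> 'k poly \<Rightarrow> 'k poly \<Rightarrow> bool" where
  "mu_dvd \<mu> h g \<longleftrightarrow> Gdvd \<mu> (Hmu \<mu> h) (Hmu \<mu> g)"

definition key_poly :: "('k::field poly \<Rightarrow> 'g::linordered_ab_group_add) \<Rightarrow> 'k poly \<Rightarrow> bool" where
  "key_poly \<mu> \<phi> \<longleftrightarrow> lead_coeff \<phi> = 1 \<and>
     Gideal \<mu> (Hmu \<mu> \<phi>) \<noteq> {Gzero \<mu>} \<and> Gprime_ideal \<mu> (Gideal \<mu> (Hmu \<mu> \<phi>)) \<and>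
     (\<forall>f. f \<noteq> 0 \<longrightarrow> degree f < degree \<phi> \<longrightarrow> \<not> mu_dvd \<mu> \<phi> f)"

text \<open>phi-adic expansion f = sum a_s phi^s, deg a_s < deg phi.\<close>
definition phi_coeff :: "'k::field poly \<Rightarrow> 'k poly \<Rightarrow> nat \<Rightarrow> 'k poly" where
  "phi_coeff \<phi> f s = (f div \<phi> ^ s) mod \<phi>"

definition augment :: "('k::field poly \<Rightarrow> 'g::linordered_ab_group_add) \<Rightarrow> 'k poly \<Rightarrow> 'g \<Rightarrow> 'k poly \<Rightarrow> 'g" where
  "augment \<mu> \<phi> \<gamma> f = Min {\<mu> (phi_coeff \<phi> f s) + nsmul s \<gamma> | s. s \<le> degree f \<and> phi_coeff \<phi> f s \<noteq> 0}"

text \<open>mu_{-1} = v, applied to constants.\<close>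
definition mu_minus1 :: "('k::field \<Rightarrow> 'g::linordered_ab_group_add) \<Rightarrow> 'k poly \<Rightarrow> 'g" where
  "mu_minus1 v c = v (coeff c 0)"

primrec MC :: "('k::field \<Rightarrow> 'g::linordered_ab_group_add) \<Rightarrow> (nat \<Rightarrow> 'k poly) \<Rightarrow> (nat \<Rightarrow> 'g) \<Rightarrow> nat \<Rightarrow> 'k poly \<Rightarrow> 'g" where
  "MC v \<phi> \<gamma> 0 = augment (mu_minus1 v) (\<phi> 0) (\<gamma> 0)"
| "MC v \<phi> \<gamma> (Suc i) = augment (MC v \<phi> \<gamma> i) (\<phi> (Suc i)) (\<gamma> (Suc i))"

definition mu_prev :: "('k::field \<Rightarrow> 'g::linordered_ab_group_add) \<Rightarrow> (nat \<Rightarrow> 'k poly) \<Rightarrow> (nat \<Rightarrow> 'g) \<Rightarrow> nat \<Rightarrow> 'k poly \<Rightarrow> 'g" where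
  "mu_prev v \<phi> \<gamma> i = (if i = 0 then mu_minus1 v else MC v \<phi> \<gamma> (i - 1))"

definition valgroup_prev :: "('k::field \<Rightarrow> 'g::linordered_ab_group_add) \<Rightarrow> (nat \<Rightarrow> 'k poly) \<Rightarrow> (nat \<Rightarrow> 'g) \<Rightarrow> nat \<Rightarrow> 'g set" where
  "valgroup_prev v \<phi> \<gamma> i = (if i = 0 then valgroup_K v else valgroup (MC v \<phi> \<gamma> (i - 1)))"

definition e_idx :: "('k::field \<Rightarrow> 'g::linordered_ab_group_add) \<Rightarrow> (nat \<Rightarrow> 'k poly) \<Rightarrow> (nat \<Rightarrow> 'g) \<Rightarrow> nat \<Rightarrow> nat" where
  "e_idx v \<phi> \<gamma> i = gindex (valgroup (MC v \<phi> \<gamma> i)) (valgroup_prev v \<phi> \<gamma> i)"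

definition h_val :: "('k::field \<Rightarrow> 'g::linordered_ab_group_add) \<Rightarrow> (nat \<Rightarrow> 'k poly) \<Rightarrow> (nat \<Rightarrow> 'g) \<Rightarrow> nat \<Rightarrow> 'g" where
  "h_val v \<phi> \<gamma> i = nsmul (e_idx v \<phi> \<gamma> i) (\<gamma> i)"

definition is_MacLane_chain :: "('k::field \<Rightarrow> 'g::linordered_ab_group_add) \<Rightarrow> (nat \<Rightarrow> 'k poly) \<Rightarrow> (nat \<Rightarrow> 'g) \<Rightarrow> nat \<Rightarrow> bool" where
  "is_MacLane_chain v \<phi> \<gamma> r \<longleftrightarrow>
     (\<exists>a. \<phi> 0 = [:a, 1:]) \<and>
     (\<forall>i\<le>r. \<gamma> i \<in> GammaQ (valgroup_K v)) \<and>
     (\<forall>i. 1 \<le> i \<longrightarrow> i \<le> r \<longrightarrow> key_poly (MC v \<phi> \<gamma> (i - 1)) (\<phi> i) \<and> MC v \<phi> \<gamma> (i - 1) (\<phi> i) < \<gamma> i) \<and>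
     (\<forall>i<r. \<not> mu_dvd (MC v \<phi> \<gamma> i) (\<phi> (Suc i)) (\<phi> i))"

text \<open>Gsub iota0 n gamma k = Gamma_{k-1} = < Gamma_{-1}, gamma_0, ..., gamma_{k-1} >,
  where Gamma_{-1} is generated by iota0 0, ..., iota0 (n-1).\<close>
definition Gsub :: "(nat \<Rightarrow> 'g::ab_group_add) \<Rightarrow> nat \<Rightarrow> (nat \<Rightarrow> 'g) \<Rightarrow> nat \<Rightarrow> 'g set" where
  "Gsub \<iota>0 n \<gamma> k = zspan (\<iota>0 ` {..<n} \<union> \<gamma> ` {..<k})"

definition zindep :: "(nat \<Rightarrow> 'g::ab_group_add) \<Rightarrow> nat \<Rightarrow> bool" where
  "zindep b n \<longleftrightarrow> (\<forall>c. (\<Sum>j<n. zsmul (c j) (b j)) = 0 \<longrightarrow> (\<forall>j<n. c j = 0))"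

definition coordsQ :: "nat \<Rightarrow> (nat \<Rightarrow> 'g::linordered_ab_group_add) \<Rightarrow> 'g \<Rightarrow> nat \<Rightarrow> rat" where
  "coordsQ n b x = (THE q. (\<forall>j\<ge>n. q j = 0) \<and> (\<Sum>j<n. qmul (q j) (b j)) = x)"

definition coordsZ :: "nat \<Rightarrow> (nat \<Rightarrow> 'g::ab_group_add) \<Rightarrow> 'g \<Rightarrow> nat \<Rightarrow> int" where
  "coordsZ n b x = (THE c. (\<forall>j\<ge>n. c j = 0) \<and> (\<Sum>j<n. zsmul (c j) (b j)) = x)"

definition hh :: "nat \<Rightarrow> (nat \<Rightarrow> 'g::linordered_ab_group_add) \<Rightarrow> 'g \<Rightarrow> nat \<Rightarrow> int" where
  "hh n b g j = fst (quotient_of (coordsQ n b g j))"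

definition ee :: "nat \<Rightarrow> (nat \<Rightarrow> 'g::linordered_ab_group_add) \<Rightarrow> 'g \<Rightarrow> nat \<Rightarrow> int" where
  "ee n b g j = snd (quotient_of (coordsQ n b g j))"

text \<open>e'_{j+1} = e'_j e_j / d_j (i.e. e'_j = prod_{t<j} e_t / prod_{t<j} d_t), e'_0 = 1.\<close>
primrec eprime :: "(nat \<Rightarrow> int) \<Rightarrow> nat \<Rightarrow> int" where
  "eprime e 0 = 1"
| "eprime e (Suc j) = eprime e j * e j div gcd (e j) (eprime e j)"

definition dd :: "(nat \<Rightarrow> int) \<Rightarrow> nat \<Rightarrow> int" where
  "dd e j = gcd (e j) (eprime e j)"

definition ll :: "(nat \<Rightarrow> int) \<Rightarrow> (nat \<Rightarrow> int) \<Rightarrow> nat \<Rightarrow> int" where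
  "ll h e j = (THE l. 0 \<le> l \<and> l < e j div dd e j \<and>
                      (\<exists>l'. l * h j * eprime e j + l' * e j = dd e j))"

definition llp :: "(nat \<Rightarrow> int) \<Rightarrow> (nat \<Rightarrow> int) \<Rightarrow> nat \<Rightarrow> int" where
  "llp h e j = (THE l'. ll h e j * h j * eprime e j + l' * e j = dd e j)"

definition next_basis :: "nat \<Rightarrow> (nat \<Rightarrow> 'g::linordered_ab_group_add) \<Rightarrow> 'g \<Rightarrow> nat \<Rightarrow> 'g" where
  "next_basis n b g j =
     (let h = hh n b g; e = ee n b g in
      qmul (of_int (dd e j) / of_int (e j)) (b j) +
      (\<Sum>m\<in>{j<..<n}. qmul (of_int (ll h e j * eprime e j * h m) / of_int (e m)) (b m)))"

text \<open>Next rational functions pi_{i+1,j}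
  = (phi_i pi_{i,1}^{-h_1/e_1} ... pi_{i,j-1}^{-h_{j-1}/e_{j-1}})^{l_j e'_j} pi_{i,j}^{l'_j};
  the exponent of pi_{i,t} (t<j) is -(h_t l_j e'_j)/e_t, an integer since e_t divides e'_j.\<close>
definition next_pi :: "nat \<Rightarrow> (nat \<Rightarrow> 'g::linordered_ab_group_add) \<Rightarrow> 'g \<Rightarrow> 'k::field poly \<Rightarrow> (nat \<Rightarrow> 'k poly fract) \<Rightarrow> nat \<Rightarrow> 'k poly fract" where
  "next_pi n b g \<phi> p j =
     (let h = hh n b g; e = ee n b g; L = ll h e j * eprime e j in
      Fract \<phi> 1 powi L *
      (\<Prod>t<j. p t powi (- ((h t * L) div e t))) *
      p j powi llp h e j)"

text \<open>basis_pi ... i = (iota_i, pi_i), the basis of Gamma_{i-1} and the associated rational functions.\<close>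
primrec basis_pi :: "nat \<Rightarrow> (nat \<Rightarrow> 'g::linordered_ab_group_add) \<Rightarrow> (nat \<Rightarrow> 'k::field) \<Rightarrow> (nat \<Rightarrow> 'k poly) \<Rightarrow> (nat \<Rightarrow> 'g) \<Rightarrow> nat \<Rightarrow> (nat \<Rightarrow> 'g) \<times> (nat \<Rightarrow> 'k poly fract)" where
  "basis_pi n \<iota>0 \<pi>0 \<phi> \<gamma> 0 = (\<iota>0, \<lambda>j. Fract [:\<pi>0 j:] 1)"
| "basis_pi n \<iota>0 \<pi>0 \<phi> \<gamma> (Suc i) =
     (let (b, p) = basis_pi n \<iota>0 \<pi>0 \<phi> \<gamma> i in
       (next_basis n b (\<gamma> i), next_pi n b (\<gamma> i) (\<phi> i) p))"

definition pi_pow :: "nat \<Rightarrow> (nat \<Rightarrow> 'g::linordered_ab_group_add) \<Rightarrow> (nat \<Rightarrow> 'k::field) \<Rightarrow> (nat \<Rightarrow> 'k poly) \<Rightarrow> (nat \<Rightarrow> 'g) \<Rightarrow> nat \<Rightarrow> 'g \<Rightarrow> 'k poly fract" where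
  "pi_pow n \<iota>0 \<pi>0 \<phi> \<gamma> i \<alpha> =
     (let (b, p) = basis_pi n \<iota>0 \<pi>0 \<phi> \<gamma> i; c = coordsZ n b \<alpha> in \<Prod>j<n. p j powi c j)"

definition Yfun :: "('k::field \<Rightarrow> 'g::linordered_ab_group_add) \<Rightarrow> nat \<Rightarrow> (nat \<Rightarrow> 'g) \<Rightarrow> (nat \<Rightarrow> 'k) \<Rightarrow> (nat \<Rightarrow> 'k poly) \<Rightarrow> (nat \<Rightarrow> 'g) \<Rightarrow> nat \<Rightarrow> 'k poly fract" where
  "Yfun v n \<iota>0 \<pi>0 \<phi> \<gamma> i =
     Fract (\<phi> i ^ e_idx v \<phi> \<gamma> i) 1 * pi_pow n \<iota>0 \<pi>0 \<phi> \<gamma> i (- h_val v \<phi> \<gamma> i)"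

definition NPoints :: "('k::field poly \<Rightarrow> 'g::linordered_ab_group_add) \<Rightarrow> 'k poly \<Rightarrow> 'k poly \<Rightarrow> (rat \<times> 'g) set" where
  "NPoints \<mu>' \<phi> f = {(of_nat s, \<mu>' (phi_coeff \<phi> f s)) | s. phi_coeff \<phi> f s \<noteq> 0}"

definition qconv :: "(rat \<times> 'g::linordered_ab_group_add) set \<Rightarrow> (rat \<times> 'g) set" where
  "qconv P = {((\<Sum>p\<in>F. w p * fst p), (\<Sum>p\<in>F. qmul (w p) (snd p))) | F w.
               finite F \<and> F \<noteq> {} \<and> F \<subseteq> P \<and> (\<forall>p\<in>F. 0 \<le> w p) \<and> (\<Sum>p\<in>F. w p) = 1}"

definition Npoly :: "('k::field poly \<Rightarrow> 'g::linordered_ab_group_add) \<Rightarrow> 'k poly \<Rightarrow> 'k poly \<Rightarrow> (rat \<times> 'g) set" where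
  "Npoly \<mu>' \<phi> f = {p \<in> qconv (NPoints \<mu>' \<phi> f).
        \<forall>q\<in>qconv (NPoints \<mu>' \<phi> f). fst q = fst p \<longrightarrow> snd p \<le> snd q}"

definition Sgam :: "('k::field poly \<Rightarrow> 'g::linordered_ab_group_add) \<Rightarrow> 'k poly \<Rightarrow> 'g \<Rightarrow> 'k poly \<Rightarrow> (rat \<times> 'g) set" where
  "Sgam \<mu>' \<phi> \<gamma> f = {p \<in> Npoly \<mu>' \<phi> f.
        \<forall>q\<in>Npoly \<mu>' \<phi> f. snd p + qmul (fst p) \<gamma> \<le> snd q + qmul (fst q) \<gamma>}"

definition left_end :: "('k::field poly \<Rightarrow> 'g::linordered_ab_group_add) \<Rightarrow> 'k poly \<Rightarrow> 'g \<Rightarrow> 'k poly \<Rightarrow> rat \<times> 'g" where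
  "left_end \<mu>' \<phi> \<gamma> f = (THE p. p \<in> Sgam \<mu>' \<phi> \<gamma> f \<and> (\<forall>q\<in>Sgam \<mu>' \<phi> \<gamma> f. fst p \<le> fst q))"

definition right_end :: "('k::field poly \<Rightarrow> 'g::linordered_ab_group_add) \<Rightarrow> 'k poly \<Rightarrow> 'g \<Rightarrow> 'k poly \<Rightarrow> rat \<times> 'g" where
  "right_end \<mu>' \<phi> \<gamma> f = (THE p. p \<in> Sgam \<mu>' \<phi> \<gamma> f \<and> (\<forall>q\<in>Sgam \<mu>' \<phi> \<gamma> f. fst q \<le> fst p))"

definition s_r :: "('k::field \<Rightarrow> 'g::linordered_ab_group_add) \<Rightarrow> (nat \<Rightarrow> 'k poly) \<Rightarrow> (nat \<Rightarrow> 'g) \<Rightarrow> nat \<Rightarrow> 'k poly \<Rightarrow> nat" where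
  "s_r v \<phi> \<gamma> r f = nat \<lfloor>fst (left_end (mu_prev v \<phi> \<gamma> r) (\<phi> r) (\<gamma> r) f)\<rfloor>"

definition u_r :: "('k::field \<Rightarrow> 'g::linordered_ab_group_add) \<Rightarrow> (nat \<Rightarrow> 'k poly) \<Rightarrow> (nat \<Rightarrow> 'g) \<Rightarrow> nat \<Rightarrow> 'k poly \<Rightarrow> 'g" where
  "u_r v \<phi> \<gamma> r f = snd (left_end (mu_prev v \<phi> \<gamma> r) (\<phi> r) (\<gamma> r) f)"

definition s'_r :: "('k::field \<Rightarrow> 'g::linordered_ab_group_add) \<Rightarrow> (nat \<Rightarrow> 'k poly) \<Rightarrow> (nat \<Rightarrow> 'g) \<Rightarrow> nat \<Rightarrow> 'k poly \<Rightarrow> nat" where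
  "s'_r v \<phi> \<gamma> r f = nat \<lfloor>fst (right_end (mu_prev v \<phi> \<gamma> r) (\<phi> r) (\<gamma> r) f)\<rfloor>"

definition d_r :: "('k::field \<Rightarrow> 'g::linordered_ab_group_add) \<Rightarrow> (nat \<Rightarrow> 'k poly) \<Rightarrow> (nat \<Rightarrow> 'g) \<Rightarrow> nat \<Rightarrow> 'k poly \<Rightarrow> nat" where
  "d_r v \<phi> \<gamma> r f = (s'_r v \<phi> \<gamma> r f - s_r v \<phi> \<gamma> r f) div e_idx v \<phi> \<gamma> r"

text \<open>Coefficient c_j of R_r(f), an element of kappa_r \<subseteq> Delta_mu \<subseteq> G_mu.\<close>
definition Rcoeff :: "('k::field \<Rightarrow> 'g::linordered_ab_group_add) \<Rightarrow> nat \<Rightarrow> (nat \<Rightarrow> 'g) \<Rightarrow> (nat \<Rightarrow> 'k) \<Rightarrow> (nat \<Rightarrow> 'k poly) \<Rightarrow> (nat \<Rightarrow> 'g) \<Rightarrow> nat \<Rightarrow> 'k poly \<Rightarrow> nat \<Rightarrow> ('k, 'g) gelem" where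
  "Rcoeff v n \<iota>0 \<pi>0 \<phi> \<gamma> r f j =
     (let \<mu> = MC v \<phi> \<gamma> r; \<mu>' = mu_prev v \<phi> \<gamma> r;
          sj = s_r v \<phi> \<gamma> r f + j * e_idx v \<phi> \<gamma> r; a = phi_coeff (\<phi> r) f sj in
      if a \<noteq> 0 \<and> (of_nat sj, \<mu>' a) \<in> Npoly \<mu>' (\<phi> r) f
      then Gmul \<mu> (Hq \<mu> (pi_pow n \<iota>0 \<pi>0 \<phi> \<gamma> r (- \<mu>' a))) (Hmu \<mu> a)
      else Gzero \<mu>)"

definition R_at_y :: "('k::field \<Rightarrow> 'g::linordered_ab_group_add) \<Rightarrow> nat \<Rightarrow> (nat \<Rightarrow> 'g) \<Rightarrow> (nat \<Rightarrow> 'k) \<Rightarrow> (nat \<Rightarrow> 'k poly) \<Rightarrow> (nat \<Rightarrow> 'g) \<Rightarrow> nat \<Rightarrow> 'k poly \<Rightarrow> ('k, 'g) gelem" where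
  "R_at_y v n \<iota>0 \<pi>0 \<phi> \<gamma> r f =
     (let \<mu> = MC v \<phi> \<gamma> r; y = Hq \<mu> (Yfun v n \<iota>0 \<pi>0 \<phi> \<gamma> r) in
      Gsum \<mu> (\<lambda>j. Gmul \<mu> (Rcoeff v n \<iota>0 \<pi>0 \<phi> \<gamma> r f j) (Gpow \<mu> y j)) (d_r v \<phi> \<gamma> r f))"

end

theory Submission
  imports Defs
begin

text \<open>
  Write \<open>f = \<Sum>a\<^sub>s\<phi>\<^sub>r\<^sup>s\<close> and let \<open>I\<close> be the set of indices \<open>s\<close> at which
  \<open>\<mu>\<^sub>r\<^sub>-\<^sub>1(a\<^sub>s) + s\<gamma>\<^sub>r\<close> attains its minimum \<open>\<mu>(f)\<close>. Modulo terms of larger value, \<open>f\<close> is the sum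
  of the \<open>a\<^sub>s\<phi>\<^sub>r\<^sup>s\<close> with \<open>s \<in> I\<close>. The end points of \<open>S\<close> have the extreme elements of \<open>I\<close> as
  abscissas; let \<open>(s\<^sub>0, u)\<close> be the left one. As \<open>e = e\<^sub>r\<close> is the order of \<open>\<gamma>\<^sub>r\<close> modulo the value group of
  \<open>\<mu>\<^sub>r\<^sub>-\<^sub>1\<close>, every \<open>s \<in> I\<close> is of the form \<open>s\<^sub>0 + je\<close>. Then, with \<open>\<beta> = \<mu>\<^sub>r\<^sub>-\<^sub>1(a\<^sub>s)\<close>,
  \<open>a\<^sub>s\<phi>\<^sub>r\<^bsup>s\<^esup> = \<phi>\<^sub>r\<^bsup>s\<^sub>0\<^esup> \<pi>\<^sub>r\<^bsup>u\<^esup> (\<pi>\<^sub>r\<^bsup>-\<beta>\<^esup> a\<^sub>s) Y\<^sub>r\<^bsup>j\<^esup>\<close> holds already between rational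
  functions, because the exponents of \<open>\<pi>\<^sub>r\<close> add up to \<open>u - \<beta> - jh\<^sub>r = 0\<close>. Taking initial forms gives the
  formula.

  It remains to see that the initial forms of the \<open>\<pi>\<^sub>r\<^bsup>\<alpha>\<^esup>\<close> exist and are units of degree \<open>\<alpha>\<close>.
  If \<open>\<phi>\<close> is a key polynomial for \<open>\<mu>\<close> and does not \<open>\<mu>\<close>-divide \<open>f\<close>, then in the augmented valuation
  \<open>f\<close> has the same value and initial form as its remainder modulo \<open>\<phi>\<close>, and this remainder has
  an inverse modulo \<open>\<phi>\<close>, so that its initial form is a unit. This applies to the division of \<open>\<phi>\<^sub>i\<close> by
  \<open>\<phi>\<^sub>i\<^sub>+\<^sub>1\<close>, and units remain units along the chain.
\<close>

section \<open>Multiples in ordered abelian groups\<close>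

lemma nsmul_0 [simp]: "nsmul 0 x = 0"
  and nsmul_Suc [simp]: "nsmul (Suc k) x = x + nsmul k x"
  by (simp_all add: nsmul_def add.commute)

lemma nsmul_add: "nsmul (k + l) x = nsmul k x + nsmul l x"
  by (induction k) (simp_all add: algebra_simps)

lemma nsmul_add_right: "nsmul k (x + y) = nsmul k x + nsmul k y"
  by (simp add: nsmul_def sum.distrib)

lemma nsmul_mult: "nsmul (k * l) x = nsmul k (nsmul l x)"
  by (induction k) (simp_all add: nsmul_add)

lemma nsmul_nonneg: "0 \<le> (x :: 'g::linordered_ab_group_add) \<Longrightarrow> 0 \<le> nsmul k x"
  by (induction k) simp_all

lemma nsmul_pos: "0 < (x :: 'g::linordered_ab_group_add) \<Longrightarrow> 0 < k \<Longrightarrow> 0 < nsmul k x"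
  by (cases k) (simp_all add: add_pos_nonneg nsmul_nonneg)

lemma zsmul_of_nat: "zsmul (int k) x = nsmul k x"
  by (simp add: zsmul_def)

lemma zsmul_diff_nat: "zsmul (int k - int l) x = nsmul k x - nsmul l x"
proof (cases "l \<le> k")
  case True
  then obtain m where "k = l + m" using le_Suc_ex by blast
  then show ?thesis by (simp add: zsmul_def nsmul_add)
next
  case False
  then obtain m where "l = k + m" "0 < m"
    by (metis le_Suc_ex less_imp_le_nat not_le less_add_same_cancel1)
  then show ?thesis by (simp add: zsmul_def nsmul_add)
qed

lemma nsmul_diff_right: "nsmul k (x - y) = nsmul k x - nsmul k y"
  by (simp add: nsmul_def sum_subtractf)

text \<open>Writing integers as differences of naturals removes the sign distinction in
  \<open>zsmul\<close>, so the module laws reduce to those of \<open>nsmul\<close>. Subgroups of the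
  value group are from here on treated as submodules over the integers.\<close>

interpretation zmod: module "zsmul :: int \<Rightarrow> 'g::ab_group_add \<Rightarrow> 'g"
proof
  fix a b :: int and x y :: 'g
  obtain k l where a: "a = int k - int l" by (metis int_diff_cases)
  obtain k' l' where b: "b = int k' - int l'" by (metis int_diff_cases)
  show "zsmul a (x + y) = zsmul a x + zsmul a y"
    by (simp add: a zsmul_diff_nat nsmul_add_right algebra_simps)
  have "a + b = int (k + k') - int (l + l')" by (simp add: a b)
  then show "zsmul (a + b) x = zsmul a x + zsmul b x"
    unfolding a b by (simp only: zsmul_diff_nat nsmul_add) (simp add: algebra_simps)
  have "a * b = int (k * k' + l * l') - int (k * l' + l * k')"
    by (simp add: a b algebra_simps)
  then show "zsmul a (zsmul b x) = zsmul (a * b) x"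
    unfolding a b
    by (simp only: zsmul_diff_nat nsmul_add nsmul_diff_right nsmul_mult) (simp add: algebra_simps)
  show "zsmul 1 x = x" by (simp add: zsmul_def)
qed

lemma zspan_eq_span: "zspan S = zmod.span S"
  unfolding zspan_def zmod.span_explicit ..

text \<open>An ordered group is torsion-free: a non-zero element or its negative is positive, and
  positive multiples of a positive element stay positive.\<close>

lemma zsmul_cancel:
  fixes x y :: "'g::linordered_ab_group_add"
  assumes "k \<noteq> 0" "zsmul k x = zsmul k y"
  shows "x = y"
proof -
  have *: "nsmul m z = 0 \<Longrightarrow> 0 < m \<Longrightarrow> z = 0" for m and z :: 'g
  proof (rule ccontr)
    assume "nsmul m z = 0" "0 < m" "z \<noteq> 0"
    moreover have "nsmul m (- z) = 0" using \<open>nsmul m z = 0\<close> by (simp add: nsmul_def sum_negf)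
    ultimately show False
      using nsmul_pos[of z m] nsmul_pos[of "- z" m] neq_iff[of z 0] by auto
  qed
  have "zsmul k (x - y) = 0" using assms(2) by (simp add: zmod.scale_right_diff_distrib)
  then have "nsmul (nat \<bar>k\<bar>) (x - y) = 0" by (auto simp: zsmul_def split: if_splits)
  then show ?thesis using *[of "nat \<bar>k\<bar>" "x - y"] assms(1) by simp
qed

section \<open>Rational multiples in a divisible ordered group\<close>

locale divisible_group =
  fixes T :: "'g::linordered_ab_group_add itself"
  assumes divisible: "divisible_type TYPE('g)"
begin

lemma ex_zsmul: "k \<noteq> 0 \<Longrightarrow> \<exists>y :: 'g. zsmul k y = x"
proof -
  assume "k \<noteq> 0"
  then have "0 < nat \<bar>k\<bar>" by simp
  then obtain y where y: "nsmul (nat \<bar>k\<bar>) y = x"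
    using divisible unfolding divisible_type_def by blast
  then have "zsmul k (if 0 \<le> k then y else - y) = x"
    using \<open>k \<noteq> 0\<close> by (auto simp: zsmul_def nsmul_def sum_negf)
  then show ?thesis by blast
qed

text \<open>Divisibility gives existence, and torsion-freeness gives uniqueness, of the element
  described in \<open>qmul\<close>. The fraction need not be in lowest terms, so that common
  denominators can be used later.\<close>

lemma zsmul_qmul:
  fixes x :: 'g
  assumes "k \<noteq> 0" and q: "q = of_int p / of_int k"
  shows "zsmul k (qmul q x) = zsmul p x"
proof -
  obtain a b where ab: "quotient_of q = (a, b)" by fastforce
  then have b: "b > 0" and qab: "q = of_int a / of_int b"
    using quotient_of_denom_pos quotient_of_div by blast+
  obtain y :: 'g where y: "zsmul b y = zsmul a x" using ex_zsmul[of b] b by auto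
  have "qmul q x = y"
    unfolding qmul_def ab fst_conv snd_conv
  proof (rule the_equality)
    show "nsmul (nat b) y = zsmul a x" using y b by (simp add: zsmul_def)
  next
    fix z assume "nsmul (nat b) z = zsmul a x"
    then have "zsmul b z = zsmul b y" using y b by (simp add: zsmul_def)
    then show "z = y" using zsmul_cancel[of b z y] b by simp
  qed
  moreover have "a * k = p * b"
    using q qab assms(1) b by (simp add: field_simps flip: of_int_mult)
  then have "zsmul b (zsmul k y) = zsmul b (zsmul p x)"
    using y by (metis mult.commute zmod.scale_scale)
  then have "zsmul k y = zsmul p x" using zsmul_cancel[of b "zsmul k y" "zsmul p x"] b by simp
  ultimately show ?thesis by simp
qed

lemma qmul_eqI:
  fixes x :: 'g
  assumes "k \<noteq> 0" "q = of_int p / of_int k" "zsmul k y = zsmul p x"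
  shows "qmul q x = y"
  using zsmul_cancel[of k "qmul q x" y] zsmul_qmul[OF assms(1,2), of x] assms by simp

lemma rat_fraction: obtains p k where "k \<noteq> 0" "(q::rat) = of_int p / of_int k"
  by (metis quotient_of_div quotient_of_denom_pos surj_pair order_less_irrefl)

text \<open>Each law is checked after multiplication by a common denominator, which can be
  cancelled.\<close>

sublocale qvec: vector_space "qmul :: rat \<Rightarrow> 'g \<Rightarrow> 'g"
proof
  fix a b :: rat and x y :: 'g
  obtain p k where a: "k \<noteq> 0" "a = of_int p / of_int k" by (rule rat_fraction)
  obtain p' k' where b: "k' \<noteq> 0" "b = of_int p' / of_int k'" by (rule rat_fraction)
  note ka = zsmul_qmul[OF a] and kb = zsmul_qmul[OF b]
  show "qmul a (x + y) = qmul a x + qmul a y"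
    by (rule qmul_eqI[OF a]) (simp add: zmod.scale_right_distrib ka)
  have k1: "zsmul (k * k') (qmul a z) = zsmul (p * k') z" for z :: 'g
    using ka[of z] by (metis mult.commute zmod.scale_scale)
  have k2: "zsmul (k * k') (qmul b z) = zsmul (p' * k) z" for z :: 'g
    using kb[of z] by (metis mult.commute zmod.scale_scale)
  have ab: "a + b = of_int (p * k' + p' * k) / of_int (k * k')"
    using a b by (simp add: field_simps)
  show "qmul (a + b) x = qmul a x + qmul b x"
    by (rule qmul_eqI[OF _ ab]) (use a(1) b(1) in \<open>simp_all add: zmod.scale_right_distrib k1 k2 zmod.scale_left_distrib\<close>)
  have ab: "a * b = of_int (p * p') / of_int (k * k')"
    unfolding a(2) b(2) by simp
  have "zsmul (k * k') (qmul a (qmul b x)) = zsmul p (zsmul k' (qmul b x))"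
    by (simp add: k1)
  then have "zsmul (k * k') (qmul a (qmul b x)) = zsmul (p * p') x"
    by (simp add: kb)
  then show "qmul a (qmul b x) = qmul (a * b) x"
    using qmul_eqI[OF _ ab, of _ x] a b by simp
  show "qmul 1 x = x"
    by (rule qmul_eqI[of 1 1 1]) simp_all
qed

lemma qmul_of_int: "qmul (of_int k) x = zsmul k (x :: 'g)"
  by (rule qmul_eqI[of 1 _ k]) simp_all

lemma qmul_of_nat: "qmul (of_nat k) x = nsmul k (x :: 'g)"
  using qmul_of_int[of "int k" x] by (simp add: zsmul_of_nat)

lemma qmul_nonneg:
  assumes "0 \<le> q" "0 \<le> (x :: 'g)"
  shows "0 \<le> qmul q x"
proof (rule ccontr)
  obtain p k where pk: "quotient_of q = (p, k)" by fastforce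
  then have k: "k > 0" and q: "q = of_int p / of_int k"
    using quotient_of_denom_pos quotient_of_div by blast+
  then have p: "p \<ge> 0" using assms(1) by (simp add: zero_le_divide_iff)
  assume "\<not> 0 \<le> qmul q x"
  then have "nsmul (nat k) (- qmul q x) > 0" using k by (intro nsmul_pos) auto
  then have "zsmul k (qmul q x) < 0" using k by (simp add: zsmul_def nsmul_def sum_negf)
  moreover have "zsmul p x \<ge> 0" using p assms(2) by (simp add: zsmul_def nsmul_nonneg)
  ultimately show False using zsmul_qmul[OF _ q, of x] k by simp
qed

end

section \<open>Homogeneous elements of the graded algebra\<close>

text \<open>The group has no infinite element, so the value at 0 is arbitrary and all laws are
  restricted to non-zero arguments. The sets \<open>Pge\<close> and \<open>Pgt\<close> contain 0 by
  definition and allow arguments without this case distinction.\<close>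

locale poly_valuation =
  fixes \<mu> :: "'k::field poly \<Rightarrow> 'g::linordered_ab_group_add"
  assumes val_mult: "f \<noteq> 0 \<Longrightarrow> g \<noteq> 0 \<Longrightarrow> \<mu> (f * g) = \<mu> f + \<mu> g"
    and val_add: "f \<noteq> 0 \<Longrightarrow> g \<noteq> 0 \<Longrightarrow> f + g \<noteq> 0 \<Longrightarrow> min (\<mu> f) (\<mu> g) \<le> \<mu> (f + g)"
begin

lemma val_1 [simp]: "\<mu> 1 = 0"
  using val_mult[of 1 1] by simp

lemma val_minus [simp]: "\<mu> (- f) = \<mu> f"
proof (cases "f = 0")
  case False
  have "\<mu> (- 1) + \<mu> (- 1) = 0" using val_mult[of "- 1" "- 1"] by simp
  then have "\<mu> (- 1) = 0" by (simp add: double_zero)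
  then show ?thesis using False val_mult[of "- 1" f] by simp
qed simp

lemma val_power: "f \<noteq> 0 \<Longrightarrow> \<mu> (f ^ k) = nsmul k (\<mu> f)"
  by (induction k) (simp_all add: val_mult)

lemma Pge_0 [simp]: "0 \<in> Pge \<mu> \<alpha>" and Pgt_0 [simp]: "0 \<in> Pgt \<mu> \<alpha>"
  by (simp_all add: Pge_def Pgt_def)

lemma Pge_val [simp]: "f \<in> Pge \<mu> (\<mu> f)"
  by (simp add: Pge_def)

lemma Pgt_imp_Pge: "f \<in> Pgt \<mu> \<alpha> \<Longrightarrow> f \<in> Pge \<mu> \<alpha>"
  by (auto simp: Pge_def Pgt_def)

lemma Pge_add: "f \<in> Pge \<mu> \<alpha> \<Longrightarrow> g \<in> Pge \<mu> \<alpha> \<Longrightarrow> f + g \<in> Pge \<mu> \<alpha>"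
proof (cases "f = 0 \<or> g = 0 \<or> f + g = 0")
  case False
  assume "f \<in> Pge \<mu> \<alpha>" "g \<in> Pge \<mu> \<alpha>"
  then have "\<alpha> \<le> min (\<mu> f) (\<mu> g)" using False by (simp add: Pge_def)
  also have "\<dots> \<le> \<mu> (f + g)" using False by (simp add: val_add)
  finally show ?thesis by (simp add: Pge_def)
qed (auto simp: Pge_def)

lemma Pgt_add: "f \<in> Pgt \<mu> \<alpha> \<Longrightarrow> g \<in> Pgt \<mu> \<alpha> \<Longrightarrow> f + g \<in> Pgt \<mu> \<alpha>"
proof (cases "f = 0 \<or> g = 0 \<or> f + g = 0")
  case False
  assume "f \<in> Pgt \<mu> \<alpha>" "g \<in> Pgt \<mu> \<alpha>"
  then have "\<alpha> < min (\<mu> f) (\<mu> g)" using False by (simp add: Pgt_def)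
  also have "\<dots> \<le> \<mu> (f + g)" using False by (simp add: val_add)
  finally show ?thesis by (simp add: Pgt_def)
qed (auto simp: Pgt_def)

lemma Pgt_minus_iff [simp]: "- f \<in> Pgt \<mu> \<alpha> \<longleftrightarrow> f \<in> Pgt \<mu> \<alpha>"
  by (simp add: Pgt_def)

lemma Pgt_diff: "f \<in> Pgt \<mu> \<alpha> \<Longrightarrow> g \<in> Pgt \<mu> \<alpha> \<Longrightarrow> f - g \<in> Pgt \<mu> \<alpha>"
  using Pgt_add[of f \<alpha> "- g"] by simp

lemma Pgt_diff_commute: "f - g \<in> Pgt \<mu> \<alpha> \<longleftrightarrow> g - f \<in> Pgt \<mu> \<alpha>"
  using Pgt_minus_iff[of "f - g"] by simp

lemma Pgt_diff_trans: "f - g \<in> Pgt \<mu> \<alpha> \<Longrightarrow> g - h \<in> Pgt \<mu> \<alpha> \<Longrightarrow> f - h \<in> Pgt \<mu> \<alpha>"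
  using Pgt_add[of "f - g" \<alpha> "g - h"] by simp

lemma Pgt_diff_cong: "f - g \<in> Pgt \<mu> \<alpha> \<Longrightarrow> f \<in> Pgt \<mu> \<alpha> \<longleftrightarrow> g \<in> Pgt \<mu> \<alpha>"
  using Pgt_diff[of f \<alpha> "f - g"] Pgt_add[of "f - g" \<alpha> g] by auto

lemma Pge_mult: "f \<in> Pge \<mu> \<alpha> \<Longrightarrow> g \<in> Pge \<mu> \<beta> \<Longrightarrow> f * g \<in> Pge \<mu> (\<alpha> + \<beta>)"
  by (cases "f = 0 \<or> g = 0") (auto simp: Pge_def val_mult add_mono)

lemma Pgt_mult: "f \<in> Pgt \<mu> \<alpha> \<Longrightarrow> g \<in> Pge \<mu> \<beta> \<Longrightarrow> f * g \<in> Pgt \<mu> (\<alpha> + \<beta>)"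
  by (cases "f = 0 \<or> g = 0") (auto simp: Pge_def Pgt_def val_mult add_less_le_mono)

lemma Pgt_mult': "f \<in> Pge \<mu> \<alpha> \<Longrightarrow> g \<in> Pgt \<mu> \<beta> \<Longrightarrow> f * g \<in> Pgt \<mu> (\<alpha> + \<beta>)"
  using Pgt_mult[of g \<beta> f \<alpha>] by (simp add: ac_simps)

lemma Pge_sum: "(\<And>i. i \<in> A \<Longrightarrow> f i \<in> Pge \<mu> \<alpha>) \<Longrightarrow> sum f A \<in> Pge \<mu> \<alpha>"
  by (induction A rule: infinite_finite_induct) (auto intro: Pge_add)

lemma Pgt_sum: "(\<And>i. i \<in> A \<Longrightarrow> f i \<in> Pgt \<mu> \<alpha>) \<Longrightarrow> sum f A \<in> Pgt \<mu> \<alpha>"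
  by (induction A rule: infinite_finite_induct) (auto intro: Pgt_add)

lemma not_Pgt_val: "f \<noteq> 0 \<Longrightarrow> f \<notin> Pgt \<mu> (\<mu> f)"
  by (simp add: Pgt_def)

lemma val_eq_of_diff:
  assumes "f \<noteq> 0" "f - g \<in> Pgt \<mu> (\<mu> f)"
  shows "g \<noteq> 0" "\<mu> g = \<mu> f"
proof -
  show g: "g \<noteq> 0" using assms not_Pgt_val by auto
  have "\<mu> f \<le> \<mu> g"
    using Pge_add[of f "\<mu> f" "g - f"] Pgt_imp_Pge assms(2) Pgt_diff_commute g
    by (force simp: Pge_def)
  moreover have "\<not> \<mu> f < \<mu> g"
    using Pgt_diff_cong[OF assms(2)] not_Pgt_val[OF assms(1)] by (simp add: Pgt_def)
  ultimately show "\<mu> g = \<mu> f" by simp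
qed

section \<open>Classes, representatives and homogeneous elements\<close>

lemma mem_cls: "h \<in> cls \<mu> \<alpha> g \<longleftrightarrow> h - g \<in> Pgt \<mu> \<alpha>"
  unfolding cls_def by (auto intro: exI[of _ "h - g"])

lemma cls_eq_iff: "cls \<mu> \<alpha> g = cls \<mu> \<alpha> h \<longleftrightarrow> g - h \<in> Pgt \<mu> \<alpha>"
proof
  assume "cls \<mu> \<alpha> g = cls \<mu> \<alpha> h"
  moreover have "g \<in> cls \<mu> \<alpha> g" by (simp add: mem_cls)
  ultimately show "g - h \<in> Pgt \<mu> \<alpha>" by (simp add: mem_cls)
next
  assume "g - h \<in> Pgt \<mu> \<alpha>"
  then show "cls \<mu> \<alpha> g = cls \<mu> \<alpha> h"
    by (metis Pgt_diff_commute Pgt_diff_trans mem_cls subsetI subset_antisym)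
qed

lemma cls_0: "cls \<mu> \<alpha> 0 = Pgt \<mu> \<alpha>"
  by (auto simp: mem_cls)

lemma rep_cls: "rep (cls \<mu> \<alpha> g) - g \<in> Pgt \<mu> \<alpha>"
proof -
  have "g \<in> cls \<mu> \<alpha> g" by (simp add: mem_cls)
  then have "rep (cls \<mu> \<alpha> g) \<in> cls \<mu> \<alpha> g" unfolding rep_def by (rule someI)
  then show ?thesis by (simp add: mem_cls)
qed

text \<open>All factors of the formula to be proved are of this shape. Identities in the graded
  algebra thereby become congruences of polynomials modulo \<open>Pgt\<close>.\<close>

definition homog :: "'g \<Rightarrow> 'k poly \<Rightarrow> ('k, 'g) gelem" where
  "homog \<alpha> g = (\<lambda>\<beta>. cls \<mu> \<beta> (if \<beta> = \<alpha> then g else 0))"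

lemma homog_eq_iff: "homog \<alpha> f = homog \<alpha> g \<longleftrightarrow> f - g \<in> Pgt \<mu> \<alpha>"
proof
  assume "homog \<alpha> f = homog \<alpha> g"
  then have "homog \<alpha> f \<alpha> = homog \<alpha> g \<alpha>" by simp
  then show "f - g \<in> Pgt \<mu> \<alpha>" by (simp add: homog_def cls_eq_iff)
next
  assume "f - g \<in> Pgt \<mu> \<alpha>"
  then show "homog \<alpha> f = homog \<alpha> g" by (simp add: homog_def cls_eq_iff fun_eq_iff)
qed

lemma Hmu_homog: "f \<noteq> 0 \<Longrightarrow> Hmu \<mu> f = homog (\<mu> f) f"
  by (auto simp: Hmu_def homog_def cls_0 fun_eq_iff)

lemma Gone_homog: "Gone \<mu> = homog 0 1"
  by (simp add: Gone_def Hmu_homog)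

lemma Gzero_homog: "Gzero \<mu> = homog \<alpha> 0"
  by (simp add: Gzero_def homog_def cls_0)

lemma Gsupp_homog: "Gsupp \<mu> (homog \<alpha> f) = (if f \<in> Pgt \<mu> \<alpha> then {} else {\<alpha>})"
proof -
  have "cls \<mu> \<alpha> f = Pgt \<mu> \<alpha> \<longleftrightarrow> f \<in> Pgt \<mu> \<alpha>"
    using cls_eq_iff[of \<alpha> f 0] by (simp add: cls_0)
  then show ?thesis by (auto simp: Gsupp_def homog_def cls_0)
qed

lemma homog_carrier: "f \<in> Pge \<mu> \<alpha> \<Longrightarrow> homog \<alpha> f \<in> Gcarrier \<mu>"
  unfolding Gcarrier_def mem_Collect_eq
  by (intro conjI allI) (auto simp: Gsupp_homog, auto simp: homog_def intro!: bexI)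

lemma carrier_rep:
  assumes "Z \<in> Gcarrier \<mu>"
  shows "Z \<alpha> = cls \<mu> \<alpha> (rep (Z \<alpha>))" "rep (Z \<alpha>) \<in> Pge \<mu> \<alpha>"
proof -
  obtain g where g: "g \<in> Pge \<mu> \<alpha>" "Z \<alpha> = cls \<mu> \<alpha> g"
    using assms by (auto simp: Gcarrier_def)
  have d: "rep (Z \<alpha>) - g \<in> Pgt \<mu> \<alpha>" unfolding g(2) by (rule rep_cls)
  then show "Z \<alpha> = cls \<mu> \<alpha> (rep (Z \<alpha>))" by (metis g(2) Pgt_diff_commute cls_eq_iff)
  show "rep (Z \<alpha>) \<in> Pge \<mu> \<alpha>"
    using Pge_add[OF g(1) Pgt_imp_Pge[OF d]] by simp
qed

text \<open>The sum in \<open>Gmul\<close> runs over the support of the first factor, which has at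
  most one element. If it is empty, the product on the right lies in \<open>Pgt\<close> anyway;
  otherwise a change of representative alters the product only by an element of
  \<open>Pgt\<close>.\<close>

lemma Gmul_homog_left:
  assumes f: "f \<in> Pge \<mu> \<alpha>" and Z: "Z \<in> Gcarrier \<mu>"
  shows "Gmul \<mu> (homog \<alpha> f) Z = (\<lambda>\<gamma>. cls \<mu> \<gamma> (f * rep (Z (\<gamma> - \<alpha>))))"
proof
  fix \<gamma>
  note z = carrier_rep(2)[OF Z, of "\<gamma> - \<alpha>"]
  show "Gmul \<mu> (homog \<alpha> f) Z \<gamma> = cls \<mu> \<gamma> (f * rep (Z (\<gamma> - \<alpha>)))"
  proof (cases "f \<in> Pgt \<mu> \<alpha>")
    case True
    then have "0 - f * rep (Z (\<gamma> - \<alpha>)) \<in> Pgt \<mu> \<gamma>" using Pgt_mult[OF True z] by simp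
    then show ?thesis using True unfolding Gmul_def by (simp add: Gsupp_homog cls_eq_iff)
  next
    case False
    have "rep (homog \<alpha> f \<alpha>) - f \<in> Pgt \<mu> \<alpha>" by (simp add: homog_def rep_cls)
    then have "(rep (homog \<alpha> f \<alpha>) - f) * rep (Z (\<gamma> - \<alpha>)) \<in> Pgt \<mu> \<gamma>"
      using Pgt_mult[OF _ z] by fastforce
    then show ?thesis using False unfolding Gmul_def
      by (simp add: Gsupp_homog cls_eq_iff left_diff_distrib)
  qed
qed

lemma Gmul_homog:
  assumes f: "f \<in> Pge \<mu> \<alpha>" and g: "g \<in> Pge \<mu> \<beta>"
  shows "Gmul \<mu> (homog \<alpha> f) (homog \<beta> g) = homog (\<alpha> + \<beta>) (f * g)"
proof
  fix \<gamma>
  let ?g = "if \<gamma> - \<alpha> = \<beta> then g else 0"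
  have "rep (homog \<beta> g (\<gamma> - \<alpha>)) - ?g \<in> Pgt \<mu> (\<gamma> - \<alpha>)" unfolding homog_def by (rule rep_cls)
  from Pgt_mult'[OF f this] have "f * rep (homog \<beta> g (\<gamma> - \<alpha>)) - f * ?g \<in> Pgt \<mu> \<gamma>"
    by (simp add: right_diff_distrib)
  then have "cls \<mu> \<gamma> (f * rep (homog \<beta> g (\<gamma> - \<alpha>))) = cls \<mu> \<gamma> (f * ?g)"
    by (simp only: cls_eq_iff)
  also have "f * ?g = (if \<gamma> = \<alpha> + \<beta> then f * g else 0)" by auto
  finally show "Gmul \<mu> (homog \<alpha> f) (homog \<beta> g) \<gamma> = homog (\<alpha> + \<beta>) (f * g) \<gamma>"
    unfolding Gmul_homog_left[OF f homog_carrier[OF g]] by (simp add: homog_def)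
qed

lemma Gadd_homog: "Gadd \<mu> (homog \<alpha> f) (homog \<alpha> g) = homog \<alpha> (f + g)"
proof
  fix \<gamma>
  let ?f = "if \<gamma> = \<alpha> then f else 0" and ?g = "if \<gamma> = \<alpha> then g else 0"
  have "(rep (cls \<mu> \<gamma> ?f) - ?f) + (rep (cls \<mu> \<gamma> ?g) - ?g) \<in> Pgt \<mu> \<gamma>"
    by (intro Pgt_add rep_cls)
  then have "cls \<mu> \<gamma> (rep (cls \<mu> \<gamma> ?f) + rep (cls \<mu> \<gamma> ?g)) = cls \<mu> \<gamma> (?f + ?g)"
    unfolding cls_eq_iff by (simp add: algebra_simps)
  also have "?f + ?g = (if \<gamma> = \<alpha> then f + g else 0)" by simp
  finally show "Gadd \<mu> (homog \<alpha> f) (homog \<alpha> g) \<gamma> = homog \<alpha> (f + g) \<gamma>"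
    unfolding Gadd_def homog_def .
qed

lemma Pge_power: "f \<in> Pge \<mu> \<alpha> \<Longrightarrow> f ^ k \<in> Pge \<mu> (nsmul k \<alpha>)"
proof (induction k)
  case 0
  then show ?case by (simp add: Pge_def)
qed (simp add: Pge_mult)

lemma Gpow_homog: "f \<in> Pge \<mu> \<alpha> \<Longrightarrow> Gpow \<mu> (homog \<alpha> f) k = homog (nsmul k \<alpha>) (f ^ k)"
  by (induction k) (simp_all add: Gone_homog Gmul_homog Pge_power)

lemma Gsum_homog:
  "(\<And>j. j \<le> d \<Longrightarrow> c j = homog \<alpha> (g j)) \<Longrightarrow> Gsum \<mu> c d = homog \<alpha> (\<Sum>j\<le>d. g j)"
  by (induction d) (simp_all add: Gadd_homog)

section \<open>Invertible initial forms\<close>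

definition initial_inverse :: "'k poly \<Rightarrow> 'k poly \<Rightarrow> bool" where
  "initial_inverse b b' \<longleftrightarrow> b \<noteq> 0 \<and> b' \<in> Pge \<mu> (- \<mu> b) \<and> b * b' - 1 \<in> Pgt \<mu> 0"

text \<open>The chosen inverse in \<open>Ginv\<close> is hereby replaced by an explicit homogeneous
  one. This requires uniqueness of inverses among all elements of the graded algebra, not only among
  homogeneous ones.\<close>

lemma initial_inverse_imp:
  assumes "initial_inverse b b'"
  shows "Gunit \<mu> (Hmu \<mu> b)" "Ginv \<mu> (Hmu \<mu> b) = homog (- \<mu> b) b'"
proof -
  have b: "b \<noteq> 0" and b': "b' \<in> Pge \<mu> (- \<mu> b)" and bb': "b * b' - 1 \<in> Pgt \<mu> 0"
    using assms by (auto simp: initial_inverse_def)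
  let ?Y = "homog (- \<mu> b) b'"
  have Y: "?Y \<in> Gcarrier \<mu>" "Gmul \<mu> (Hmu \<mu> b) ?Y = Gone \<mu>"
    using b b' bb' by (simp_all add: homog_carrier Hmu_homog Gmul_homog Gone_homog homog_eq_iff)
  then show "Gunit \<mu> (Hmu \<mu> b)" unfolding Gunit_def by blast
  show "Ginv \<mu> (Hmu \<mu> b) = ?Y"
    unfolding Ginv_def
  proof (rule some_equality)
    show "?Y \<in> Gcarrier \<mu> \<and> Gmul \<mu> (Hmu \<mu> b) ?Y = Gone \<mu>" using Y by simp
  next
    fix Z assume Z: "Z \<in> Gcarrier \<mu> \<and> Gmul \<mu> (Hmu \<mu> b) Z = Gone \<mu>"
    \<comment> \<open>Uniqueness is shown in each degree by evaluating \<open>b' * b * ?z\<close> in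
      two ways: it is congruent to \<open>?z\<close>, and also to \<open>b'\<close> times the
      component of 1 in the corresponding degree.\<close>
    show "Z = ?Y"
    proof
      fix \<delta>
      let ?z = "rep (Z \<delta>)" and ?o = "if \<delta> = - \<mu> b then 1 else 0 :: 'k poly"
      have "cls \<mu> (\<delta> + \<mu> b) (b * ?z) = homog 0 1 (\<delta> + \<mu> b)"
        using Z Gmul_homog_left[of b "\<mu> b" Z] by (simp add: Hmu_homog b Gone_homog fun_eq_iff)
      moreover have "\<delta> + \<mu> b = 0 \<longleftrightarrow> \<delta> = - \<mu> b" by (simp add: eq_neg_iff_add_eq_0)
      ultimately have "b * ?z - ?o \<in> Pgt \<mu> (\<delta> + \<mu> b)"
        by (simp only: homog_def cls_eq_iff)
      from Pgt_mult'[OF b' this] have "b' * (b * ?z - ?o) \<in> Pgt \<mu> \<delta>" by (simp add: ac_simps)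
      moreover have "(b * b' - 1) * ?z \<in> Pgt \<mu> \<delta>"
        using Pgt_mult[OF bb' carrier_rep(2)] Z by fastforce
      ultimately have "b' * (b * ?z - ?o) - (b * b' - 1) * ?z \<in> Pgt \<mu> \<delta>" by (rule Pgt_diff)
      moreover have "b' * (b * ?z - ?o) - (b * b' - 1) * ?z = ?z - b' * ?o"
        by (simp add: algebra_simps)
      ultimately have "?z - (if \<delta> = - \<mu> b then b' else 0) \<in> Pgt \<mu> \<delta>" by (simp split: if_splits)
      then show "Z \<delta> = ?Y \<delta>"
        using Z carrier_rep(1)[of Z \<delta>] unfolding homog_def by (metis cls_eq_iff)
    qed
  qed
qed

lemma Gunit_imp_initial_inverse:
  assumes "b \<noteq> 0" "Gunit \<mu> (Hmu \<mu> b)"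
  obtains b' where "initial_inverse b b'"
proof -
  obtain Y where Y: "Y \<in> Gcarrier \<mu>" "Gmul \<mu> (Hmu \<mu> b) Y = Gone \<mu>"
    using assms(2) by (auto simp: Gunit_def)
  then have "cls \<mu> 0 (b * rep (Y (0 - \<mu> b))) = homog 0 1 0"
    using Gmul_homog_left[of b "\<mu> b" Y] by (metis Hmu_homog assms(1) Gone_homog Pge_val)
  then have "initial_inverse b (rep (Y (- \<mu> b)))"
    using carrier_rep(2)[OF Y(1)] assms(1)
    by (simp add: homog_def cls_eq_iff initial_inverse_def)
  then show thesis by (rule that)
qed

text \<open>\<open>initial_form q \<alpha> f\<close>: the fraction \<open>q\<close> has value \<open>\<alpha>\<close>, and its initial form lies in the
  graded algebra and is the class of the polynomial \<open>f\<close> in degree \<open>\<alpha>\<close>.\<close>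
definition initial_form :: "'k poly fract \<Rightarrow> 'g \<Rightarrow> 'k poly \<Rightarrow> bool" where
  "initial_form q \<alpha> f \<longleftrightarrow> (\<exists>a b b'. a \<noteq> 0 \<and> q = Fract a b \<and> initial_inverse b b' \<and>
     \<alpha> = \<mu> a - \<mu> b \<and> f = a * b')"

text \<open>Two fractions for \<open>q\<close> satisfy \<open>a * d = c * b\<close>. Multiplying
  \<open>f\<close> by \<open>d * d'\<close> and \<open>g\<close> by \<open>b * b'\<close>, both
  congruent to 1, yields the same polynomial.\<close>

lemma initial_form_unique:
  assumes "initial_form q \<alpha> f" "initial_form q \<beta> g"
  shows "\<alpha> = \<beta>" "f - g \<in> Pgt \<mu> \<alpha>"
proof -
  obtain a b b' where 1: "a \<noteq> 0" "q = Fract a b" "initial_inverse b b'" "\<alpha> = \<mu> a - \<mu> b" "f = a * b'"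
    using assms(1) by (auto simp: initial_form_def)
  obtain c d d' where 2: "c \<noteq> 0" "q = Fract c d" "initial_inverse d d'" "\<beta> = \<mu> c - \<mu> d" "g = c * d'"
    using assms(2) by (auto simp: initial_form_def)
  note b = 1(3)[unfolded initial_inverse_def] and d = 2(3)[unfolded initial_inverse_def]
  have e: "a * d = c * b" using 1 2 b d by (auto simp: eq_fract)
  then have "\<mu> a + \<mu> d = \<mu> c + \<mu> b" using 1 2 b d val_mult by metis
  then show ab: "\<alpha> = \<beta>" unfolding 1 2 by (simp add: algebra_simps)
  have f: "f \<in> Pge \<mu> \<alpha>" using Pge_mult[of a "\<mu> a" b' "- \<mu> b"] b unfolding 1 by simp
  have g: "g \<in> Pge \<mu> \<alpha>" using Pge_mult[of c "\<mu> c" d' "- \<mu> d"] d unfolding 2 ab by simp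
  have "f * (d * d' - 1) \<in> Pgt \<mu> \<alpha>" "g * (b * b' - 1) \<in> Pgt \<mu> \<alpha>"
    using Pgt_mult'[OF f, of _ 0] Pgt_mult'[OF g, of _ 0] b d by simp_all
  then have "g * (b * b' - 1) - f * (d * d' - 1) \<in> Pgt \<mu> \<alpha>" by (simp add: Pgt_diff)
  moreover have "f * (d * d') = g * (b * b')"
  proof -
    have "f * (d * d') = (a * d) * (b' * d')" unfolding 1 by (simp add: ac_simps)
    also have "\<dots> = g * (b * b')" unfolding e 2 by (simp add: ac_simps)
    finally show ?thesis .
  qed
  ultimately show "f - g \<in> Pgt \<mu> \<alpha>" by (simp add: algebra_simps)
qed

lemma initial_form_Pge: "initial_form q \<alpha> f \<Longrightarrow> f \<in> Pge \<mu> \<alpha>"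
  using Pge_mult[OF Pge_val] by (fastforce simp: initial_form_def initial_inverse_def)

text \<open>\<open>Hq\<close> selects one value among those given by all representations of
  \<open>q\<close> with invertible denominator; by \<open>initial_form_unique\<close> they all
  agree.\<close>

lemma Hq_homog:
  assumes "initial_form q \<alpha> f"
  shows "Hq \<mu> q = homog \<alpha> f"
  unfolding Hq_def
proof (rule some_equality)
  have eq: "Gmul \<mu> (Hmu \<mu> a) (Ginv \<mu> (Hmu \<mu> b)) = homog (\<mu> a - \<mu> b) (a * b')"
    if "initial_inverse b b'" "a \<noteq> 0" for a b b'
    using that Gmul_homog[of a "\<mu> a" b' "- \<mu> b"]
    by (simp add: initial_inverse_imp Hmu_homog) (simp add: initial_inverse_def)
  show "\<exists>a b. b \<noteq> 0 \<and> q = Fract a b \<and> Gunit \<mu> (Hmu \<mu> b) \<and>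
      homog \<alpha> f = Gmul \<mu> (Hmu \<mu> a) (Ginv \<mu> (Hmu \<mu> b))"
    using assms unfolding initial_form_def
    by (metis eq initial_inverse_def initial_inverse_imp(1))
  fix X assume "\<exists>a b. b \<noteq> 0 \<and> q = Fract a b \<and> Gunit \<mu> (Hmu \<mu> b) \<and>
      X = Gmul \<mu> (Hmu \<mu> a) (Ginv \<mu> (Hmu \<mu> b))"
  then obtain c d where cd: "d \<noteq> 0" "q = Fract c d" "Gunit \<mu> (Hmu \<mu> d)"
    "X = Gmul \<mu> (Hmu \<mu> c) (Ginv \<mu> (Hmu \<mu> d))" by blast
  obtain d' where d': "initial_inverse d d'" using Gunit_imp_initial_inverse cd by blast
  \<comment> \<open>This makes the numerator of the competing representation non-zero, as
    \<open>initial_form\<close> demands.\<close>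
  have "q \<noteq> 0" using assms by (auto simp: initial_form_def initial_inverse_def Zero_fract_def eq_fract)
  then have c: "c \<noteq> 0" using cd by (auto simp: Zero_fract_def eq_fract)
  then have g: "initial_form q (\<mu> c - \<mu> d) (c * d')" using cd d' unfolding initial_form_def by blast
  show "X = homog \<alpha> f"
    using initial_form_unique[OF g assms] cd(4) eq[OF d' c] homog_eq_iff by simp
qed

lemma initial_inverse_mult:
  assumes "initial_inverse b b'" "initial_inverse d d'"
  shows "initial_inverse (b * d) (b' * d')"
proof -
  note b = assms(1)[unfolded initial_inverse_def] and d = assms(2)[unfolded initial_inverse_def]
  have m: "b' * d' \<in> Pge \<mu> (- \<mu> (b * d))"
    using Pge_mult[of b' "- \<mu> b" d' "- \<mu> d"] b d by (simp add: val_mult)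
  have "b * b' \<in> Pge \<mu> (\<mu> b + - \<mu> b)" using b by (intro Pge_mult) simp_all
  then have "b * b' * (d * d' - 1) \<in> Pgt \<mu> 0" using Pgt_mult'[of "b * b'" 0 "d * d' - 1" 0] d by simp
  then have "b * b' * (d * d' - 1) + (b * b' - 1) \<in> Pgt \<mu> 0" using b by (intro Pgt_add) auto
  then have "b * d * (b' * d') - 1 \<in> Pgt \<mu> 0" by (simp add: algebra_simps)
  then show ?thesis using m b d by (simp add: initial_inverse_def)
qed

lemma initial_form_mult:
  assumes "initial_form p \<alpha> f" "initial_form q \<beta> g"
  shows "initial_form (p * q) (\<alpha> + \<beta>) (f * g)"
proof -
  obtain a b b' where 1: "a \<noteq> 0" "p = Fract a b" "initial_inverse b b'" "\<alpha> = \<mu> a - \<mu> b" "f = a * b'"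
    using assms(1) by (auto simp: initial_form_def)
  obtain c d d' where 2: "c \<noteq> 0" "q = Fract c d" "initial_inverse d d'" "\<beta> = \<mu> c - \<mu> d" "g = c * d'"
    using assms(2) by (auto simp: initial_form_def)
  have "b \<noteq> 0" "d \<noteq> 0" using 1 2 by (auto simp: initial_inverse_def)
  then have "a * c \<noteq> 0" "p * q = Fract (a * c) (b * d)" "\<alpha> + \<beta> = \<mu> (a * c) - \<mu> (b * d)"
    "f * g = a * c * (b' * d')"
    using 1 2 by (simp_all add: val_mult)
  then show ?thesis using initial_inverse_mult[OF 1(3) 2(3)] unfolding initial_form_def by blast
qed

lemma initial_inverse_1: "initial_inverse 1 1"
  by (simp add: initial_inverse_def Pge_def)

lemma initial_form_poly: "f \<noteq> 0 \<Longrightarrow> initial_form (Fract f 1) (\<mu> f) f"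
  unfolding initial_form_def using initial_inverse_1 by fastforce

lemma initial_form_1: "initial_form 1 0 1"
  using initial_form_poly[of 1] by (simp add: One_fract_def)

lemma initial_form_power: "initial_form p \<alpha> f \<Longrightarrow> initial_form (p ^ k) (nsmul k \<alpha>) (f ^ k)"
  by (induction k) (simp_all add: initial_form_1 initial_form_mult)

text \<open>The inverse is included because the exponents in \<open>next_pi\<close> and
  \<open>pi_pow\<close> may be negative.\<close>

definition initial_unit :: "'k poly fract \<Rightarrow> 'g \<Rightarrow> bool" where
  "initial_unit q \<alpha> \<longleftrightarrow> q \<noteq> 0 \<and> (\<exists>f. initial_form q \<alpha> f) \<and> (\<exists>f. initial_form (inverse q) (- \<alpha>) f)"

lemma initial_unit_mult:
  "initial_unit p \<alpha> \<Longrightarrow> initial_unit q \<beta> \<Longrightarrow> initial_unit (p * q) (\<alpha> + \<beta>)"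
  using initial_form_mult unfolding initial_unit_def by (fastforce simp: add.commute)

lemma initial_unit_1: "initial_unit 1 0"
  using initial_form_1 by (auto simp: initial_unit_def)

lemma initial_unit_inverse: "initial_unit q \<alpha> \<Longrightarrow> initial_unit (inverse q) (- \<alpha>)"
  by (auto simp: initial_unit_def)

lemma initial_unit_power: "initial_unit q \<alpha> \<Longrightarrow> initial_unit (q ^ k) (nsmul k \<alpha>)"
  by (induction k) (simp_all add: initial_unit_1 initial_unit_mult)

lemma initial_unit_powi: "initial_unit q \<alpha> \<Longrightarrow> initial_unit (q powi k) (zsmul k \<alpha>)"
  using initial_unit_power[of q \<alpha> "nat k"] initial_unit_power[of "inverse q" "- \<alpha>" "nat (- k)"]
  by (auto simp: power_int_def zsmul_def nsmul_def sum_negf initial_unit_inverse)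

lemma initial_unit_prod:
  "finite A \<Longrightarrow> (\<And>i. i \<in> A \<Longrightarrow> initial_unit (q i) (\<alpha> i)) \<Longrightarrow> initial_unit (prod q A) (sum \<alpha> A)"
  by (induction A rule: finite_induct) (simp_all add: initial_unit_1 initial_unit_mult)

lemma initial_unit_poly:
  assumes "initial_inverse b b'"
  shows "initial_unit (Fract b 1) (\<mu> b)"
proof -
  have b: "b \<noteq> 0" using assms by (simp add: initial_inverse_def)
  have "initial_form (Fract 1 b) (- \<mu> b) b'"
    unfolding initial_form_def using assms by (intro exI[of _ 1] exI[of _ b] exI[of _ b']) simp
  then show ?thesis
    using b initial_form_poly[OF b]
    by (auto simp: initial_unit_def Zero_fract_def eq_fract)
qed

text \<open>A cofactor in the graded algebra may be cut down to its component of degree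
  \<open>\<mu> g - \<mu> h\<close>; the polynomial \<open>q\<close> represents this
  component.\<close>

lemma mu_dvd_iff:
  assumes "h \<noteq> 0" "g \<noteq> 0"
  shows "mu_dvd \<mu> h g \<longleftrightarrow> (\<exists>q. q \<noteq> 0 \<and> g - h * q \<in> Pgt \<mu> (\<mu> g))"
proof
  assume "mu_dvd \<mu> h g"
  then obtain Z where Z: "Z \<in> Gcarrier \<mu>" "Hmu \<mu> g = Gmul \<mu> (Hmu \<mu> h) Z"
    by (auto simp: mu_dvd_def Gdvd_def)
  then have "homog (\<mu> g) g (\<mu> g) = cls \<mu> (\<mu> g) (h * rep (Z (\<mu> g - \<mu> h)))"
    by (simp add: Hmu_homog assms Gmul_homog_left)
  then have d: "g - h * rep (Z (\<mu> g - \<mu> h)) \<in> Pgt \<mu> (\<mu> g)"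
    by (simp add: homog_def cls_eq_iff)
  then have "rep (Z (\<mu> g - \<mu> h)) \<noteq> 0" using not_Pgt_val[OF assms(2)] by auto
  then show "\<exists>q. q \<noteq> 0 \<and> g - h * q \<in> Pgt \<mu> (\<mu> g)" using d by blast
next
  assume "\<exists>q. q \<noteq> 0 \<and> g - h * q \<in> Pgt \<mu> (\<mu> g)"
  then obtain q where q: "q \<noteq> 0" "g - h * q \<in> Pgt \<mu> (\<mu> g)" by blast
  then have "\<mu> g = \<mu> h + \<mu> q" using val_eq_of_diff(2)[OF assms(2) q(2)] val_mult assms q by metis
  then have "Hmu \<mu> g = Gmul \<mu> (Hmu \<mu> h) (homog (\<mu> q) q)"
    using q(2) by (simp add: Hmu_homog assms Gmul_homog homog_eq_iff)
  then show "mu_dvd \<mu> h g"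
    unfolding mu_dvd_def Gdvd_def using homog_carrier[OF Pge_val] by blast
qed

lemma Gmul_Gone: "Z \<in> Gcarrier \<mu> \<Longrightarrow> Gmul \<mu> (Gone \<mu>) Z = Z"
  using Gmul_homog_left[of 1 0 Z] carrier_rep(1)[of Z] by (simp add: Gone_homog Pge_def fun_eq_iff)

end

section \<open>Augmented valuations\<close>

lemma all_nat_split: "(\<forall>s::nat. P s) \<longleftrightarrow> P 0 \<and> (\<forall>s. P (Suc s))"
  by (metis not0_implies_Suc)

lemma phi_coeff_0: "phi_coeff \<phi> f 0 = f mod \<phi>"
  by (simp add: phi_coeff_def)

lemma phi_coeff_Suc: "phi_coeff \<phi> f (Suc s) = phi_coeff \<phi> (f div \<phi>) s"
  by (simp add: phi_coeff_def poly_div_mult_right)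

lemma phi_coeff_add: "phi_coeff \<phi> (f + g) s = phi_coeff \<phi> f s + phi_coeff \<phi> g s"
  by (simp add: phi_coeff_def poly_div_add_left poly_mod_add_left)

lemma phi_coeff_minus: "phi_coeff \<phi> (- f) s = - phi_coeff \<phi> f s"
  by (simp add: phi_coeff_def)

lemma degree_phi_coeff: "0 < degree \<phi> \<Longrightarrow> degree (phi_coeff \<phi> f s) < degree \<phi>"
  using degree_mod_less[of \<phi> "f div \<phi> ^ s"] by (force simp: phi_coeff_def)

lemma phi_coeff_eq_0: "0 < degree \<phi> \<Longrightarrow> degree f < s \<Longrightarrow> phi_coeff \<phi> f s = 0"
proof -
  assume "0 < degree \<phi>" "degree f < s"
  then have "degree f < degree (\<phi> ^ s)"
    by (metis degree_0 degree_power_eq less_irrefl less_le_trans mult.commute mult_le_mono1 nat_mult_1 Suc_leI One_nat_def)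
  then show ?thesis by (simp add: phi_coeff_def div_poly_less)
qed

text \<open>Induction along the expansion: division by \<open>\<phi>\<close> removes the lowest
  coefficient and lowers the degree, until the quotient of a reduced polynomial is 0.\<close>

lemma phi_induct [consumes 1, case_names 0 step]:
  fixes \<phi> :: "'k::field poly"
  assumes "0 < degree \<phi>" "P 0" "\<And>f. f \<noteq> 0 \<Longrightarrow> P (f div \<phi>) \<Longrightarrow> P f"
  shows "P f"
proof (induction "degree f" arbitrary: f rule: less_induct)
  case less
  show ?case
  proof (cases "degree f < degree \<phi>")
    case True
    then show ?thesis using assms by (metis div_poly_less)
  next
    case False
    then have "degree f > 0" using assms(1) by simp
    then have "degree (f div \<phi>) < degree f" using degree_div_less[of f \<phi>] assms(1) False by auto
    then show ?thesis using less assms(2,3) by metis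
  qed
qed

text \<open>Meant for products of two reduced polynomials: the quotient is again reduced, so its
  augmented value is its original value.\<close>

lemma degree_div_small:
  fixes f \<phi> :: "'k::field poly"
  assumes "0 < degree \<phi>" "degree f < degree \<phi> + degree \<phi>"
  shows "degree (f div \<phi>) < degree \<phi>"
proof (cases "f div \<phi> = 0")
  case False
  have "degree (\<phi> * (f div \<phi>)) = degree (f - f mod \<phi>)" by (simp add: minus_mod_eq_mult_div)
  also have "\<dots> < degree \<phi> + degree \<phi>"
    using assms degree_mod_less[of \<phi> f] by (intro degree_diff_less) force+
  finally show ?thesis using False assms(1) by (subst (asm) degree_mult_eq) auto
qed (use assms in simp)

lemma phi_expansion:
  assumes "0 < degree \<phi>"
  shows "\<exists>N. \<forall>s\<ge>N. phi_coeff \<phi> f s = 0"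
  using phi_coeff_eq_0[OF assms, of f] by (metis less_eq_Suc_le)

lemma sum_phi_coeff:
  assumes "0 < degree \<phi>" "\<forall>s\<ge>N. phi_coeff \<phi> f s = 0"
  shows "f = (\<Sum>s<N. phi_coeff \<phi> f s * \<phi> ^ s)"
  using assms
proof (induction f arbitrary: N rule: phi_induct)
  case 0
  then show ?case by (simp add: phi_coeff_def)
next
  case (step f)
  show ?case
  proof (cases N)
    case 0
    then have "phi_coeff \<phi> f s = 0" for s using step by simp
    then have "f mod \<phi> = 0" "\<forall>s. phi_coeff \<phi> (f div \<phi>) s = 0" by (metis phi_coeff_0, metis phi_coeff_Suc)
    then have "f div \<phi> = 0" using step(2)[of 0] by simp
    then have "f = 0" using \<open>f mod \<phi> = 0\<close> by (metis mod_div_mult_eq mult_zero_left add_0)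
    then show ?thesis using step by simp
  next
    case (Suc M)
    have "f div \<phi> = (\<Sum>s<M. phi_coeff \<phi> (f div \<phi>) s * \<phi> ^ s)"
      using step(3) Suc by (intro step(2)) (metis Suc_le_mono phi_coeff_Suc)
    moreover have "f = f mod \<phi> + \<phi> * (f div \<phi>)" by simp
    ultimately have "f = f mod \<phi> + \<phi> * (\<Sum>s<M. phi_coeff \<phi> f (Suc s) * \<phi> ^ s)"
      by (simp add: phi_coeff_Suc)
    then show ?thesis
      unfolding Suc sum.lessThan_Suc_shift by (simp add: phi_coeff_0 sum_distrib_left ac_simps)
  qed
qed

text \<open>These conditions only involve \<open>\<mu>\<close> on polynomials of degree below that of \<open>\<phi>\<close>. They hold both
  for a key polynomial \<open>\<phi>\<close> of a valuation \<open>\<mu>\<close> and for a linear \<open>\<phi>\<close> and a valuation of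
  the constants, so that all steps of a MacLane chain are covered.\<close>
locale augmentation =
  fixes \<mu> :: "'k::field poly \<Rightarrow> 'g::linordered_ab_group_add" and \<phi> :: "'k poly" and \<gamma> :: 'g
  assumes deg_pos: "0 < degree \<phi>"
    and red_add: "a \<noteq> 0 \<Longrightarrow> b \<noteq> 0 \<Longrightarrow> a + b \<noteq> 0 \<Longrightarrow> degree a < degree \<phi> \<Longrightarrow> degree b < degree \<phi> \<Longrightarrow>
      min (\<mu> a) (\<mu> b) \<le> \<mu> (a + b)"
    and red_mult: "a \<noteq> 0 \<Longrightarrow> b \<noteq> 0 \<Longrightarrow> degree a < degree \<phi> \<Longrightarrow> degree b < degree \<phi> \<Longrightarrow>
      (a * b) mod \<phi> \<noteq> 0 \<and> \<mu> ((a * b) mod \<phi>) = \<mu> a + \<mu> b \<and>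
      ((a * b) div \<phi> \<noteq> 0 \<longrightarrow> \<mu> a + \<mu> b < \<mu> ((a * b) div \<phi>) + \<gamma>)"
begin

abbreviation w where "w \<equiv> augment \<mu> \<phi> \<gamma>"

lemma deg_mod: "degree (f mod \<phi>) < degree \<phi>"
  using degree_phi_coeff[OF deg_pos, of f 0] by (simp add: phi_coeff_0)

text \<open>The bound on \<open>s\<close> in \<open>augment\<close> loses nothing, since the
  coefficients beyond \<open>degree f\<close> vanish.\<close>

lemma augment_set:
  "{\<mu> (phi_coeff \<phi> f s) + nsmul s \<gamma> | s. s \<le> degree f \<and> phi_coeff \<phi> f s \<noteq> 0} =
   (\<lambda>s. \<mu> (phi_coeff \<phi> f s) + nsmul s \<gamma>) ` {s. phi_coeff \<phi> f s \<noteq> 0}"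
  using phi_coeff_eq_0[OF deg_pos, of f] by (force simp: not_less[symmetric])

lemma finite_phi_support: "finite {s. phi_coeff \<phi> f s \<noteq> 0}"
  by (rule finite_subset[of _ "{..degree f}"]) (use phi_coeff_eq_0[OF deg_pos, of f] in \<open>auto simp: not_less[symmetric]\<close>)

lemma phi_support_nonempty: "f \<noteq> 0 \<Longrightarrow> {s. phi_coeff \<phi> f s \<noteq> 0} \<noteq> {}"
  using sum_phi_coeff[OF deg_pos, of 0 f] by auto

lemma Pge_w: "f \<in> Pge w \<alpha> \<longleftrightarrow> (\<forall>s. phi_coeff \<phi> f s = 0 \<or> \<alpha> \<le> \<mu> (phi_coeff \<phi> f s) + nsmul s \<gamma>)"
proof (cases "f = 0")
  case False
  then show ?thesis
    using phi_support_nonempty[of f] finite_phi_support[of f]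
    unfolding Pge_def mem_Collect_eq augment_def augment_set by (subst Min_ge_iff) auto
qed (simp add: Pge_def phi_coeff_def)

lemma Pgt_w: "f \<in> Pgt w \<alpha> \<longleftrightarrow> (\<forall>s. phi_coeff \<phi> f s = 0 \<or> \<alpha> < \<mu> (phi_coeff \<phi> f s) + nsmul s \<gamma>)"
proof (cases "f = 0")
  case False
  then show ?thesis
    using phi_support_nonempty[of f] finite_phi_support[of f]
    unfolding Pgt_def mem_Collect_eq augment_def augment_set by (subst Min_gr_iff) auto
qed (simp add: Pgt_def phi_coeff_def)

text \<open>Removing the lowest coefficient shifts the bound by \<open>\<gamma>\<close>. This is the
  form of the definition that fits \<open>phi_induct\<close>.\<close>

lemma Pge_rec: "f \<in> Pge w \<alpha> \<longleftrightarrow> f mod \<phi> \<in> Pge \<mu> \<alpha> \<and> f div \<phi> \<in> Pge w (\<alpha> - \<gamma>)"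
  unfolding Pge_w by (subst all_nat_split) (simp add: phi_coeff_0 phi_coeff_Suc Pge_def algebra_simps)

lemma Pgt_rec: "f \<in> Pgt w \<alpha> \<longleftrightarrow> f mod \<phi> \<in> Pgt \<mu> \<alpha> \<and> f div \<phi> \<in> Pgt w (\<alpha> - \<gamma>)"
  unfolding Pgt_w by (subst all_nat_split) (simp add: phi_coeff_0 phi_coeff_Suc Pgt_def algebra_simps)

lemma w_Pge_0 [simp]: "0 \<in> Pge w \<alpha>" and w_Pgt_0 [simp]: "0 \<in> Pgt w \<alpha>"
  by (simp_all add: Pge_def Pgt_def)

lemma w_eqI: "f \<noteq> 0 \<Longrightarrow> f \<in> Pge w \<alpha> \<Longrightarrow> f \<notin> Pgt w \<alpha> \<Longrightarrow> w f = \<alpha>"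
  by (auto simp: Pge_def Pgt_def)

lemma small_Pge: "degree a < degree \<phi> \<Longrightarrow> a \<in> Pge w \<alpha> \<longleftrightarrow> a \<in> Pge \<mu> \<alpha>"
  and small_Pgt: "degree a < degree \<phi> \<Longrightarrow> a \<in> Pgt w \<alpha> \<longleftrightarrow> a \<in> Pgt \<mu> \<alpha>"
  using Pge_rec[of a \<alpha>] Pgt_rec[of a \<alpha>] by (simp_all add: div_poly_less mod_poly_less)

lemma w_small: "degree a < degree \<phi> \<Longrightarrow> a \<noteq> 0 \<Longrightarrow> w a = \<mu> a"
  by (intro w_eqI) (simp_all add: small_Pge small_Pgt, simp_all add: Pge_def Pgt_def)

lemma phi_nz: "\<phi> \<noteq> 0"
  using deg_pos by auto

lemma Pge_phi_mult: "\<phi> * f \<in> Pge w \<alpha> \<longleftrightarrow> f \<in> Pge w (\<alpha> - \<gamma>)"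
  and Pgt_phi_mult: "\<phi> * f \<in> Pgt w \<alpha> \<longleftrightarrow> f \<in> Pgt w (\<alpha> - \<gamma>)"
  using phi_nz by (simp_all add: Pge_rec[of "\<phi> * f"] Pgt_rec[of "\<phi> * f"]) (simp_all add: Pge_def Pgt_def)

lemma w_Pge_add:
  assumes "f \<in> Pge w \<alpha>" "g \<in> Pge w \<alpha>"
  shows "f + g \<in> Pge w \<alpha>"
  unfolding Pge_w phi_coeff_add
proof
  fix s
  let ?a = "phi_coeff \<phi> f s" and ?b = "phi_coeff \<phi> g s"
  have "min (\<mu> ?a) (\<mu> ?b) \<le> \<mu> (?a + ?b)" if "?a \<noteq> 0" "?b \<noteq> 0" "?a + ?b \<noteq> 0"
    using that by (intro red_add degree_phi_coeff deg_pos)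
  moreover have "?a = 0 \<or> \<alpha> - nsmul s \<gamma> \<le> \<mu> ?a" "?b = 0 \<or> \<alpha> - nsmul s \<gamma> \<le> \<mu> ?b"
    using assms unfolding Pge_w by (simp_all add: algebra_simps)
  ultimately have "?a + ?b = 0 \<or> \<alpha> - nsmul s \<gamma> \<le> \<mu> (?a + ?b)"
    by (cases "?a = 0 \<or> ?b = 0") (auto intro: order_trans[rotated])
  then show "?a + ?b = 0 \<or> \<alpha> \<le> \<mu> (?a + ?b) + nsmul s \<gamma>"
    by (simp add: diff_le_eq)
qed

lemma w_Pgt_add:
  assumes "f \<in> Pgt w \<alpha>" "g \<in> Pgt w \<alpha>"
  shows "f + g \<in> Pgt w \<alpha>"
proof (cases "f = 0 \<or> g = 0 \<or> f + g = 0")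
  case False
  have "f + g \<in> Pge w (min (w f) (w g))" by (intro w_Pge_add) (simp_all add: Pge_def)
  then have le: "min (w f) (w g) \<le> w (f + g)" using False by (simp add: Pge_def)
  have "\<alpha> < min (w f) (w g)" using False assms by (simp add: Pgt_def)
  then have "\<alpha> < w (f + g)" using le by (rule less_le_trans)
  then show ?thesis by (simp add: Pgt_def)
qed (use assms in auto)

lemma red_minus: "degree a < degree \<phi> \<Longrightarrow> \<mu> (- a) = \<mu> a"
proof (cases "a = 0")
  case False
  assume a: "degree a < degree \<phi>"
  have m: "a mod \<phi> = a" "1 mod \<phi> = 1" "(- a) mod \<phi> = - a" using a deg_pos by (simp_all add: mod_poly_less)
  have 1: "\<mu> 1 = 0" using red_mult[of 1 1] deg_pos m by simp
  have "\<mu> (- 1) + \<mu> (- 1) = 0" using red_mult[of "- 1" "- 1"] deg_pos m 1 by simp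
  then have "\<mu> (- 1) = 0" by (simp add: double_zero)
  then show ?thesis using red_mult[of "- 1" a] a deg_pos m False by simp
qed simp

lemma w_Pgt_minus: "f \<in> Pgt w \<alpha> \<Longrightarrow> - f \<in> Pgt w \<alpha>"
  unfolding Pgt_w phi_coeff_minus by (simp add: red_minus degree_phi_coeff deg_pos)

lemma w_Pgt_diff: "f \<in> Pgt w \<alpha> \<Longrightarrow> g \<in> Pgt w \<alpha> \<Longrightarrow> f - g \<in> Pgt w \<alpha>"
  using w_Pgt_add[of f \<alpha> "- g"] w_Pgt_minus by simp

section \<open>Multiplicativity of the augmented valuation\<close>

lemma w_Pge_small_mult:
  assumes a: "degree a < degree \<phi>" "a \<in> Pge \<mu> \<alpha>"
  shows "g \<in> Pge w \<beta> \<Longrightarrow> a * g \<in> Pge w (\<alpha> + \<beta>)"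
  using deg_pos
proof (induction g arbitrary: \<beta> rule: phi_induct)
  case (step g)
  let ?b = "g mod \<phi>"
  have b: "?b \<in> Pge \<mu> \<beta>" "g div \<phi> \<in> Pge w (\<beta> - \<gamma>)" using step(3) unfolding Pge_rec[of g \<beta>] by blast+
  have "a * ?b \<in> Pge w (\<alpha> + \<beta>)"
  proof (cases "a = 0 \<or> ?b = 0")
    case False
    have "\<alpha> + \<beta> \<le> \<mu> a + \<mu> ?b" using False a(2) b(1) by (auto simp: Pge_def add_mono)
    \<comment> \<open>The expansion of a product of two reduced polynomials has at most two terms,
      and \<open>red_mult\<close> bounds both.\<close>
    moreover have "degree (a * ?b div \<phi>) < degree \<phi>"
    proof -
      have "degree (a * ?b) < degree \<phi> + degree \<phi>"
        using degree_mult_le[of a ?b] a(1) deg_mod[of g] by linarith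
      then show ?thesis by (rule degree_div_small[OF deg_pos])
    qed
    ultimately show ?thesis
      using red_mult[OF _ _ a(1) deg_mod, of g] False
      unfolding Pge_rec[of "a * ?b" "\<alpha> + \<beta>"] by (auto simp: small_Pge, auto simp: Pge_def algebra_simps)
  qed auto
  moreover have "\<phi> * (a * (g div \<phi>)) \<in> Pge w (\<alpha> + \<beta>)"
    unfolding Pge_phi_mult using step(2)[OF b(2)] by (simp add: algebra_simps)
  ultimately have "a * ?b + \<phi> * (a * (g div \<phi>)) \<in> Pge w (\<alpha> + \<beta>)" by (rule w_Pge_add)
  moreover have "a * ?b + \<phi> * (a * (g div \<phi>)) = a * g"
    by (metis distrib_left mod_mult_div_eq mult.left_commute)
  ultimately show ?case by simp
qed simp

lemma phi_split_mult: "f * g = (f mod \<phi>) * g + \<phi> * ((f div \<phi>) * g)"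
  by (metis distrib_right mod_mult_div_eq mult.assoc)

lemma w_Pge_mult: "f \<in> Pge w \<alpha> \<Longrightarrow> g \<in> Pge w \<beta> \<Longrightarrow> f * g \<in> Pge w (\<alpha> + \<beta>)"
  using deg_pos
proof (induction f arbitrary: \<alpha> rule: phi_induct)
  case (step f)
  have "f div \<phi> * g \<in> Pge w (\<alpha> - \<gamma> + \<beta>)" using step Pge_rec by blast
  moreover have "f mod \<phi> * g \<in> Pge w (\<alpha> + \<beta>)"
    using step(3,4) unfolding Pge_rec[of f \<alpha>] by (intro w_Pge_small_mult deg_mod) auto
  ultimately show ?case
    unfolding phi_split_mult[of f g] by (intro w_Pge_add) (simp_all add: Pge_phi_mult algebra_simps)
qed simp

lemma w_Pge_self [simp]: "f \<in> Pge w (w f)"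
  by (simp add: Pge_def)

lemma w_Pgt_self: "f \<noteq> 0 \<Longrightarrow> f \<notin> Pgt w (w f)"
  by (simp add: Pgt_def)

lemma w_Pgt_mult: "f \<in> Pgt w \<alpha> \<Longrightarrow> g \<in> Pge w \<beta> \<Longrightarrow> f * g \<in> Pgt w (\<alpha> + \<beta>)"
proof (cases "f = 0 \<or> g = 0")
  case False
  assume "f \<in> Pgt w \<alpha>" "g \<in> Pge w \<beta>"
  then have "\<alpha> + \<beta> < w f + w g" using False by (auto simp: Pgt_def Pge_def intro: add_less_le_mono)
  moreover have "f * g \<in> Pge w (w f + w g)" by (intro w_Pge_mult) simp_all
  ultimately show ?thesis by (auto simp: Pgt_def Pge_def)
qed auto

text \<open>If the lowest coefficient of \<open>f\<close> does not attain the value of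
  \<open>f\<close>, it can be discarded modulo larger values. What is left is \<open>\<phi>\<close>
  times the quotient, whose value is \<open>w f - \<gamma>\<close>, and the claim descends to the
  quotient.\<close>

lemma w_not_Pgt_step:
  assumes f: "f \<noteq> 0" and a: "f mod \<phi> \<in> Pgt \<mu> (w f)"
    and IH: "f div \<phi> \<noteq> 0 \<Longrightarrow> f div \<phi> * g \<notin> Pgt w (w (f div \<phi>) + w g)"
  shows "f * g \<notin> Pgt w (w f + w g)"
proof
  have q: "f div \<phi> \<in> Pge w (w f - \<gamma>)" "f div \<phi> \<notin> Pgt w (w f - \<gamma>)"
    using w_Pgt_self[OF f] a Pgt_rec Pge_rec w_Pge_self by blast+
  then have q0: "f div \<phi> \<noteq> 0" by auto
  have wq: "w (f div \<phi>) = w f - \<gamma>" using w_eqI[OF q0 q] .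
  assume *: "f * g \<in> Pgt w (w f + w g)"
  have "f mod \<phi> * g \<in> Pgt w (w f + w g)"
    using a by (intro w_Pgt_mult) (simp_all add: small_Pgt deg_mod)
  then have "\<phi> * (f div \<phi> * g) \<in> Pgt w (w f + w g)"
    using w_Pgt_diff[OF *] phi_split_mult[of f g] by (metis add_diff_cancel_left')
  then show False using IH[OF q0] by (simp add: Pgt_phi_mult wq algebra_simps)
qed

text \<open>A double induction strips lowest coefficients until those of both factors attain the
  values of the factors. Then the remainder of the product has exactly the sum of these values by
  \<open>red_mult\<close>, and no other term can cancel it, because \<open>Pgt_rec\<close> tests the
  remainder separately.\<close>

lemma w_not_Pgt_mult: "f \<noteq> 0 \<Longrightarrow> g \<noteq> 0 \<Longrightarrow> f * g \<notin> Pgt w (w f + w g)"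
  using deg_pos
proof (induction f arbitrary: g rule: phi_induct)
  case (step f)
  note f = step(1) and IHf = step(2)
  show ?case
  proof (cases "f mod \<phi> \<in> Pgt \<mu> (w f)")
    case True
    then show ?thesis using w_not_Pgt_step f IHf step(4) by blast
  next
    case False
    show ?thesis using deg_pos \<open>g \<noteq> 0\<close>
    proof (induction g rule: phi_induct)
      case (step g)
      show ?case
      proof (cases "g mod \<phi> \<in> Pgt \<mu> (w g)")
        case True
        then show ?thesis
          using w_not_Pgt_step[of g f] step by (simp add: ac_simps)
      next
        case Fg: False
        let ?a = "f mod \<phi>" and ?b = "g mod \<phi>"
        have "?a \<in> Pge \<mu> (w f)" "?b \<in> Pge \<mu> (w g)" using Pge_rec w_Pge_self by blast+
        then have ab: "?a \<noteq> 0" "?b \<noteq> 0" "\<mu> ?a = w f" "\<mu> ?b = w g"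
          using False Fg by (auto simp: Pge_def Pgt_def)
        have "(f * g) mod \<phi> = (?a * ?b) mod \<phi>" by (simp add: mod_mult_eq)
        then have "(f * g) mod \<phi> \<noteq> 0" "\<mu> ((f * g) mod \<phi>) = w f + w g"
          using red_mult[OF ab(1,2) deg_mod deg_mod] ab by simp_all
        then have "(f * g) mod \<phi> \<notin> Pgt \<mu> (w f + w g)" by (simp add: Pgt_def)
        then show ?thesis using Pgt_rec by blast
      qed
    qed simp
  qed
qed simp

sublocale aug: poly_valuation w
proof
  fix f g :: "'k poly" assume nz: "f \<noteq> 0" "g \<noteq> 0"
  show "w (f * g) = w f + w g"
    using nz by (intro w_eqI w_Pge_mult w_not_Pgt_mult) simp_all
  assume "f + g \<noteq> 0"
  moreover have "f + g \<in> Pge w (min (w f) (w g))" by (intro w_Pge_add) (simp_all add: Pge_def)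
  ultimately show "min (w f) (w g) \<le> w (f + g)" by (simp add: Pge_def)
qed

lemma w_phi: "w \<phi> = \<gamma>"
proof -
  have "w 1 = 0" by simp
  then show ?thesis using Pge_phi_mult[of 1 \<gamma>] Pgt_phi_mult[of 1 \<gamma>] phi_nz
    by (intro w_eqI) (simp_all add: Pge_def Pgt_def)
qed

section \<open>Reduced polynomials have invertible initial forms\<close>

lemma ex_inverse_mod:
  assumes "a \<noteq> 0" "degree a < degree \<phi>"
  shows "\<exists>b. b \<noteq> 0 \<and> degree b < degree \<phi> \<and> (a * b) mod \<phi> = 1"
  using assms
proof (induction "degree a" arbitrary: a rule: less_induct)
  case less
  have 1: "1 mod \<phi> = 1" using deg_pos by (simp add: mod_poly_less)
  have "\<exists>b. (a * b) mod \<phi> = 1"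
  proof (cases "degree a = 0")
    case True
    then obtain c where "a = [:c:]" by (metis degree_eq_zeroE)
    then have "a * [:1 / c:] = 1" using less(2) by simp
    then show ?thesis using 1 by metis
  next
    case False
    let ?q = "\<phi> div a" and ?r = "\<phi> mod a"
    have q: "?q \<noteq> 0" "degree ?q < degree \<phi>"
      using less(2,3) False degree_div_less[of \<phi> a] by (auto simp: div_poly_eq_0_iff)
    have r: "?r = \<phi> - a * ?q" by (simp add: minus_mult_div_eq_mod)
    \<comment> \<open>A zero remainder would make \<open>\<phi>\<close> a product of two reduced
      polynomials, against \<open>red_mult\<close>. This takes the place of irreducibility in the
      Euclidean argument, which continues with \<open>?r\<close> instead of
      \<open>a\<close>.\<close>
    have "?r \<noteq> 0"
    proof
      assume "?r = 0"
      then have "a * ?q = \<phi>" using r by simp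
      then show False using red_mult[OF less(2) q(1) less(3) q(2)] by simp
    qed
    moreover have rd: "degree ?r < degree a" using degree_mod_less'[OF less(2)] \<open>?r \<noteq> 0\<close> by simp
    ultimately obtain b where b: "(?r * b) mod \<phi> = 1" using less by (meson less_trans)
    have "a * (- ?q * b) = ?r * b - \<phi> * b" unfolding r by (simp add: algebra_simps)
    then have "(a * (- ?q * b)) mod \<phi> = 1" using b by (simp add: poly_mod_diff_left)
    then show ?thesis by blast
  qed
  then obtain b where b: "(a * b) mod \<phi> = 1" by blast
  then have "(a * (b mod \<phi>)) mod \<phi> = 1" by (simp add: mod_mult_right_eq)
  moreover from this have "b mod \<phi> \<noteq> 0" by (metis mod_0 mult_zero_right zero_neq_one)
  ultimately show ?case using deg_mod by blast
qed

text \<open>The inverse modulo \<open>\<phi>\<close> has the opposite value, because the remainder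
  of the product is 1. The strict inequality in \<open>red_mult\<close> then pushes the remaining
  multiple of \<open>\<phi>\<close> above value 0.\<close>

lemma small_initial_inverse:
  assumes a: "a \<noteq> 0" "degree a < degree \<phi>"
  obtains b where "aug.initial_inverse a b"
proof -
  obtain b where b: "b \<noteq> 0" "degree b < degree \<phi>" "(a * b) mod \<phi> = 1"
    using ex_inverse_mod[OF a] by blast
  note R = red_mult[OF a(1) b(1) a(2) b(2)]
  have "\<mu> 1 = 0" using w_small[of 1] deg_pos by simp
  then have s: "\<mu> a + \<mu> b = 0" using R b(3) by simp
  have "a * b - 1 = \<phi> * (a * b div \<phi>)"
    using b(3) by (metis minus_mod_eq_mult_div)
  moreover have "degree (a * b div \<phi>) < degree \<phi>"
    using degree_mult_le[of a b] a(2) b(2) by (intro degree_div_small deg_pos) linarith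
  then have "a * b div \<phi> \<in> Pgt w (- \<gamma>)"
    using R s less_diff_eq[of 0 "\<mu> (a * b div \<phi>)" "- \<gamma>"]
    by (auto simp: small_Pgt, auto simp: Pgt_def)
  ultimately have "a * b - 1 \<in> Pgt w 0" by (simp add: Pgt_phi_mult)
  moreover have "\<mu> b = - \<mu> a" using s by (metis add.commute add_eq_0_iff)
  then have "b \<in> Pge w (- w a)" using a b by (simp add: w_small small_Pge) (simp add: Pge_def)
  ultimately show thesis using that a by (auto simp: aug.initial_inverse_def)
qed

lemmas augment_poly_valuation = aug.poly_valuation_axioms

end

section \<open>Key polynomials\<close>

context poly_valuation
begin

context
  fixes \<phi> assumes key: "key_poly \<mu> \<phi>"
begin

lemma key_nz: "\<phi> \<noteq> 0"
  using key by (auto simp: key_poly_def)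

text \<open>A monic constant is 1 and generates the whole graded algebra, which is not a prime
  ideal.\<close>

lemma key_degree_pos: "0 < degree \<phi>"
proof (rule ccontr)
  assume "\<not> 0 < degree \<phi>"
  then have "\<phi> = 1" using key by (auto simp: key_poly_def elim: degree_eq_zeroE)
  then have "Gideal \<mu> (Hmu \<mu> \<phi>) = Gcarrier \<mu>"
    unfolding Gideal_def using Gmul_Gone by (force simp flip: Gone_def)
  then show False using key by (simp add: key_poly_def Gprime_ideal_def)
qed

lemma key_small_not_dvd: "f \<noteq> 0 \<Longrightarrow> degree f < degree \<phi> \<Longrightarrow> \<not> mu_dvd \<mu> \<phi> f"
  using key by (simp add: key_poly_def)

lemma key_not_dvd_mult:
  assumes "f \<noteq> 0" "g \<noteq> 0" "\<not> mu_dvd \<mu> \<phi> f" "\<not> mu_dvd \<mu> \<phi> g"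
  shows "\<not> mu_dvd \<mu> \<phi> (f * g)"
proof
  have dvd: "mu_dvd \<mu> \<phi> h \<longleftrightarrow> Hmu \<mu> h \<in> Gideal \<mu> (Hmu \<mu> \<phi>)" for h
    by (auto simp: mu_dvd_def Gdvd_def Gideal_def)
  have H: "Hmu \<mu> h \<in> Gcarrier \<mu>" if "h \<noteq> 0" for h
    using that by (simp add: Hmu_homog homog_carrier)
  assume "mu_dvd \<mu> \<phi> (f * g)"
  moreover have "Hmu \<mu> (f * g) = Gmul \<mu> (Hmu \<mu> f) (Hmu \<mu> g)"
    using assms(1,2) by (simp add: Hmu_homog Gmul_homog val_mult)
  ultimately show False
    using key H assms dvd unfolding key_poly_def Gprime_ideal_def by metis
qed

text \<open>Key polynomials are \<open>\<mu>\<close>-minimal: no cancellation of initial forms can occur between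
  the remainder and a multiple of \<open>\<phi>\<close>.\<close>
lemma key_Pge_mod_div:
  assumes "f \<in> Pge \<mu> \<alpha>"
  shows "f mod \<phi> \<in> Pge \<mu> \<alpha>" "\<phi> * (f div \<phi>) \<in> Pge \<mu> \<alpha>"
proof -
  let ?c = "f mod \<phi>" and ?q = "f div \<phi>"
  have f: "f = ?c + \<phi> * ?q" by simp
  show c: "?c \<in> Pge \<mu> \<alpha>"
  proof (rule ccontr)
    assume n: "?c \<notin> Pge \<mu> \<alpha>"
    then have c: "?c \<noteq> 0" "\<mu> ?c < \<alpha>" by (auto simp: Pge_def)
    then have "f \<in> Pgt \<mu> (\<mu> ?c)" using assms by (auto simp: Pge_def Pgt_def)
    then have p: "?c - \<phi> * (- ?q) \<in> Pgt \<mu> (\<mu> ?c)" using f by simp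
    moreover have "?q \<noteq> 0" using n assms f by (metis mult_zero_right add.right_neutral)
    ultimately have "mu_dvd \<mu> \<phi> ?c"
      using mu_dvd_iff[OF key_nz c(1)] by (metis neg_equal_0_iff_equal)
    moreover have "degree ?c < degree \<phi>"
      using degree_mod_less[of \<phi> f] key_nz key_degree_pos by force
    ultimately show False using key_small_not_dvd c by blast
  qed
  have "- ?c \<in> Pge \<mu> \<alpha>" using c by (simp add: Pge_def)
  then have "f + - ?c \<in> Pge \<mu> \<alpha>" using assms by (rule Pge_add[rotated])
  then show "\<phi> * ?q \<in> Pge \<mu> \<alpha>" using f by (simp add: minus_mod_eq_mult_div)
qed

text \<open>If the remainder had larger value than \<open>f\<close>, then \<open>f\<close> would be
  congruent to a multiple of \<open>\<phi>\<close>.\<close>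

lemma key_not_dvd_mod:
  assumes "f \<noteq> 0" "\<not> mu_dvd \<mu> \<phi> f"
  shows "f mod \<phi> \<noteq> 0" "\<mu> (f mod \<phi>) = \<mu> f"
proof -
  have "f mod \<phi> \<notin> Pgt \<mu> (\<mu> f)"
  proof
    assume p: "f mod \<phi> \<in> Pgt \<mu> (\<mu> f)"
    then have "f - \<phi> * (f div \<phi>) \<in> Pgt \<mu> (\<mu> f)" by (simp add: minus_mult_div_eq_mod)
    moreover have "f div \<phi> \<noteq> 0"
      using p not_Pgt_val[OF assms(1)] by (metis mod_mult_div_eq mult_zero_right add.right_neutral)
    ultimately show False using mu_dvd_iff[OF key_nz assms(1)] assms(2) by blast
  qed
  moreover have "f mod \<phi> \<in> Pge \<mu> (\<mu> f)" by (rule key_Pge_mod_div) simp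
  ultimately show "f mod \<phi> \<noteq> 0" "\<mu> (f mod \<phi>) = \<mu> f" by (auto simp: Pge_def Pgt_def)
qed

context
  fixes \<gamma> assumes gt: "\<mu> \<phi> < \<gamma>"
begin

text \<open>A multiple of \<open>\<phi>\<close> split off by division has value at least
  \<open>\<alpha>\<close>; raising the value of \<open>\<phi>\<close> from
  \<open>\<mu> \<phi>\<close> to \<open>\<gamma>\<close> makes the bound strict.\<close>

lemma key_div_bound:
  assumes "f \<in> Pge \<mu> \<alpha>" "f div \<phi> \<noteq> 0"
  shows "\<alpha> < \<mu> (f div \<phi>) + \<gamma>"
proof -
  have "\<alpha> \<le> \<mu> (\<phi> * (f div \<phi>))"
    using key_Pge_mod_div(2)[OF assms(1)] assms(2) key_nz by (simp add: Pge_def)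
  also have "\<dots> = \<mu> (f div \<phi>) + \<mu> \<phi>" using assms(2) key_nz by (simp add: val_mult add.commute)
  also have "\<dots> < \<mu> (f div \<phi>) + \<gamma>" using gt by simp
  finally show ?thesis .
qed

lemma key_augmentation: "augmentation \<mu> \<phi> \<gamma>"
proof
  show "0 < degree \<phi>" by (rule key_degree_pos)
next
  fix a b :: "'k poly" assume "a \<noteq> 0" "b \<noteq> 0" "a + b \<noteq> 0"
  then show "min (\<mu> a) (\<mu> b) \<le> \<mu> (a + b)" by (rule val_add)
next
  fix a b :: "'k poly" assume ab: "a \<noteq> 0" "b \<noteq> 0" "degree a < degree \<phi>" "degree b < degree \<phi>"
  then have "\<not> mu_dvd \<mu> \<phi> (a * b)" by (intro key_not_dvd_mult key_small_not_dvd)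
  moreover have "a * b \<noteq> 0" "\<mu> (a * b) = \<mu> a + \<mu> b" using ab by (simp_all add: val_mult)
  ultimately show "(a * b) mod \<phi> \<noteq> 0 \<and> \<mu> ((a * b) mod \<phi>) = \<mu> a + \<mu> b \<and>
      ((a * b) div \<phi> \<noteq> 0 \<longrightarrow> \<mu> a + \<mu> b < \<mu> ((a * b) div \<phi>) + \<gamma>)"
    using key_not_dvd_mod[of "a * b"] key_div_bound[OF Pge_val, of "a * b"] by simp
qed

interpretation key: augmentation \<mu> \<phi> \<gamma>
  by (rule key_augmentation)

section \<open>Comparison of a valuation with its augmentation\<close>

lemma augment_Pge: "f \<in> Pge \<mu> \<alpha> \<Longrightarrow> f \<in> Pge (augment \<mu> \<phi> \<gamma>) \<alpha>"
  using key_degree_pos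
proof (induction f arbitrary: \<alpha> rule: phi_induct)
  case (step f)
  have "f div \<phi> \<in> Pge \<mu> (\<alpha> - \<gamma>)"
    using key_div_bound[OF step(3)]
    by (cases "f div \<phi> = 0") (auto simp: Pge_def diff_le_eq less_imp_le)
  then show ?case
    using step(2) key_Pge_mod_div(1)[OF step(3)] key.Pge_rec by blast
qed simp

lemma augment_ge: "f \<noteq> 0 \<Longrightarrow> \<mu> f \<le> augment \<mu> \<phi> \<gamma> f"
  using augment_Pge[of f "\<mu> f"] by (simp add: Pge_def)

lemma augment_Pgt: "f \<in> Pgt \<mu> \<alpha> \<Longrightarrow> f \<in> Pgt (augment \<mu> \<phi> \<gamma>) \<alpha>"
  using augment_ge[of f] less_le_trans by (cases "f = 0") (auto simp: Pgt_def)

text \<open>Modulo larger augmented values \<open>f\<close> equals its remainder, since the multiple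
  of \<open>\<phi>\<close> gains value. An inverse of the reduced remainder therefore also inverts
  \<open>f\<close>.\<close>

lemma augment_not_dvd_inverse:
  assumes f: "f \<noteq> 0" "\<not> mu_dvd \<mu> \<phi> f"
  shows "augment \<mu> \<phi> \<gamma> f = \<mu> f" "\<exists>g. key.aug.initial_inverse f g"
proof -
  let ?c = "f mod \<phi>" and ?q = "f div \<phi>"
  note c = key_not_dvd_mod[OF f]
  have wc: "key.w ?c = \<mu> f" using key.w_small[OF key.deg_mod c(1)] c(2) by simp
  have "?q \<in> Pgt key.w (\<mu> f - \<gamma>)"
  proof (cases "?q = 0")
    case False
    have "\<mu> f < \<mu> ?q + \<gamma>" using key_div_bound[OF _ False, of "\<mu> f"] by simp
    also have "\<dots> \<le> key.w ?q + \<gamma>" using augment_ge[OF False] by simp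
    finally show ?thesis by (simp add: Pgt_def algebra_simps)
  qed simp
  then have "\<phi> * ?q \<in> Pgt key.w (\<mu> f)" by (simp add: key.Pgt_phi_mult)
  then have fc: "f - ?c \<in> Pgt key.w (\<mu> f)" by (simp add: minus_mod_eq_mult_div)
  then show wf: "key.w f = \<mu> f"
    using key.aug.val_eq_of_diff(2)[OF c(1), of f] key.aug.Pgt_diff_commute wc by simp
  obtain g where g: "key.aug.initial_inverse ?c g"
    using key.small_initial_inverse[OF c(1) key.deg_mod] by blast
  then have g': "g \<in> Pge key.w (- \<mu> f)" "?c * g - 1 \<in> Pgt key.w 0"
    using wc by (simp_all add: key.aug.initial_inverse_def)
  have "(f - ?c) * g \<in> Pgt key.w 0" using key.aug.Pgt_mult[OF fc g'(1)] by simp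
  then have "(f - ?c) * g + (?c * g - 1) \<in> Pgt key.w 0" using g'(2) by (rule key.aug.Pgt_add)
  then have "f * g - 1 \<in> Pgt key.w 0" by (simp add: left_diff_distrib)
  then show "\<exists>g. key.aug.initial_inverse f g"
    using f(1) g'(1) wf by (auto simp: key.aug.initial_inverse_def)
qed

text \<open>Augmentation can only raise values. The product \<open>f * g\<close> has value 0 before
  and after, so neither factor can have been raised.\<close>

lemma augment_initial_inverse:
  assumes "initial_inverse f g"
  shows "augment \<mu> \<phi> \<gamma> f = \<mu> f" "key.aug.initial_inverse f g"
proof -
  have f: "f \<noteq> 0" and g: "g \<in> Pge \<mu> (- \<mu> f)" and fg: "f * g - 1 \<in> Pgt \<mu> 0"
    using assms by (auto simp: initial_inverse_def)
  have fg': "f * g - 1 \<in> Pgt key.w 0" using fg by (rule augment_Pgt)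
  have m: "f * g \<noteq> 0" "\<mu> (f * g) = 0"
    using val_eq_of_diff[of 1 "f * g"] fg Pgt_diff_commute by simp_all
  have w: "key.w (f * g) = 0"
    using key.aug.val_eq_of_diff[of 1 "f * g"] fg' key.aug.Pgt_diff_commute by simp
  have g0: "g \<noteq> 0" using m by auto
  have le: "\<mu> f \<le> key.w f" "\<mu> g \<le> key.w g" using f g0 by (simp_all add: augment_ge)
  have "\<mu> f + \<mu> g = key.w f + key.w g" using m w f g0 by (simp add: val_mult key.aug.val_mult)
  then have "\<not> \<mu> f < key.w f" using le add_less_le_mono by fastforce
  then show wf: "key.w f = \<mu> f" using le by simp
  show "key.aug.initial_inverse f g"
    using f fg' augment_Pge[OF g] wf by (simp add: key.aug.initial_inverse_def)
qed

end

end

end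

text \<open>For linear \<open>\<phi>\<close> the reduced polynomials are the constants. Their
  products have quotient 0, so the inequality involving \<open>\<gamma>\<close> holds
  vacuously.\<close>

lemma mu_minus1_augmentation:
  assumes v: "is_valuation_field v" and phi: "degree \<phi> = 1"
  shows "augmentation (mu_minus1 v) \<phi> \<gamma>"
proof
  show "0 < degree \<phi>" using phi by simp
next
  fix a b :: "'a poly"
  assume "a \<noteq> 0" "b \<noteq> 0" "a + b \<noteq> 0" "degree a < degree \<phi>" "degree b < degree \<phi>"
  moreover from this obtain c d where "a = [:c:]" "b = [:d:]"
    using phi by (metis degree_eq_zeroE less_one)
  ultimately show "min (mu_minus1 v a) (mu_minus1 v b) \<le> mu_minus1 v (a + b)"
    using v by (simp add: mu_minus1_def is_valuation_field_def)
next
  fix a b :: "'a poly"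
  assume ab: "a \<noteq> 0" "b \<noteq> 0" "degree a < degree \<phi>" "degree b < degree \<phi>"
  then obtain c d where cd: "a = [:c:]" "b = [:d:]"
    using phi by (metis degree_eq_zeroE less_one)
  then have "degree (a * b) < degree \<phi>" using phi by simp
  then have "(a * b) mod \<phi> = a * b" "(a * b) div \<phi> = 0"
    by (rule mod_poly_less, rule div_poly_less)
  then show "(a * b) mod \<phi> \<noteq> 0 \<and> mu_minus1 v ((a * b) mod \<phi>) = mu_minus1 v a + mu_minus1 v b \<and>
      ((a * b) div \<phi> \<noteq> 0 \<longrightarrow> mu_minus1 v a + mu_minus1 v b < mu_minus1 v ((a * b) div \<phi>) + \<gamma>)"
    using v ab cd by (simp add: mu_minus1_def is_valuation_field_def)
qed

section \<open>Lattice bases\<close>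

text \<open>\<open>zspan\<close> sums over a set of generators, in which repeated values coincide,
  whereas coordinates are indexed by position.\<close>

lemma zspan_image_lessThan:
  "zspan (b ` {..<n}) = {\<Sum>j<n. zsmul (c j) (b j) | c. True}" for b :: "nat \<Rightarrow> 'g::ab_group_add"
proof
  let ?C = "{\<Sum>j<n. zsmul (c j) (b j) | c. True}"
  show "zspan (b ` {..<n}) \<subseteq> ?C"
    unfolding zspan_eq_span
  proof (rule zmod.span_minimal)
    show "b ` {..<n} \<subseteq> ?C"
    proof safe
      fix i assume i: "i < n"
      have "b i = (\<Sum>j<n. zsmul (if j = i then 1 else 0) (b j))"
        using i by (simp add: if_distrib[of "\<lambda>k. zsmul k _"] sum.delta cong: if_cong)
      then show "\<exists>c. b i = (\<Sum>j<n. zsmul (c j) (b j)) \<and> True"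
        by (intro exI[of _ "\<lambda>j. if j = i then 1 else 0"] conjI TrueI)
    qed
    show "zmod.subspace ?C"
    proof (rule zmod.subspaceI)
      have "0 = (\<Sum>j<n. zsmul 0 (b j))" by simp
      then show "0 \<in> ?C" unfolding mem_Collect_eq by (intro exI[of _ "\<lambda>_. 0"] conjI TrueI)
    next
      fix x y assume "x \<in> ?C" "y \<in> ?C"
      then obtain c d where "x = (\<Sum>j<n. zsmul (c j) (b j))" "y = (\<Sum>j<n. zsmul (d j) (b j))" by blast
      then have "x + y = (\<Sum>j<n. zsmul (c j + d j) (b j))"
        by (simp add: zmod.scale_left_distrib sum.distrib)
      then show "x + y \<in> ?C"
        unfolding mem_Collect_eq by (intro exI[of _ "\<lambda>j. c j + d j"] conjI TrueI)
    next
      fix k x assume "x \<in> ?C"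
      then obtain c where "x = (\<Sum>j<n. zsmul (c j) (b j))" by blast
      then have "zsmul k x = (\<Sum>j<n. zsmul (k * c j) (b j))"
        by (simp add: zmod.scale_sum_right)
      then show "zsmul k x \<in> ?C"
        unfolding mem_Collect_eq by (intro exI[of _ "\<lambda>j. k * c j"] conjI TrueI)
    qed
  qed
  show "?C \<subseteq> zspan (b ` {..<n})"
    unfolding zspan_eq_span by (auto intro!: zmod.span_sum zmod.span_scale[OF zmod.span_base])
qed

lemma coordsZ_eqI:
  assumes "zindep b n" "\<forall>j\<ge>n. c j = 0" "(\<Sum>j<n. zsmul (c j) (b j)) = x"
  shows "coordsZ n b x = c"
  unfolding coordsZ_def
proof (rule the_equality)
  fix d assume d: "(\<forall>j\<ge>n. d j = 0) \<and> (\<Sum>j<n. zsmul (d j) (b j)) = x"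
  then have "(\<Sum>j<n. zsmul (d j - c j) (b j)) = 0"
    using assms(3) by (simp add: zmod.scale_left_diff_distrib sum_subtractf)
  then have "\<forall>j<n. d j - c j = 0"
    using assms(1)[unfolded zindep_def, rule_format, of "\<lambda>j. d j - c j"] by blast
  then show "d = c" using d assms(2) by (metis eq_iff_diff_eq_0 ext not_le)
qed (use assms in simp)

lemma coordsZ_spec:
  assumes "zindep b n" "x \<in> zspan (b ` {..<n})"
  shows "\<forall>j\<ge>n. coordsZ n b x j = 0" "(\<Sum>j<n. zsmul (coordsZ n b x j) (b j)) = x"
proof -
  obtain c where "x = (\<Sum>j<n. zsmul (c j) (b j))" using assms(2) unfolding zspan_image_lessThan by blast
  then have "(\<Sum>j<n. zsmul (if j < n then c j else 0) (b j)) = x" by simp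
  from coordsZ_eqI[OF assms(1) _ this]
  have "coordsZ n b x = (\<lambda>j. if j < n then c j else 0)" by simp
  then show "\<forall>j\<ge>n. coordsZ n b x j = 0" "(\<Sum>j<n. zsmul (coordsZ n b x j) (b j)) = x"
    using \<open>(\<Sum>j<n. zsmul (if j < n then c j else 0) (b j)) = x\<close> by simp_all
qed

lemma coordsZ_add:
  assumes "zindep b n" "x \<in> zspan (b ` {..<n})" "y \<in> zspan (b ` {..<n})"
  shows "coordsZ n b (x + y) = (\<lambda>j. coordsZ n b x j + coordsZ n b y j)"
  using coordsZ_spec[OF assms(1,2)] coordsZ_spec[OF assms(1,3)]
  by (intro coordsZ_eqI[OF assms(1)]) (simp_all add: zmod.scale_left_distrib sum.distrib)

section \<open>Denominators and Bezout coefficients\<close>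

lemma common_denominator:
  "\<exists>(D::int)>0. \<exists>c. \<forall>j<(n::nat). q j = (of_int (c j) / of_int D :: rat)"
proof (induction n)
  case 0
  then show ?case by (auto intro: exI[of _ 1])
next
  case (Suc n)
  then obtain D c where D: "D > 0" "\<forall>j<n. q j = of_int (c j) / of_int D" by blast
  obtain p k where pk: "quotient_of (q n) = (p, k)" by fastforce
  then have k: "k > 0" "q n = of_int p / of_int k"
    using quotient_of_denom_pos quotient_of_div by blast+
  have "\<forall>j<Suc n. q j = of_int (if j = n then p * D else c j * k) / of_int (D * k)"
    using D k by (auto simp: less_Suc_eq)
  moreover have "D * k > 0" using D k by simp
  ultimately show ?case
    by (intro exI[of _ "D * k"] exI[of _ "\<lambda>j. if j = n then p * D else c j * k"] conjI)
qed

lemma eprime_Suc_mult: "eprime e (Suc j) * dd e j = eprime e j * e j"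
  unfolding dd_def by simp

text \<open>For positive entries, \<open>eprime e j\<close> is the least common multiple of the
  \<open>e t\<close> with \<open>t < j\<close>. This divisibility makes the exponents in
  \<open>next_pi\<close> integral.\<close>

lemma eprime_dvd: "t < j \<Longrightarrow> e t dvd eprime e j"
proof (induction j)
  case (Suc j)
  have *: "eprime e (Suc j) = eprime e j div gcd (e j) (eprime e j) * e j"
    "eprime e (Suc j) = eprime e j * (e j div gcd (e j) (eprime e j))"
    by (simp_all add: dvd_div_mult div_mult_swap)
  show ?case
  proof (cases "t = j")
    case True
    then show ?thesis using *(1) by simp
  next
    case False
    then show ?thesis using *(2) Suc by (metis dvd_mult2 less_SucE)
  qed
qed simp

text \<open>After division by \<open>dd e j\<close> the number \<open>h j * E'\<close> is invertible
  modulo \<open>e'\<close>, and its inverse has exactly one representative in the prescribed range.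
  Hence both definite descriptions are meaningful.\<close>

lemma ll_llp_bezout:
  assumes e: "\<And>j. 0 < e j" and cop: "coprime (h j) (e j)"
  shows "ll h e j * h j * eprime e j + llp h e j * e j = dd e j"
proof -
  let ?E = "eprime e j" and ?d = "dd e j"
  define e' E' where "e' = e j div ?d" and "E' = ?E div ?d"
  have d: "?d > 0" using e[of j] by (simp add: dd_def gcd_pos_int)
  have ee: "e j = e' * ?d" "?E = E' * ?d" unfolding e'_def E'_def by (simp_all add: dd_def)
  have e': "e' > 0" using ee(1) e[of j] d by (metis zero_less_mult_pos2)
  have c1: "coprime E' e'"
    unfolding e'_def E'_def dd_def using e[of j] by (metis coprime_commute div_gcd_coprime less_irrefl)
  have "coprime (h j) e'" using cop ee(1) by simp
  then have c2: "coprime (h j * E') e'" using c1 by simp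
  have iff: "l * h j * ?E + l' * e j = ?d \<longleftrightarrow> l * (h j * E') + l' * e' = 1" for l l'
  proof -
    have "l * h j * ?E + l' * e j = (l * (h j * E') + l' * e') * ?d"
      unfolding ee by (simp add: algebra_simps)
    then show ?thesis using d by simp
  qed
  have ex: "\<exists>!l. 0 \<le> l \<and> l < e' \<and> (\<exists>l'. l * (h j * E') + l' * e' = 1)"
  proof (rule ex_ex1I)
    obtain u w where u: "u * (h j * E') + w * e' = 1" using bezout_int[of "h j * E'" e'] c2 by auto
    \<comment> \<open>Reducing the first Bezout coefficient modulo \<open>e'\<close> is compensated
      by the second one.\<close>
    have "(u mod e') * (h j * E') + (w + (u div e') * (h j * E')) * e' =
        (u mod e' + u div e' * e') * (h j * E') + w * e'" by (simp only: algebra_simps)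
    also have "\<dots> = 1" using u by simp
    finally have "\<exists>l'. (u mod e') * (h j * E') + l' * e' = 1" by (rule exI)
    then have "0 \<le> u mod e' \<and> u mod e' < e' \<and> (\<exists>l'. (u mod e') * (h j * E') + l' * e' = 1)"
      using e' by simp
    then show "\<exists>l. 0 \<le> l \<and> l < e' \<and> (\<exists>l'. l * (h j * E') + l' * e' = 1)" by (rule exI)
  next
    fix l m assume l: "0 \<le> l \<and> l < e' \<and> (\<exists>l'. l * (h j * E') + l' * e' = 1)"
      and m: "0 \<le> m \<and> m < e' \<and> (\<exists>l'. m * (h j * E') + l' * e' = 1)"
    then obtain l' m' where "l * (h j * E') + l' * e' = 1" "m * (h j * E') + m' * e' = 1" by blast
    then have "(l - m) * (h j * E') = (m' - l') * e'" by (simp add: algebra_simps)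
    then have "e' dvd (l - m) * (h j * E')" by simp
    then have "e' dvd l - m" using c2 by (metis coprime_commute coprime_dvd_mult_left_iff)
    then show "l = m" using l m by (metis mod_eq_dvd_iff mod_pos_pos_trivial)
  qed
  have "ll h e j = (THE l. 0 \<le> l \<and> l < e' \<and> (\<exists>l'. l * (h j * E') + l' * e' = 1))"
    unfolding ll_def iff e'_def ..
  then obtain l' where l': "ll h e j * (h j * E') + l' * e' = 1" using theI'[OF ex] by auto
  have "llp h e j = l'"
    unfolding llp_def iff using l' e' by (intro the_equality) (simp, metis add_left_cancel mult_cancel_right less_irrefl)
  then show ?thesis using l' iff by simp
qed

context divisible_group
begin

lemma qindep:
  fixes b :: "nat \<Rightarrow> 'g"
  assumes "zindep b n" "(\<Sum>j<n. qmul (q j) (b j)) = 0" "j < n"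
  shows "q j = 0"
proof -
  obtain D c where D: "(D::int) > 0" "\<forall>j<n. q j = of_int (c j) / of_int D"
    using common_denominator[of n q] by blast
  have "(\<Sum>j<n. zsmul (c j) (b j)) = (\<Sum>j<n. zsmul D (qmul (q j) (b j)))"
    using D by (intro sum.cong) (auto simp: zsmul_qmul)
  also have "\<dots> = 0" using assms(2) by (simp flip: zmod.scale_sum_right)
  finally have "\<forall>j<n. c j = 0" using assms(1) unfolding zindep_def by blast
  then show ?thesis using D assms(3) by simp
qed

lemma coordsQ_eqI:
  fixes b :: "nat \<Rightarrow> 'g"
  assumes "zindep b n" "\<forall>j\<ge>n. q j = 0" "(\<Sum>j<n. qmul (q j) (b j)) = x"
  shows "coordsQ n b x = q"
  unfolding coordsQ_def
proof (rule the_equality)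
  fix p assume p: "(\<forall>j\<ge>n. p j = 0) \<and> (\<Sum>j<n. qmul (p j) (b j)) = x"
  then have "(\<Sum>j<n. qmul (p j - q j) (b j)) = 0"
    using assms(3) by (simp add: qvec.scale_left_diff_distrib sum_subtractf)
  then have "\<forall>j<n. p j - q j = 0" using qindep[OF assms(1), of "\<lambda>j. p j - q j"] by blast
  then show "p = q" using p assms(2) by (metis eq_iff_diff_eq_0 ext not_le)
qed (use assms in simp)

lemma coordsQ_sum:
  fixes b :: "nat \<Rightarrow> 'g"
  assumes b: "zindep b n" and k: "k \<noteq> 0" "zsmul k x \<in> zspan (b ` {..<n})"
  shows "(\<Sum>j<n. qmul (coordsQ n b x j) (b j)) = x"
proof -
  obtain c where c: "zsmul k x = (\<Sum>j<n. zsmul (c j) (b j))"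
    using k(2) unfolding zspan_image_lessThan by blast
  define q where "q j = (if j < n then of_int (c j) / of_int k else 0 :: rat)" for j
  have "zsmul k (\<Sum>j<n. qmul (q j) (b j)) = zsmul k x"
    unfolding c zmod.scale_sum_right
    using k(1) by (intro sum.cong) (auto simp: q_def intro!: zsmul_qmul)
  then have "(\<Sum>j<n. qmul (q j) (b j)) = x" by (rule zsmul_cancel[OF k(1)])
  moreover from this have "coordsQ n b x = q" by (intro coordsQ_eqI b) (simp_all add: q_def)
  ultimately show ?thesis by simp
qed

end

section \<open>One change of basis, adjoining a torsion element to the lattice\<close>

locale basis_step = divisible_group T for T :: "'g::linordered_ab_group_add itself" +
  fixes n :: nat and b :: "nat \<Rightarrow> 'g" and g :: 'g
  assumes indep: "zindep b n" and torsion: "\<exists>k. k \<noteq> 0 \<and> zsmul k g \<in> zspan (b ` {..<n})"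
begin

abbreviation "h \<equiv> hh n b g"
abbreviation "e \<equiv> ee n b g"
abbreviation "E \<equiv> eprime e"
abbreviation "d \<equiv> dd e"
abbreviation "l \<equiv> ll h e"
abbreviation "l' \<equiv> llp h e"
abbreviation "nb \<equiv> next_basis n b g"

text \<open>The last part of the rational expansion of \<open>g\<close>. The change of basis
  proceeds one index at a time, acting on the pair of \<open>zsmul (E j) (tail j)\<close> and
  \<open>b j\<close>.\<close>

definition tail :: "nat \<Rightarrow> 'g" where
  "tail j = (\<Sum>t\<in>{j..<n}. qmul (of_int (h t) / of_int (e t)) (b t))"

lemma e_pos: "0 < e j"
  unfolding ee_def using quotient_of_denom_pos by (metis prod.collapse)

lemma coprime_he: "coprime (h j) (e j)"
  unfolding ee_def hh_def using quotient_of_coprime by (metis prod.collapse)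

lemma coords_he: "coordsQ n b g j = of_int (h j) / of_int (e j)"
  unfolding ee_def hh_def using quotient_of_div by (metis prod.collapse)

lemma g_eq_tail: "g = tail 0"
proof -
  obtain k where "k \<noteq> 0" "zsmul k g \<in> zspan (b ` {..<n})" using torsion by blast
  from coordsQ_sum[OF indep this] show ?thesis
    unfolding coords_he tail_def atLeast0LessThan by (rule sym)
qed

lemma tail_split: "j < n \<Longrightarrow> tail j = qmul (of_int (h j) / of_int (e j)) (b j) + tail (Suc j)"
  unfolding tail_def by (simp add: sum.atLeast_Suc_lessThan)

lemma tail_end: "tail n = 0"
  by (simp add: tail_def)

lemma d_pos: "0 < d j"
  using e_pos[of j] by (simp add: dd_def gcd_pos_int)

lemma bezout: "l j * h j * E j + l' j * e j = d j"
  using e_pos coprime_he by (rule ll_llp_bezout)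

lemma next_basis_tail:
  assumes "j < n"
  shows "nb j = zsmul (l j) (zsmul (E j) (tail j)) + zsmul (l' j) (b j)"
proof -
  have "nb j = qmul (of_int (d j) / of_int (e j)) (b j) +
      (\<Sum>m\<in>{j<..<n}. qmul (of_int (l j * E j * h m) / of_int (e m)) (b m))"
    by (simp add: next_basis_def Let_def)
  also have "(\<Sum>m\<in>{j<..<n}. qmul (of_int (l j * E j * h m) / of_int (e m)) (b m)) =
      qmul (of_int (l j * E j)) (tail (Suc j))"
    unfolding tail_def qvec.scale_sum_right
    by (intro sum.cong) (auto simp: ac_simps atLeastSucLessThan_greaterThanLessThan)
  \<comment> \<open>The Bezout identity divided by \<open>e j\<close> splits the diagonal entry into
    the part belonging to the tail and the integer \<open>l' j\<close>.\<close>
  also have "(of_int (d j) / of_int (e j) :: rat) = of_int (l j * E j) * (of_int (h j) / of_int (e j)) + of_int (l' j)"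
    unfolding bezout[symmetric] using e_pos[of j] by (simp add: field_simps)
  finally show ?thesis
    unfolding tail_split[OF assms] zmod.scale_scale qmul_of_int[symmetric]
    by (simp add: qvec.scale_left_distrib qvec.scale_right_distrib ac_simps)
qed

text \<open>With \<open>next_basis_tail\<close> this expresses the new basis vector and the next
  scaled tail by the old pair. The coefficients are integers, and by the Bezout identity the
  determinant is -1.\<close>

lemma tail_Suc:
  assumes "j < n"
  shows "zsmul (E (Suc j)) (tail (Suc j)) =
    zsmul (e j div d j) (zsmul (E j) (tail j)) - zsmul (E j div d j * h j) (b j)"
proof -
  have dv: "d j dvd e j" "d j dvd E j" by (simp_all add: dd_def)
  have "of_int (E (Suc j)) * of_int (d j) = (of_int (E j) * of_int (e j) :: rat)"
    using eprime_Suc_mult[of e j] by (metis of_int_mult)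
  then have 1: "(of_int (E (Suc j)) :: rat) = of_int (E j) * of_int (e j) / of_int (d j)"
    using d_pos[of j] by (simp add: field_simps)
  show ?thesis
    unfolding qmul_of_int[symmetric] 1 tail_split[OF assms] using dv d_pos[of j] e_pos[of j]
    by (simp add: qvec.scale_right_distrib of_int_div field_simps)
qed

text \<open>The inverse of the integral transformation above, again with integral
  coefficients.\<close>

lemma next_basis_inverse:
  assumes "j < n"
  shows "zsmul (E j) (tail j) = zsmul (l' j) (zsmul (E (Suc j)) (tail (Suc j))) + zsmul (E j div d j * h j) (nb j)"
    and "b j = zsmul (e j div d j) (nb j) - zsmul (l j) (zsmul (E (Suc j)) (tail (Suc j)))"
proof -
  let ?x = "e j div d j" and ?y = "E j div d j * h j" and ?A = "zsmul (E j) (tail j)"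
  have xd: "?x * d j = e j" "E j div d j * d j = E j" by (simp_all add: dd_def)
  have "(l j * ?y + l' j * ?x) * d j = l j * h j * (E j div d j * d j) + l' j * (?x * d j)"
    by (simp only: algebra_simps)
  also have "\<dots> = d j" unfolding xd by (rule bezout)
  finally have 1: "l j * ?y + l' j * ?x = 1" using d_pos[of j] by simp
  have "zsmul (l' j) (zsmul ?x ?A - zsmul ?y (b j)) + zsmul ?y (zsmul (l j) ?A + zsmul (l' j) (b j)) =
      zsmul (l j * ?y + l' j * ?x) ?A"
    by (simp add: zmod.scale_right_diff_distrib zmod.scale_right_distrib zmod.scale_left_distrib ac_simps
        del: zmod.scale_scale) (simp add: ac_simps)
  then show "?A = zsmul (l' j) (zsmul (E (Suc j)) (tail (Suc j))) + zsmul ?y (nb j)"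
    unfolding tail_Suc[OF assms] next_basis_tail[OF assms] 1 by simp
  have "zsmul ?x (zsmul (l j) ?A + zsmul (l' j) (b j)) - zsmul (l j) (zsmul ?x ?A - zsmul ?y (b j)) =
      zsmul (l j * ?y + l' j * ?x) (b j)"
    by (simp add: zmod.scale_right_diff_distrib zmod.scale_right_distrib zmod.scale_left_distrib ac_simps
        del: zmod.scale_scale) (simp add: ac_simps)
  then show "b j = zsmul ?x (nb j) - zsmul (l j) (zsmul (E (Suc j)) (tail (Suc j)))"
    unfolding tail_Suc[OF assms] next_basis_tail[OF assms] 1 by simp
qed

text \<open>One inclusion ascends from \<open>tail 0\<close>, which is \<open>g\<close>, by the
  forward transformation. The other descends from \<open>tail n\<close>, which is 0, by its
  inverse.\<close>

lemma span_next_basis: "zspan (nb ` {..<n}) = zspan (insert g (b ` {..<n}))"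
  unfolding zspan_eq_span
proof
  let ?S = "zmod.span (insert g (b ` {..<n}))" and ?N = "zmod.span (nb ` {..<n})"
  have A: "j \<le> n \<Longrightarrow> zsmul (E j) (tail j) \<in> ?S" for j
  proof (induction j)
    case 0
    then show ?case by (simp add: zmod.span_base flip: g_eq_tail)
  next
    case (Suc j)
    then show ?case unfolding tail_Suc[OF Suc_le_lessD[OF Suc(2)]]
      using Suc by (intro zmod.span_diff zmod.span_scale[OF Suc.IH] zmod.span_scale[OF zmod.span_base]) auto
  qed
  show "?N \<subseteq> ?S"
  proof (rule zmod.span_minimal)
    show "nb ` {..<n} \<subseteq> ?S"
    proof safe
      fix j assume j: "j < n"
      show "nb j \<in> ?S" unfolding next_basis_tail[OF j]
        using j by (intro zmod.span_add zmod.span_scale[OF A] zmod.span_scale[OF zmod.span_base]) auto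
    qed
  qed simp
  have nb: "nb j \<in> ?N" if "j < n" for j using that by (simp add: zmod.span_base)
  have B: "j \<le> n \<Longrightarrow> zsmul (E j) (tail j) \<in> ?N" for j
  proof (induction j rule: inc_induct)
    case base
    then show ?case by (simp add: tail_end zmod.span_zero)
  next
    case (step j)
    then show ?case
      using next_basis_inverse(1)[of j] nb
      by (metis zmod.span_add zmod.span_scale)
  qed
  show "?S \<subseteq> ?N"
  proof (rule zmod.span_minimal)
    have "g \<in> ?N" using B[of 0] by (simp flip: g_eq_tail)
    moreover have "b j \<in> ?N" if "j < n" for j
      unfolding next_basis_inverse(2)[OF that]
      using nb that by (intro zmod.span_diff zmod.span_scale[OF B] zmod.span_scale[OF nb]) simp_all
    ultimately show "insert g (b ` {..<n}) \<subseteq> ?N" by auto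
  qed simp
qed

text \<open>The matrix of the new basis over the old one is lower triangular with non-zero diagonal.
  Comparing the coefficients at \<open>b j\<close> in increasing order of \<open>j\<close> shows
  that each \<open>c j\<close> vanishes.\<close>

lemma next_basis_indep: "zindep nb n"
  unfolding zindep_def
proof (intro allI impI)
  fix c j assume c: "(\<Sum>j<n. zsmul (c j) (nb j)) = 0" and "j < n"
  define M where "M m j = (if m = j then of_int (d j) / of_int (e j)
    else if j < m then of_int (l j * E j * h m) / of_int (e m) else 0 :: rat)" for m j
  have nb: "nb j = (\<Sum>m<n. qmul (M m j) (b m))" if "j < n" for j
  proof -
    have "(\<Sum>m<n. qmul (M m j) (b m)) = qmul (M j j) (b j) + (\<Sum>m\<in>{..<n} - {j}. qmul (M m j) (b m))"
      using that by (intro sum.remove) auto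
    also have "(\<Sum>m\<in>{..<n} - {j}. qmul (M m j) (b m)) = (\<Sum>m\<in>{j<..<n}. qmul (M m j) (b m))"
      by (intro sum.mono_neutral_right) (auto simp: M_def)
    also have "\<dots> = (\<Sum>m\<in>{j<..<n}. qmul (of_int (l j * E j * h m) / of_int (e m)) (b m))"
      by (intro sum.cong) (auto simp: M_def)
    finally show ?thesis by (simp add: next_basis_def Let_def M_def)
  qed
  have "0 = (\<Sum>j<n. \<Sum>m<n. qmul (of_int (c j) * M m j) (b m))"
    unfolding c[symmetric] by (intro sum.cong) (simp_all add: nb qvec.scale_sum_right flip: qmul_of_int)
  also have "\<dots> = (\<Sum>m<n. qmul (\<Sum>j<n. of_int (c j) * M m j) (b m))"
    by (subst sum.swap) (simp add: qvec.scale_sum_left)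
  finally have z: "(\<Sum>j<n. of_int (c j) * M m j) = 0" if "m < n" for m
    using qindep[OF indep, of "\<lambda>m. \<Sum>j<n. of_int (c j) * M m j"] that by simp
  show "c j = 0" using \<open>j < n\<close>
  proof (induction j rule: less_induct)
    case (less j)
    have "0 = (\<Sum>t<n. of_int (c t) * M j t)" using z less(2) by simp
    also have "\<dots> = (\<Sum>t\<in>{j}. of_int (c t) * M j t)"
      using less by (intro sum.mono_neutral_right) (auto simp: M_def not_less)
    finally show ?case using d_pos[of j] e_pos[of j] by (simp add: M_def)
  qed
qed

text \<open>The new vector is written with exactly the exponents of \<open>next_pi\<close>, so that
  the value of the new rational function can be read off factor by factor.\<close>

lemma next_basis_exponents:
  assumes "j < n"
  shows "nb j = zsmul (l j * E j) g + (\<Sum>t<j. zsmul (- ((h t * (l j * E j)) div e t)) (b t)) + zsmul (l' j) (b j)"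
proof -
  have "zsmul (l j * E j) g = zsmul (l j * E j) (tail 0)" by (simp flip: g_eq_tail)
  also have "tail 0 = (\<Sum>t<j. qmul (of_int (h t) / of_int (e t)) (b t)) + tail j"
    unfolding tail_def lessThan_atLeast0
    using assms by (intro sum.atLeastLessThan_concat[symmetric]) simp_all
  finally have "zsmul (l j * E j) g =
      (\<Sum>t<j. zsmul (l j * E j) (qmul (of_int (h t) / of_int (e t)) (b t))) + zsmul (l j * E j) (tail j)"
    by (simp only: zmod.scale_right_distrib zmod.scale_sum_right)
  moreover have "zsmul ((h t * (l j * E j)) div e t) (b t) =
      zsmul (l j * E j) (qmul (of_int (h t) / of_int (e t)) (b t))" if "t < j" for t
  proof -
    have "e t dvd h t * (l j * E j)" using eprime_dvd[OF that, of e] by simp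
    then have "(of_int ((h t * (l j * E j)) div e t) :: rat) = of_int (l j * E j) * (of_int (h t) / of_int (e t))"
      using e_pos[of t] by (auto simp: of_int_div field_simps)
    then show ?thesis by (simp add: flip: qmul_of_int)
  qed
  ultimately show ?thesis
    unfolding next_basis_tail[OF assms]
    by (simp add: sum_negf)
qed

end

section \<open>Newton polygons\<close>

context divisible_group
begin

lemma qconv_combination:
  fixes \<gamma> :: 'g
  assumes "finite F"
  shows "(\<Sum>p\<in>F. qmul (c p) (snd p)) + qmul (\<Sum>p\<in>F. c p * fst p) \<gamma> =
    (\<Sum>p\<in>F. qmul (c p) (snd p + qmul (fst p) \<gamma>))"
  by (simp add: qvec.scale_sum_left qvec.scale_right_distrib sum.distrib)

lemma in_qconv: "(x :: rat \<times> 'g) \<in> P \<Longrightarrow> x \<in> qconv P"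
  unfolding qconv_def mem_Collect_eq
  by (rule exI[of _ "{x}"], rule exI[of _ "\<lambda>_. 1"]) simp

context
  fixes P :: "(rat \<times> 'g) set" and \<gamma> M :: 'g
  assumes P_ge: "\<And>x. x \<in> P \<Longrightarrow> M \<le> snd x + qmul (fst x) \<gamma>"
begin

text \<open>The height of a convex combination above the line of slope \<open>- \<gamma>\<close> is
  the weighted mean of the heights of its points.\<close>

lemma qconv_line:
  assumes "z \<in> qconv P"
  obtains F c where "finite F" "F \<subseteq> P" "\<forall>p\<in>F. 0 \<le> c p" "(\<Sum>p\<in>F. c p) = 1"
    "fst z = (\<Sum>p\<in>F. c p * fst p)"
    "snd z + qmul (fst z) \<gamma> - M = (\<Sum>p\<in>F. qmul (c p) (snd p + qmul (fst p) \<gamma> - M))"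
proof -
  obtain F c where F: "finite F" "F \<subseteq> P" "\<forall>p\<in>F. 0 \<le> c p" "(\<Sum>p\<in>F. c p) = 1"
    "z = ((\<Sum>p\<in>F. c p * fst p), (\<Sum>p\<in>F. qmul (c p) (snd p)))"
    using assms unfolding qconv_def by blast
  have "(\<Sum>p\<in>F. qmul (c p) M) = M" using F(4) by (simp flip: qvec.scale_sum_left)
  then have "snd z + qmul (fst z) \<gamma> - M = (\<Sum>p\<in>F. qmul (c p) (snd p + qmul (fst p) \<gamma> - M))"
    using qconv_combination[OF F(1), of c \<gamma>]
    by (simp add: F(5) qvec.scale_right_diff_distrib sum_subtractf)
  then show thesis using that F by simp
qed

lemma qconv_ge: "z \<in> qconv P \<Longrightarrow> M \<le> snd z + qmul (fst z) \<gamma>"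
proof (elim qconv_line)
  fix F c assume F: "F \<subseteq> P" "\<forall>p\<in>F. 0 \<le> c p"
    "snd z + qmul (fst z) \<gamma> - M = (\<Sum>p\<in>F. qmul (c p) (snd p + qmul (fst p) \<gamma> - M))"
  have "0 \<le> (\<Sum>p\<in>F. qmul (c p) (snd p + qmul (fst p) \<gamma> - M))"
    using F P_ge by (intro sum_nonneg qmul_nonneg) auto
  then show ?thesis unfolding F(3)[symmetric] by simp
qed

text \<open>No point lies below the line, so a combination on the line has positive weights only at
  points on the line.\<close>

lemma qconv_bounds:
  assumes "z \<in> qconv P" "snd z + qmul (fst z) \<gamma> = M"
    and bd: "\<And>x. x \<in> P \<Longrightarrow> snd x + qmul (fst x) \<gamma> = M \<Longrightarrow> lo \<le> fst x \<and> fst x \<le> hi"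
  shows "lo \<le> fst z" "fst z \<le> hi"
proof -
  obtain F c where F: "finite F" "F \<subseteq> P" "\<forall>p\<in>F. 0 \<le> c p" "(\<Sum>p\<in>F. c p) = 1"
    "fst z = (\<Sum>p\<in>F. c p * fst p)"
    "snd z + qmul (fst z) \<gamma> - M = (\<Sum>p\<in>F. qmul (c p) (snd p + qmul (fst p) \<gamma> - M))"
    using qconv_line[OF assms(1)] by blast
  have "(\<Sum>p\<in>F. qmul (c p) (snd p + qmul (fst p) \<gamma> - M)) = 0" using F(6) assms(2) by simp
  moreover have "0 \<le> qmul (c p) (snd p + qmul (fst p) \<gamma> - M)" if "p \<in> F" for p
    using that F P_ge by (intro qmul_nonneg) auto
  ultimately have "qmul (c p) (snd p + qmul (fst p) \<gamma> - M) = 0" if "p \<in> F" for p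
    using that F(1) by (simp add: sum_nonneg_eq_0_iff)
  then have b: "c p = 0 \<or> (lo \<le> fst p \<and> fst p \<le> hi)" if "p \<in> F" for p
    using that bd[of p] F(2) qvec.scale_eq_0_iff by fastforce
  have "c p * lo \<le> c p * fst p \<and> c p * fst p \<le> c p * hi" if "p \<in> F" for p
    using b[OF that] F(3) that by (auto intro: mult_left_mono)
  then have "(\<Sum>p\<in>F. c p * lo) \<le> (\<Sum>p\<in>F. c p * fst p)" "(\<Sum>p\<in>F. c p * fst p) \<le> (\<Sum>p\<in>F. c p * hi)"
    by (simp_all add: sum_mono)
  then show "lo \<le> fst z" "fst z \<le> hi"
    using F(4,5) by (simp_all flip: sum_distrib_right)
qed

lemma qconv_segment:
  assumes p: "p \<in> P" "snd p + qmul (fst p) \<gamma> = M" and q: "q \<in> P" "snd q + qmul (fst q) \<gamma> = M"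
    and s: "fst p \<le> s" "s \<le> fst q"
  shows "\<exists>z\<in>qconv P. fst z = s \<and> snd z + qmul (fst z) \<gamma> = M"
proof (cases "fst p = fst q")
  case True
  then show ?thesis using s p in_qconv[OF p(1)] by (intro bexI[of _ p]) auto
next
  case False
  then have lt: "fst p < fst q" and ne: "p \<noteq> q" using s by auto
  \<comment> \<open>The weights of linear interpolation at \<open>s\<close> between the abscissas of
    \<open>p\<close> and \<open>q\<close>.\<close>
  define c where "c x = (if x = p then (fst q - s) / (fst q - fst p) else (s - fst p) / (fst q - fst p))" for x
  let ?F = "{p, q}"
  define z where "z = ((\<Sum>p\<in>?F. c p * fst p), (\<Sum>p\<in>?F. qmul (c p) (snd p)))"
  have c1: "(\<Sum>x\<in>?F. c x) = 1"
    using ne lt by (simp add: c_def flip: add_divide_distrib)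
  have "z \<in> qconv P"
    unfolding qconv_def mem_Collect_eq z_def
    by (rule exI[of _ ?F], rule exI[of _ c]) (use c1 p q s lt in \<open>auto simp: c_def\<close>)
  moreover have "fst z = s"
  proof -
    have cD: "c p * (fst q - fst p) = fst q - s" "c q * (fst q - fst p) = s - fst p"
      using lt ne by (auto simp: c_def)
    have "fst z * (fst q - fst p) = c p * (fst q - fst p) * fst p + c q * (fst q - fst p) * fst q"
      unfolding z_def using ne by (simp add: algebra_simps)
    also have "\<dots> = (fst q - s) * fst p + (s - fst p) * fst q" unfolding cD ..
    also have "\<dots> = s * (fst q - fst p)" by (simp add: algebra_simps)
    finally show ?thesis using lt by simp
  qed
  moreover have "snd z + qmul (fst z) \<gamma> = (\<Sum>x\<in>?F. qmul (c x) (snd x + qmul (fst x) \<gamma>))"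
    unfolding z_def fst_conv snd_conv by (rule qconv_combination) simp
  moreover have "\<dots> = qmul (\<Sum>x\<in>?F. c x) M"
    unfolding qvec.scale_sum_left using p q by (intro sum.cong) auto
  ultimately show ?thesis using c1 by auto
qed

end

end

section \<open>The face of the Newton polygon of slope \<open>- \<gamma>\<close>\<close>

locale newton = divisible_group T + augmentation \<mu> \<phi> \<gamma>
  for T :: "'g::linordered_ab_group_add itself" and \<mu> :: "'k::field poly \<Rightarrow> 'g" and \<phi> \<gamma> +
  fixes f :: "'k poly"
  assumes f_nz: "f \<noteq> 0"
begin

definition I where "I = {s. phi_coeff \<phi> f s \<noteq> 0 \<and> \<mu> (phi_coeff \<phi> f s) + nsmul s \<gamma> = w f}"

abbreviation pt :: "nat \<Rightarrow> rat \<times> 'g" where "pt s \<equiv> (of_nat s, \<mu> (phi_coeff \<phi> f s))"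

lemma w_le: "phi_coeff \<phi> f s \<noteq> 0 \<Longrightarrow> w f \<le> \<mu> (phi_coeff \<phi> f s) + nsmul s \<gamma>"
  using w_Pge_self[of f] unfolding Pge_w by blast

lemma I_finite: "finite I"
  by (rule finite_subset[OF _ finite_phi_support[of f]]) (auto simp: I_def)

lemma I_nonempty: "I \<noteq> {}"
  using w_Pgt_self[OF f_nz] w_le unfolding Pgt_w I_def by force

lemma Min_I: "Min I \<in> I" and Max_I: "Max I \<in> I"
  using I_finite I_nonempty by simp_all

lemma NPoints_eq: "NPoints \<mu> \<phi> f = pt ` {s. phi_coeff \<phi> f s \<noteq> 0}"
  by (auto simp: NPoints_def)

lemma NPoints_ge: "x \<in> NPoints \<mu> \<phi> f \<Longrightarrow> w f \<le> snd x + qmul (fst x) \<gamma>"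
  using w_le by (auto simp: NPoints_eq qmul_of_nat)

lemma pt_I: "s \<in> I \<Longrightarrow> pt s \<in> NPoints \<mu> \<phi> f \<and> snd (pt s) + qmul (fst (pt s)) \<gamma> = w f"
  by (auto simp: NPoints_eq qmul_of_nat I_def)

lemma NPoints_bounds:
  assumes "x \<in> NPoints \<mu> \<phi> f" "snd x + qmul (fst x) \<gamma> = w f"
  shows "of_nat (Min I) \<le> fst x \<and> fst x \<le> of_nat (Max I)"
proof -
  obtain s where s: "x = pt s" "phi_coeff \<phi> f s \<noteq> 0" using assms(1) by (auto simp: NPoints_eq)
  then have "s \<in> I" using assms(2) by (simp add: I_def qmul_of_nat)
  then show ?thesis using I_finite s(1) by simp
qed

lemma Npoly_line:
  assumes "x \<in> qconv (NPoints \<mu> \<phi> f)" "snd x + qmul (fst x) \<gamma> = w f"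
  shows "x \<in> Npoly \<mu> \<phi> f"
  unfolding Npoly_def
proof (safe intro!: assms(1))
  fix a b assume "(a, b) \<in> qconv (NPoints \<mu> \<phi> f)" "fst (a, b) = fst x"
  then show "snd x \<le> snd (a, b)"
    using qconv_ge[where P = "NPoints \<mu> \<phi> f", OF NPoints_ge, where z = "(a, b)"] assms(2) by (metis add_le_cancel_right)
qed

text \<open>The minimum over the lower hull is \<open>w f\<close>: the line bounds the hull from
  below and meets it above \<open>Min I\<close>.\<close>

lemma Sgam_iff: "x \<in> Sgam \<mu> \<phi> \<gamma> f \<longleftrightarrow> x \<in> qconv (NPoints \<mu> \<phi> f) \<and> snd x + qmul (fst x) \<gamma> = w f"
proof
  assume x: "x \<in> Sgam \<mu> \<phi> \<gamma> f"
  have "pt (Min I) \<in> Npoly \<mu> \<phi> f"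
    using pt_I[OF Min_I] by (intro Npoly_line in_qconv) auto
  then have "snd x + qmul (fst x) \<gamma> \<le> w f" using x pt_I[OF Min_I] unfolding Sgam_def by force
  moreover have "x \<in> qconv (NPoints \<mu> \<phi> f)" using x by (simp add: Sgam_def Npoly_def)
  ultimately show "x \<in> qconv (NPoints \<mu> \<phi> f) \<and> snd x + qmul (fst x) \<gamma> = w f"
    using qconv_ge[where P = "NPoints \<mu> \<phi> f", OF NPoints_ge, where z = x] by simp
next
  assume x: "x \<in> qconv (NPoints \<mu> \<phi> f) \<and> snd x + qmul (fst x) \<gamma> = w f"
  then show "x \<in> Sgam \<mu> \<phi> \<gamma> f"
    using qconv_ge[where P = "NPoints \<mu> \<phi> f", OF NPoints_ge] Npoly_line[of x] unfolding Sgam_def by (auto simp: Npoly_def)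
qed

lemma Sgam_bounds: "x \<in> Sgam \<mu> \<phi> \<gamma> f \<Longrightarrow> of_nat (Min I) \<le> fst x \<and> fst x \<le> of_nat (Max I)"
  using qconv_bounds[where P = "NPoints \<mu> \<phi> f", OF NPoints_ge, where z = x and lo = "of_nat (Min I)" and hi = "of_nat (Max I)"] NPoints_bounds
  unfolding Sgam_iff by blast

lemma pt_Sgam: "s \<in> I \<Longrightarrow> pt s \<in> Sgam \<mu> \<phi> \<gamma> f"
  unfolding Sgam_iff using pt_I in_qconv by simp

lemma Sgam_inj: "x \<in> Sgam \<mu> \<phi> \<gamma> f \<Longrightarrow> y \<in> Sgam \<mu> \<phi> \<gamma> f \<Longrightarrow> fst x = fst y \<Longrightarrow> x = y"
  unfolding Sgam_iff by (metis add_right_cancel prod.collapse)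

lemma left_end_eq: "left_end \<mu> \<phi> \<gamma> f = pt (Min I)"
  unfolding left_end_def
proof (rule the_equality)
  show "pt (Min I) \<in> Sgam \<mu> \<phi> \<gamma> f \<and> (\<forall>q\<in>Sgam \<mu> \<phi> \<gamma> f. fst (pt (Min I)) \<le> fst q)"
    using pt_Sgam[OF Min_I] Sgam_bounds by simp
  fix p assume p: "p \<in> Sgam \<mu> \<phi> \<gamma> f \<and> (\<forall>q\<in>Sgam \<mu> \<phi> \<gamma> f. fst p \<le> fst q)"
  then have "fst p = fst (pt (Min I))"
    using pt_Sgam[OF Min_I] Sgam_bounds[of p] by force
  then show "p = pt (Min I)" using p pt_Sgam[OF Min_I] Sgam_inj by blast
qed

lemma right_end_eq: "right_end \<mu> \<phi> \<gamma> f = pt (Max I)"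
  unfolding right_end_def
proof (rule the_equality)
  show "pt (Max I) \<in> Sgam \<mu> \<phi> \<gamma> f \<and> (\<forall>q\<in>Sgam \<mu> \<phi> \<gamma> f. fst q \<le> fst (pt (Max I)))"
    using pt_Sgam[OF Max_I] Sgam_bounds by simp
  fix p assume p: "p \<in> Sgam \<mu> \<phi> \<gamma> f \<and> (\<forall>q\<in>Sgam \<mu> \<phi> \<gamma> f. fst q \<le> fst p)"
  then have "fst p = fst (pt (Max I))"
    using pt_Sgam[OF Max_I] Sgam_bounds[of p] by force
  then show "p = pt (Max I)" using p pt_Sgam[OF Max_I] Sgam_inj by blast
qed

text \<open>Between the end points the lower hull is the segment itself, so a point of the polygon
  there must lie on the line. Outside this range a point may lie on the polygon without belonging to
  the face.\<close>

lemma Npoly_between: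
  assumes "Min I \<le> s" "s \<le> Max I"
  shows "phi_coeff \<phi> f s \<noteq> 0 \<and> pt s \<in> Npoly \<mu> \<phi> f \<longleftrightarrow> s \<in> I"
proof
  assume s: "phi_coeff \<phi> f s \<noteq> 0 \<and> pt s \<in> Npoly \<mu> \<phi> f"
  obtain z where z: "z \<in> qconv (NPoints \<mu> \<phi> f)" "fst z = of_nat s" "snd z + qmul (fst z) \<gamma> = w f"
    using qconv_segment[where P = "NPoints \<mu> \<phi> f", OF NPoints_ge, where p = "pt (Min I)" and q = "pt (Max I)" and s = "of_nat s"]
      pt_I[OF Min_I] pt_I[OF Max_I] assms by auto
  then have "snd (pt s) \<le> snd z" using s unfolding Npoly_def by simp
  then have "\<mu> (phi_coeff \<phi> f s) + nsmul s \<gamma> \<le> w f"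
    using z by (metis add_right_mono qmul_of_nat snd_conv)
  then show "s \<in> I" using w_le[of s] s by (simp add: I_def)
next
  assume s: "s \<in> I"
  then show "phi_coeff \<phi> f s \<noteq> 0 \<and> pt s \<in> Npoly \<mu> \<phi> f"
    using pt_Sgam[OF s] by (simp add: I_def Sgam_def)
qed

end

section \<open>MacLane chains\<close>

lemma zmod_subspace_zsmul_iff:
  assumes "zmod.subspace H" "\<exists>k>0. nsmul k x \<in> H"
  obtains m :: nat where "0 < m" "\<And>k. zsmul k x \<in> H \<longleftrightarrow> int m dvd k"
proof -
  define o' where "o' = (LEAST k. 0 < k \<and> nsmul k x \<in> H)"
  have o: "0 < o'" "nsmul o' x \<in> H"
    using LeastI_ex[OF assms(2)] unfolding o'_def by simp_all
  have "zsmul k x \<in> H \<longleftrightarrow> int o' dvd k" for k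
  proof
    assume k: "zsmul k x \<in> H"
    define m where "m = nat (k mod int o')"
    have m: "int m = k mod int o'" using o(1) by (simp add: m_def)
    have "zsmul (k mod int o') x = zsmul k x - zsmul (k div int o') (nsmul o' x)"
      by (simp add: minus_div_mult_eq_mod flip: zsmul_of_nat zmod.scale_left_diff_distrib)
    also have "\<dots> \<in> H" using assms(1) k o(2) by (intro zmod.subspace_diff zmod.subspace_scale[OF _ o(2)])
    finally have "nsmul m x \<in> H" by (simp flip: m zsmul_of_nat)
    moreover have "m < o'" using m o(1) by (metis of_nat_less_iff pos_mod_bound of_nat_0_less_iff)
    ultimately have "m = 0" using not_less_Least[of m "\<lambda>k. 0 < k \<and> nsmul k x \<in> H"] unfolding o'_def by simp
    then show "int o' dvd k" using m by (simp add: mod_0_imp_dvd)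
  next
    assume "int o' dvd k"
    then obtain t where "k = t * int o'" by (metis dvd_def mult.commute)
    then have "zsmul k x = zsmul t (nsmul o' x)" by (simp flip: zsmul_of_nat)
    then show "zsmul k x \<in> H" using assms(1) o(2) by (simp add: zmod.subspace_scale)
  qed
  then show thesis using that o(1) by blast
qed

text \<open>The cosets are represented by the multiples of \<open>x\<close> below its order, so the
  index equals the order of \<open>x\<close> modulo the subgroup. The torsion assumption keeps the
  cardinality in \<open>gindex\<close> finite.\<close>

lemma gindex_adjoin:
  assumes "\<exists>k>0. nsmul k x \<in> zspan S"
  shows "0 < gindex (zspan (insert x S)) (zspan S)"
    and "zsmul k x \<in> zspan S \<longleftrightarrow> int (gindex (zspan (insert x S)) (zspan S)) dvd k"
proof -
  let ?H = "zmod.span S"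
  obtain o' where o: "0 < o'" "\<And>k. zsmul k x \<in> ?H \<longleftrightarrow> int o' dvd k"
    using zmod_subspace_zsmul_iff[of ?H x] assms unfolding zspan_eq_span by auto
  let ?C = "\<lambda>a. (\<lambda>b. a + b) ` ?H"
  have C: "?C a = ?C b \<longleftrightarrow> a - b \<in> ?H" for a b
  proof
    assume "?C a = ?C b"
    moreover have "a \<in> ?C a" using zmod.span_zero by force
    ultimately have "a \<in> ?C b" by simp
    then obtain h where h: "a = b + h" "h \<in> ?H" by (elim imageE)
    then show "a - b \<in> ?H" by simp
  next
    assume ab: "a - b \<in> ?H"
    have "?C u \<subseteq> ?C w" if uw: "u - w \<in> ?H" for u w
    proof
      fix y assume "y \<in> ?C u"
      then obtain h where h: "y = u + h" "h \<in> ?H" by (elim imageE)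
      then have "y = w + ((u - w) + h)" by simp
      moreover have "(u - w) + h \<in> ?H" using uw h(2) by (rule zmod.span_add)
      ultimately show "y \<in> ?C w" by (rule image_eqI)
    qed
    moreover have "b - a \<in> ?H" using zmod.span_neg[OF ab] by simp
    ultimately show "?C a = ?C b" using ab by blast
  qed
  have "?C ` zmod.span (insert x S) = (\<lambda>k. ?C (zsmul (int k) x)) ` {..<o'}"
  proof safe
    fix a assume "a \<in> zmod.span (insert x S)"
    then obtain k where k: "a - zsmul k x \<in> ?H" using zmod.span_breakdown_eq by blast
    define m where "m = nat (k mod int o')"
    have m: "int m = k mod int o'" using o(1) by (simp add: m_def)
    have "zsmul (k - int m) x \<in> ?H" unfolding o(2) m by simp
    then have "(a - zsmul k x) + zsmul (k - int m) x \<in> ?H" using k by (intro zmod.span_add)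
    then have "a - zsmul (int m) x \<in> ?H" by (simp add: zmod.scale_left_diff_distrib)
    then have "?C a = ?C (zsmul (int m) x)" unfolding C .
    moreover have "m < o'" using m o(1) by (metis of_nat_less_iff pos_mod_bound of_nat_0_less_iff)
    ultimately show "?C a \<in> (\<lambda>k. ?C (zsmul (int k) x)) ` {..<o'}" by blast
  next
    fix k
    have "zsmul (int k) x \<in> zmod.span (insert x S)"
      by (intro zmod.span_scale zmod.span_base) simp
    then show "?C (zsmul (int k) x) \<in> ?C ` zmod.span (insert x S)" by blast
  qed
  moreover have "inj_on (\<lambda>k. ?C (zsmul (int k) x)) {..<o'}"
  proof (rule inj_onI)
    fix i j assume ij: "i \<in> {..<o'}" "j \<in> {..<o'}" "?C (zsmul (int i) x) = ?C (zsmul (int j) x)"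
    then have "zsmul (int i - int j) x \<in> ?H" unfolding C by (simp add: zmod.scale_left_diff_distrib)
    then have "int i mod int o' = int j mod int o'" unfolding o(2) by (simp add: mod_eq_dvd_iff)
    then show "i = j" using ij(1,2) by simp
  qed
  ultimately have "gindex (zspan (insert x S)) (zspan S) = o'"
    unfolding gindex_def zspan_eq_span by (simp add: card_image)
  then show "0 < gindex (zspan (insert x S)) (zspan S)"
    "zsmul k x \<in> zspan S \<longleftrightarrow> int (gindex (zspan (insert x S)) (zspan S)) dvd k"
    using o unfolding zspan_eq_span by simp_all
qed

lemma zspan_insert_cong: "zspan S = zspan S' \<Longrightarrow> zspan (insert x S) = zspan (insert x S')"
  unfolding zspan_eq_span zmod.span_insert by simp

lemma valgroup_K_subspace:
  assumes "is_valuation_field v"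
  shows "zmod.subspace (valgroup_K v)"
proof -
  have mult: "v (a * b) = v a + v b" if "a \<noteq> 0" "b \<noteq> 0" for a b
    using assms that by (simp add: is_valuation_field_def)
  have one: "v 1 = 0" using mult[of 1 1] by simp
  have add: "x + y \<in> valgroup_K v" if xy: "x \<in> valgroup_K v" "y \<in> valgroup_K v" for x y
  proof -
    obtain a b where "a \<noteq> 0" "b \<noteq> 0" "x = v a" "y = v b" using xy by (auto simp: valgroup_K_def)
    then show ?thesis unfolding valgroup_K_def using mult[of a b] by (intro image_eqI[of _ _ "a * b"]) auto
  qed
  have neg: "- x \<in> valgroup_K v" if x: "x \<in> valgroup_K v" for x
  proof -
    obtain a where a: "a \<noteq> 0" "x = v a" using x by (auto simp: valgroup_K_def)
    then have "v a + v (inverse a) = 0" using mult[of a "inverse a"] one by simp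
    then have "- x = v (inverse a)" using a(2) by (simp add: eq_neg_iff_add_eq_0 minus_unique)
    then show ?thesis unfolding valgroup_K_def using a by (intro image_eqI[of _ _ "inverse a"]) auto
  qed
  have zero: "0 \<in> valgroup_K v" unfolding valgroup_K_def using one by (intro image_eqI[of _ _ 1]) auto
  have nat: "nsmul k x \<in> valgroup_K v" if "x \<in> valgroup_K v" for k x
    using that zero add by (induction k) simp_all
  show ?thesis
    by (rule zmod.subspaceI) (use zero add neg nat in \<open>auto simp: zsmul_def\<close>)
qed

lemma GammaQ_subspace:
  assumes "zmod.subspace G"
  shows "zmod.subspace (GammaQ G)"
proof (rule zmod.subspaceI)
  show "0 \<in> GammaQ G" using zmod.subspace_0[OF assms] by (auto simp: GammaQ_def intro: exI[of _ 1])
next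
  fix x y assume "x \<in> GammaQ G" "y \<in> GammaQ G"
  then obtain k l where kl: "k > 0" "nsmul k x \<in> G" "l > 0" "nsmul l y \<in> G" by (auto simp: GammaQ_def)
  have "nsmul (k * l) (x + y) = zsmul (int l) (nsmul k x) + zsmul (int k) (nsmul l y)"
    unfolding nsmul_add_right zsmul_of_nat by (metis mult.commute nsmul_mult)
  also have "\<dots> \<in> G" using kl assms by (intro zmod.subspace_add zmod.subspace_scale)
  finally show "x + y \<in> GammaQ G" using kl by (auto simp: GammaQ_def intro!: exI[of _ "k * l"])
next
  fix c x assume "x \<in> GammaQ G"
  then obtain k where k: "k > 0" "nsmul k x \<in> G" by (auto simp: GammaQ_def)
  have "nsmul k (zsmul c x) = zsmul c (nsmul k x)" by (simp add: mult.commute flip: zsmul_of_nat)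
  also have "\<dots> \<in> G" using k assms by (intro zmod.subspace_scale)
  finally show "zsmul c x \<in> GammaQ G" using k by (auto simp: GammaQ_def)
qed

section \<open>Valuations and stable units along a MacLane chain\<close>

locale maclane_chain =
  fixes v :: "'k::field \<Rightarrow> 'g::linordered_ab_group_add"
    and \<phi> :: "nat \<Rightarrow> 'k poly" and \<gamma> :: "nat \<Rightarrow> 'g" and r :: nat
  assumes val: "is_valuation_field v" and chain: "is_MacLane_chain v \<phi> \<gamma> r"
begin

abbreviation "M \<equiv> MC v \<phi> \<gamma>"

lemma MC_augment: "M i = augment (mu_prev v \<phi> \<gamma> i) (\<phi> i) (\<gamma> i)"
  by (cases i) (simp_all add: mu_prev_def)

text \<open>At each level the augmentation makes \<open>M i\<close> a valuation, and this allows the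
  key polynomial theory to be applied at the next level.\<close>

lemma augmentation_chain: "i \<le> r \<Longrightarrow> augmentation (mu_prev v \<phi> \<gamma> i) (\<phi> i) (\<gamma> i)"
proof (induction i)
  case 0
  obtain a where "\<phi> 0 = [:a, 1:]" using chain by (auto simp: is_MacLane_chain_def)
  then show ?case by (simp add: mu_prev_def mu_minus1_augmentation[OF val])
next
  case (Suc i)
  then interpret augmentation "mu_prev v \<phi> \<gamma> i" "\<phi> i" "\<gamma> i" by simp
  have "key_poly (M i) (\<phi> (Suc i))" "M i (\<phi> (Suc i)) < \<gamma> (Suc i)"
    using chain Suc(2) by (auto simp: is_MacLane_chain_def)
  then show ?case
    using aug.key_augmentation[folded MC_augment] by (simp add: mu_prev_def)
qed

lemma poly_valuation_chain: "i \<le> r \<Longrightarrow> poly_valuation (M i)"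
  unfolding MC_augment by (rule augmentation.augment_poly_valuation[OF augmentation_chain])

text \<open>The initial forms of non-zero constants and of the previous key polynomials are
  units of the graded algebra, and their values do not change along the chain.\<close>
definition stable :: "nat \<Rightarrow> 'k poly \<Rightarrow> 'g \<Rightarrow> bool" where
  "stable i f \<alpha> \<longleftrightarrow> f \<noteq> 0 \<and> M i f = \<alpha> \<and> (\<exists>g. poly_valuation.initial_inverse (M i) f g)"

text \<open>The second claim is the place where the chain condition that
  \<open>\<phi> (Suc i)\<close> does not divide \<open>\<phi> i\<close> enters.\<close>

lemma stable_Suc:
  assumes "Suc i \<le> r"
  shows "stable i f \<alpha> \<Longrightarrow> stable (Suc i) f \<alpha>" "stable (Suc i) (\<phi> i) (\<gamma> i)"
proof -
  interpret poly_valuation "M i" using poly_valuation_chain assms by simp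
  interpret a: augmentation "mu_prev v \<phi> \<gamma> i" "\<phi> i" "\<gamma> i" using augmentation_chain assms by simp
  have key: "key_poly (M i) (\<phi> (Suc i))" "M i (\<phi> (Suc i)) < \<gamma> (Suc i)"
    and nd: "\<not> mu_dvd (M i) (\<phi> (Suc i)) (\<phi> i)"
    using chain assms by (auto simp: is_MacLane_chain_def)
  show "stable i f \<alpha> \<Longrightarrow> stable (Suc i) f \<alpha>"
    using augment_initial_inverse[OF key, of f] unfolding stable_def by auto
  show "stable (Suc i) (\<phi> i) (\<gamma> i)"
    using augment_not_dvd_inverse[OF key a.phi_nz nd] a.phi_nz a.w_phi
    unfolding stable_def by (simp add: MC_augment[of i])
qed

lemma stable_const: "i \<le> r \<Longrightarrow> c \<noteq> 0 \<Longrightarrow> stable i [:c:] (v c)"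
proof (induction i)
  case 0
  interpret augmentation "mu_prev v \<phi> \<gamma> 0" "\<phi> 0" "\<gamma> 0" using augmentation_chain by simp
  have "degree [:c:] < degree (\<phi> 0)" "[:c:] \<noteq> 0" using deg_pos 0 by simp_all
  then show ?case
    using small_initial_inverse[of "[:c:]"] w_small[of "[:c:]"]
    unfolding stable_def MC_augment by (metis coeff_pCons_0 mu_minus1_def mu_prev_def)
next
  case (Suc i)
  then show ?case using stable_Suc(1)[of i] by simp
qed

lemma stable_phi: "j < i \<Longrightarrow> i \<le> r \<Longrightarrow> stable i (\<phi> j) (\<gamma> j)"
proof (induction i)
  case (Suc i)
  then show ?case using stable_Suc[of i] by (cases "j = i") auto
qed simp

text \<open>\<open>mu_minus1\<close> reads only the constant coefficient; at a non-constant
  polynomial it may return the meaningless value \<open>v 0\<close>. Hence the degree restriction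
  for \<open>i = 0\<close>.\<close>

lemma valgroup_prev_eq: "valgroup_prev v \<phi> \<gamma> i = mu_prev v \<phi> \<gamma> i ` {a. a \<noteq> 0 \<and> (i = 0 \<longrightarrow> degree a = 0)}"
proof (cases "i = 0")
  case True
  have "valgroup_K v = mu_minus1 v ` {a. a \<noteq> 0 \<and> degree a = 0}"
  proof safe
    fix x assume "x \<in> valgroup_K v"
    then obtain c where "c \<noteq> 0" "x = v c" by (auto simp: valgroup_K_def)
    then show "x \<in> mu_minus1 v ` {a. a \<noteq> 0 \<and> degree a = 0}"
      by (intro image_eqI[of _ _ "[:c:]"]) (simp_all add: mu_minus1_def)
  next
    fix a :: "'k poly" assume "a \<noteq> 0" "degree a = 0"
    then show "mu_minus1 v a \<in> valgroup_K v"
      by (auto simp: valgroup_K_def mu_minus1_def elim!: degree_eq_zeroE)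
  qed
  then show ?thesis using True by (simp add: valgroup_prev_def mu_prev_def)
next
  case False
  then show ?thesis by (simp add: valgroup_prev_def mu_prev_def valgroup_def)
qed

lemma MC_value:
  assumes "i \<le> r" "f \<noteq> 0"
  obtains s x where "M i f = x + nsmul s (\<gamma> i)" "x \<in> valgroup_prev v \<phi> \<gamma> i"
proof -
  interpret augmentation "mu_prev v \<phi> \<gamma> i" "\<phi> i" "\<gamma> i" using augmentation_chain assms by simp
  obtain s where s: "phi_coeff (\<phi> i) f s \<noteq> 0" "M i f = mu_prev v \<phi> \<gamma> i (phi_coeff (\<phi> i) f s) + nsmul s (\<gamma> i)"
    using w_Pgt_self[OF assms(2)] w_Pge_self[of f] unfolding Pgt_w Pge_w MC_augment
    by (metis order_le_less)
  have "degree (\<phi> 0) = 1" using chain by (auto simp: is_MacLane_chain_def)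
  then have "i = 0 \<longrightarrow> degree (phi_coeff (\<phi> i) f s) = 0"
    using degree_phi_coeff[OF deg_pos, of f s] by auto
  then have "mu_prev v \<phi> \<gamma> i (phi_coeff (\<phi> i) f s) \<in> valgroup_prev v \<phi> \<gamma> i"
    using s(1) unfolding valgroup_prev_eq by blast
  then show thesis using that s(2) by blast
qed

section \<open>Value groups and ramification indices\<close>

lemma gamma_torsion: "zspan (valgroup_K v \<union> \<gamma> ` {..r}) \<subseteq> GammaQ (valgroup_K v)"
  unfolding zspan_eq_span
proof (rule zmod.span_minimal)
  show "valgroup_K v \<union> \<gamma> ` {..r} \<subseteq> GammaQ (valgroup_K v)"
  proof safe
    fix x assume "x \<in> valgroup_K v"
    then show "x \<in> GammaQ (valgroup_K v)" by (auto simp: GammaQ_def intro!: exI[of _ 1])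
  next
    fix i assume "i \<le> r"
    then show "\<gamma> i \<in> GammaQ (valgroup_K v)" using chain by (simp add: is_MacLane_chain_def)
  qed
qed (intro GammaQ_subspace valgroup_K_subspace val)

lemma valgroup_superset:
  assumes i: "i \<le> r" and sub: "valgroup (M i) \<subseteq> GammaQ (valgroup_K v)"
  shows "zspan (valgroup_K v \<union> \<gamma> ` {..i}) \<subseteq> valgroup (M i)"
  unfolding zspan_eq_span
proof (rule zmod.span_minimal)
  interpret poly_valuation "M i" using poly_valuation_chain i .
  interpret a: augmentation "mu_prev v \<phi> \<gamma> i" "\<phi> i" "\<gamma> i" using augmentation_chain i by simp
  have V: "f \<noteq> 0 \<Longrightarrow> M i f \<in> valgroup (M i)" for f by (simp add: valgroup_def)
  have K: "valgroup_K v \<subseteq> valgroup (M i)"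
  proof
    fix x assume "x \<in> valgroup_K v"
    then obtain c where c: "c \<noteq> 0" "x = v c" by (auto simp: valgroup_K_def)
    then show "x \<in> valgroup (M i)"
      using stable_const[OF i c(1)] V[of "[:c:]"] by (simp add: stable_def)
  qed
  have "\<gamma> j \<in> valgroup (M i)" if "j \<le> i" for j
  proof (cases "j = i")
    case True
    then show ?thesis using V[OF a.phi_nz] a.w_phi by (simp flip: MC_augment)
  next
    case False
    then have "stable i (\<phi> j) (\<gamma> j)" using stable_phi[of j i] that i by simp
    then show ?thesis using V[of "\<phi> j"] by (simp add: stable_def)
  qed
  then show "valgroup_K v \<union> \<gamma> ` {..i} \<subseteq> valgroup (M i)" using K by auto
  have add: "x + y \<in> valgroup (M i)" if xy: "x \<in> valgroup (M i)" "y \<in> valgroup (M i)" for x y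
  proof -
    obtain f g where fg: "f \<noteq> 0" "g \<noteq> 0" "x = M i f" "y = M i g" using xy by (auto simp: valgroup_def)
    then show ?thesis using V[of "f * g"] by (simp add: val_mult)
  qed
  have zero: "0 \<in> valgroup (M i)" using V[of 1] by simp
  have nat: "nsmul k x \<in> valgroup (M i)" if "x \<in> valgroup (M i)" for k x
    using that zero add by (induction k) simp_all
  \<comment> \<open>Values of polynomials are visibly closed under addition only. Negatives come
    from \<open>- x = (k - 1) x - k x\<close>, where \<open>k x\<close> lies in the group of values
    of constants.\<close>
  have neg: "- x \<in> valgroup (M i)" if x: "x \<in> valgroup (M i)" for x
  proof -
    obtain k where k: "k > 0" "nsmul k x \<in> valgroup_K v" using x sub by (auto simp: GammaQ_def)
    then have "- nsmul k x \<in> valgroup (M i)"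
      using zmod.subspace_neg[OF valgroup_K_subspace[OF val]] K by blast
    then have "nsmul (k - 1) x + - nsmul k x \<in> valgroup (M i)" using nat[OF x] add by blast
    moreover have "nsmul (k - 1) x + - nsmul k x = - x" using k(1) by (cases k) simp_all
    ultimately show ?thesis by simp
  qed
  show "zmod.subspace (valgroup (M i))"
    by (rule zmod.subspaceI) (use zero add neg nat in \<open>auto simp: zsmul_def\<close>)
qed

text \<open>The previous value group determines the value group of \<open>M i\<close>, which in turn
  is the previous group at the next level; the two equations thus advance together.\<close>

lemma valgroup_MC: "i \<le> r \<Longrightarrow> valgroup (M i) = zspan (valgroup_K v \<union> \<gamma> ` {..i})"
  and valgroup_prev_span: "i \<le> r \<Longrightarrow> valgroup_prev v \<phi> \<gamma> i = zspan (valgroup_K v \<union> \<gamma> ` {..<i})"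
proof -
  have K: "zspan (valgroup_K v) = valgroup_K v"
    unfolding zspan_eq_span using zmod.span_eq_iff valgroup_K_subspace[OF val] by blast
  have MC: "valgroup (M i) = zspan (valgroup_K v \<union> \<gamma> ` {..i})"
    if i: "i \<le> r" and prev: "valgroup_prev v \<phi> \<gamma> i = zspan (valgroup_K v \<union> \<gamma> ` {..<i})" for i
  proof
    show sub: "valgroup (M i) \<subseteq> zspan (valgroup_K v \<union> \<gamma> ` {..i})"
    proof
      fix y assume "y \<in> valgroup (M i)"
      then obtain f where f: "f \<noteq> 0" "y = M i f" by (auto simp: valgroup_def)
      obtain s x where x: "M i f = x + nsmul s (\<gamma> i)" "x \<in> valgroup_prev v \<phi> \<gamma> i"
        using MC_value[OF i f(1)] .
      have "x \<in> zspan (valgroup_K v \<union> \<gamma> ` {..i})"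
        using x(2) zmod.span_mono[of "valgroup_K v \<union> \<gamma> ` {..<i}" "valgroup_K v \<union> \<gamma> ` {..i}"]
        unfolding prev zspan_eq_span by force
      then show "y \<in> zspan (valgroup_K v \<union> \<gamma> ` {..i})"
        unfolding f x(1) zspan_eq_span zsmul_of_nat[symmetric]
        by (intro zmod.span_add zmod.span_scale[OF zmod.span_base]) auto
    qed
    \<comment> \<open>By the inclusion just shown all values are torsion over those of the
      constants, as \<open>valgroup_superset\<close> requires.\<close>
    have "zspan (valgroup_K v \<union> \<gamma> ` {..i}) \<subseteq> zspan (valgroup_K v \<union> \<gamma> ` {..r})"
      unfolding zspan_eq_span using i by (intro zmod.span_mono) auto
    then have "valgroup (M i) \<subseteq> GammaQ (valgroup_K v)" using sub gamma_torsion by blast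
    then show "zspan (valgroup_K v \<union> \<gamma> ` {..i}) \<subseteq> valgroup (M i)"
      using valgroup_superset[OF i] by blast
  qed
  have prev: "i \<le> r \<Longrightarrow> valgroup_prev v \<phi> \<gamma> i = zspan (valgroup_K v \<union> \<gamma> ` {..<i})" for i
  proof (induction i)
    case 0
    then show ?case using K by (simp add: valgroup_prev_def)
  next
    case (Suc i)
    then show ?case using MC[of i] by (simp add: valgroup_prev_def lessThan_Suc_atMost)
  qed
  then show "i \<le> r \<Longrightarrow> valgroup_prev v \<phi> \<gamma> i = zspan (valgroup_K v \<union> \<gamma> ` {..<i})" .
  show "i \<le> r \<Longrightarrow> valgroup (M i) = zspan (valgroup_K v \<union> \<gamma> ` {..i})" using MC prev by blast
qed

lemma e_idx_order:
  assumes "i \<le> r"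
  shows "0 < e_idx v \<phi> \<gamma> i"
    and "zsmul k (\<gamma> i) \<in> valgroup_prev v \<phi> \<gamma> i \<longleftrightarrow> int (e_idx v \<phi> \<gamma> i) dvd k"
proof -
  let ?S = "valgroup_K v \<union> \<gamma> ` {..<i}"
  have "\<gamma> i \<in> GammaQ (valgroup_K v)" using chain assms by (simp add: is_MacLane_chain_def)
  then have t: "\<exists>k>0. nsmul k (\<gamma> i) \<in> zspan ?S"
    unfolding zspan_eq_span GammaQ_def by (auto intro: zmod.span_base)
  have "valgroup_K v \<union> \<gamma> ` {..i} = insert (\<gamma> i) ?S" by (auto simp flip: lessThan_Suc_atMost simp: lessThan_Suc)
  then have "e_idx v \<phi> \<gamma> i = gindex (zspan (insert (\<gamma> i) ?S)) (zspan ?S)"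
    unfolding e_idx_def valgroup_MC[OF assms] valgroup_prev_span[OF assms] by simp
  then show "0 < e_idx v \<phi> \<gamma> i"
    "zsmul k (\<gamma> i) \<in> valgroup_prev v \<phi> \<gamma> i \<longleftrightarrow> int (e_idx v \<phi> \<gamma> i) dvd k"
    using gindex_adjoin[OF t] unfolding valgroup_prev_span[OF assms] by simp_all
qed

end

section \<open>Residual polynomials\<close>

lemma Fract_1_power: "Fract (f ^ k) 1 = Fract f 1 ^ k" for f :: "'a::idom"
proof (induction k)
  case (Suc k)
  have "Fract (f ^ Suc k) 1 = Fract f 1 * Fract (f ^ k) 1" by simp
  then show ?case using Suc by simp
qed (simp add: One_fract_def)

locale residual_chain = maclane_chain v \<phi> \<gamma> r + divisible_group "TYPE('g)"
  for v :: "'k::field \<Rightarrow> 'g::linordered_ab_group_add"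
    and \<phi> :: "nat \<Rightarrow> 'k poly" and \<gamma> :: "nat \<Rightarrow> 'g" and r :: nat +
  fixes n :: nat and \<iota>0 :: "nat \<Rightarrow> 'g" and \<pi>0 :: "nat \<Rightarrow> 'k"
  assumes iota_in: "\<forall>j<n. \<iota>0 j \<in> valgroup_K v"
    and iota_indep: "zindep \<iota>0 n"
    and h_in: "\<forall>i\<le>r. h_val v \<phi> \<gamma> i \<in> Gsub \<iota>0 n \<gamma> i"
    and pi0: "\<forall>j<n. \<pi>0 j \<noteq> 0 \<and> v (\<pi>0 j) = \<iota>0 j"
begin

abbreviation "e \<equiv> e_idx v \<phi> \<gamma>"
abbreviation "h \<equiv> h_val v \<phi> \<gamma>"
text \<open>The index is shifted by one: \<open>Gam r\<close> is \<Gamma>_{r-1}, which carries the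
  exponents of the rational functions, and \<open>Gam (Suc r)\<close> is \<Gamma>_r.\<close>

abbreviation "Gam \<equiv> Gsub \<iota>0 n \<gamma>"

sublocale top: augmentation "mu_prev v \<phi> \<gamma> r" "\<phi> r" "\<gamma> r"
  rewrites "augment (mu_prev v \<phi> \<gamma> r) (\<phi> r) (\<gamma> r) = MC v \<phi> \<gamma> r"
  by (rule augmentation_chain) (simp_all add: MC_augment)

lemma Gam_Suc: "Gam (Suc i) = zspan (insert (\<gamma> i) (\<iota>0 ` {..<n} \<union> \<gamma> ` {..<i}))"
  by (simp add: Gsub_def lessThan_Suc)

lemma Gam_add: "x \<in> Gam i \<Longrightarrow> y \<in> Gam i \<Longrightarrow> x + y \<in> Gam i"
    and Gam_diff: "x \<in> Gam i \<Longrightarrow> y \<in> Gam i \<Longrightarrow> x - y \<in> Gam i"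
    and Gam_neg: "x \<in> Gam i \<Longrightarrow> - x \<in> Gam i"
    and Gam_zsmul: "x \<in> Gam i \<Longrightarrow> zsmul k x \<in> Gam i"
    and Gam_0: "0 \<in> Gam i"
  unfolding Gsub_def zspan_eq_span
  by (simp_all add: zmod.span_add zmod.span_diff zmod.span_neg zmod.span_scale zmod.span_zero)

lemma Gam_prev: "Gam r \<subseteq> valgroup_prev v \<phi> \<gamma> r"
  unfolding Gsub_def valgroup_prev_span[OF order_refl] zspan_eq_span
  using iota_in by (intro zmod.span_mono) auto

lemma zsmul_e: "zsmul (int (e i)) (\<gamma> i) = h i"
  by (simp add: h_val_def zsmul_of_nat)

text \<open>In essence, \<Gamma>_r meets the previous value group in \<Gamma>_{r-1}. The multiple of
  \<open>\<gamma> r\<close> separating \<open>x\<close> from \<open>Gam r\<close> lies in the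
  previous value group, so it is a multiple of \<open>h r\<close>, which belongs to
  \<open>Gam r\<close>.\<close>

lemma Gam_inter:
  assumes x: "x \<in> valgroup_prev v \<phi> \<gamma> r" and g: "x + nsmul s (\<gamma> r) \<in> Gam (Suc r)"
  shows "x \<in> Gam r"
proof -
  obtain k where k: "x + nsmul s (\<gamma> r) - zsmul k (\<gamma> r) \<in> Gam r"
    using g unfolding Gam_Suc zspan_eq_span zmod.span_insert by (auto simp: Gsub_def zspan_eq_span)
  then have k': "x + zsmul (int s - k) (\<gamma> r) \<in> Gam r"
    by (simp add: zmod.scale_left_diff_distrib zsmul_of_nat algebra_simps)
  then have "x + zsmul (int s - k) (\<gamma> r) \<in> valgroup_prev v \<phi> \<gamma> r" using Gam_prev by blast
  then have "(x + zsmul (int s - k) (\<gamma> r)) - x \<in> valgroup_prev v \<phi> \<gamma> r"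
    using x unfolding valgroup_prev_span[OF order_refl] zspan_eq_span by (rule zmod.span_diff)
  then have "int (e r) dvd int s - k" using e_idx_order(2)[OF order_refl] by simp
  then obtain t where "int s - k = t * int (e r)" by (metis dvd_def mult.commute)
  then have "zsmul (int s - k) (\<gamma> r) = zsmul t (h r)" by (simp flip: zsmul_e)
  then have "zsmul (int s - k) (\<gamma> r) \<in> Gam r" using h_in by (simp add: Gam_zsmul)
  from Gam_diff[OF k' this] show ?thesis by simp
qed

section \<open>Units attached to the lattice bases\<close>

definition bas :: "nat \<Rightarrow> nat \<Rightarrow> 'g" where "bas i = fst (basis_pi n \<iota>0 \<pi>0 \<phi> \<gamma> i)"
definition pis :: "nat \<Rightarrow> nat \<Rightarrow> 'k poly fract" where "pis i = snd (basis_pi n \<iota>0 \<pi>0 \<phi> \<gamma> i)"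

lemma bas_Suc: "bas (Suc i) = next_basis n (bas i) (\<gamma> i)"
  and pis_Suc: "pis (Suc i) = next_pi n (bas i) (\<gamma> i) (\<phi> i) (pis i)"
  by (simp_all add: bas_def pis_def Let_def split_beta)

lemma stable_initial_unit: "stable r f \<alpha> \<Longrightarrow> top.aug.initial_unit (Fract f 1) \<alpha>"
  unfolding stable_def using top.aug.initial_unit_poly by blast

text \<open>At every level the units are taken in the graded algebra of the last valuation, where
  \<open>stable_const\<close> and \<open>stable_phi\<close> supply the initial forms of the
  constants and of the earlier key polynomials.\<close>

lemma basis_chain:
  "i \<le> r \<Longrightarrow> zindep (bas i) n \<and> zspan (bas i ` {..<n}) = Gam i \<and>
     (\<forall>j<n. top.aug.initial_unit (pis i j) (bas i j))"
proof (induction i)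
  case 0
  have "top.aug.initial_unit (Fract [:\<pi>0 j:] 1) (\<iota>0 j)" if "j < n" for j
    using stable_const[OF order_refl, of "\<pi>0 j"] pi0 that by (intro stable_initial_unit) auto
  then show ?case using iota_indep by (simp add: bas_def pis_def Gsub_def)
next
  case (Suc i)
  then have IH: "zindep (bas i) n" "zspan (bas i ` {..<n}) = Gam i"
    "\<And>j. j < n \<Longrightarrow> top.aug.initial_unit (pis i j) (bas i j)" and i: "i < r" by auto
  \<comment> \<open>The multiple \<open>h i\<close> of \<open>\<gamma> i\<close> lies in the current
    lattice; this is the torsion assumption of the basis change.\<close>
  have "int (e i) \<noteq> 0 \<and> zsmul (int (e i)) (\<gamma> i) \<in> zspan (bas i ` {..<n})"
    using e_idx_order(1)[of i] IH(2) h_in i by (simp add: zsmul_e)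
  then have "\<exists>k. k \<noteq> 0 \<and> zsmul k (\<gamma> i) \<in> zspan (bas i ` {..<n})" by (rule exI)
  then interpret st: basis_step "TYPE('g)" n "bas i" "\<gamma> i"
    by unfold_locales (use IH(1) in auto)
  have "zspan (insert (\<gamma> i) (bas i ` {..<n})) = Gam (Suc i)"
    unfolding Gam_Suc using IH(2) unfolding Gsub_def by (rule zspan_insert_cong)
  then have span: "zspan (bas (Suc i) ` {..<n}) = Gam (Suc i)"
    using st.span_next_basis by (simp add: bas_Suc)
  have phi: "top.aug.initial_unit (Fract (\<phi> i) 1) (\<gamma> i)"
    using stable_phi[OF i] by (intro stable_initial_unit) simp
  have "top.aug.initial_unit (pis (Suc i) j) (bas (Suc i) j)" if j: "j < n" for j
    unfolding bas_Suc pis_Suc next_pi_def Let_def st.next_basis_exponents[OF j]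
    using IH(3) j
    by (intro top.aug.initial_unit_mult top.aug.initial_unit_prod top.aug.initial_unit_powi phi) auto
  then show ?case using span st.next_basis_indep by (simp add: bas_Suc)
qed

abbreviation "pp \<equiv> pi_pow n \<iota>0 \<pi>0 \<phi> \<gamma> r"

lemma pp_eq: "pp \<alpha> = (\<Prod>j<n. pis r j powi coordsZ n (bas r) \<alpha> j)"
  by (simp add: pi_pow_def bas_def pis_def Let_def split_beta)

lemma basis_top: "zindep (bas r) n" "zspan (bas r ` {..<n}) = Gam r"
  and pis_unit: "j < n \<Longrightarrow> top.aug.initial_unit (pis r j) (bas r j)"
  using basis_chain[OF order_refl] by auto

lemma pp_unit: "\<alpha> \<in> Gam r \<Longrightarrow> top.aug.initial_unit (pp \<alpha>) \<alpha>"
proof -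
  assume a: "\<alpha> \<in> Gam r"
  have "top.aug.initial_unit (pp \<alpha>) (\<Sum>j<n. zsmul (coordsZ n (bas r) \<alpha> j) (bas r j))"
    unfolding pp_eq by (intro top.aug.initial_unit_prod top.aug.initial_unit_powi pis_unit) auto
  then show ?thesis using coordsZ_spec(2)[OF basis_top(1)] a basis_top(2) by simp
qed

lemma pp_add: "\<alpha> \<in> Gam r \<Longrightarrow> \<beta> \<in> Gam r \<Longrightarrow> pp (\<alpha> + \<beta>) = pp \<alpha> * pp \<beta>"
proof -
  assume ab: "\<alpha> \<in> Gam r" "\<beta> \<in> Gam r"
  have "pis r j \<noteq> 0" if "j < n" for j using pis_unit[OF that] by (simp add: top.aug.initial_unit_def)
  then show ?thesis
    unfolding pp_eq coordsZ_add[OF basis_top(1) ab[folded basis_top(2)]]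
    by (simp add: power_int_add flip: prod.distrib)
qed

lemma pp_0: "pp 0 = 1"
proof -
  have "pp 0 = pp 0 * pp 0" using pp_add[OF Gam_0 Gam_0] by simp
  moreover have "pp 0 \<noteq> 0" using pp_unit[OF Gam_0] by (simp add: top.aug.initial_unit_def)
  ultimately show ?thesis by simp
qed

lemma pp_power: "\<alpha> \<in> Gam r \<Longrightarrow> pp \<alpha> ^ k = pp (nsmul k \<alpha>)"
proof (induction k)
  case (Suc k)
  have "nsmul k \<alpha> \<in> Gam r" using Suc(2) Gam_zsmul[of \<alpha> r "int k"] by (simp add: zsmul_of_nat)
  then show ?case using Suc pp_add by simp
qed (simp add: pp_0)

lemma pp_form:
  assumes "\<alpha> \<in> Gam r"
  obtains f where "top.aug.initial_form (pp \<alpha>) \<alpha> f"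
  using pp_unit[OF assms] unfolding top.aug.initial_unit_def by blast

text \<open>Both sides are homogeneous of degree \<open>M r f\<close>, so the identity is a
  congruence of polynomials modulo larger values. It is proved separately for each index of the
  face.\<close>

lemma residual_formula:
  assumes f_nz: "f \<noteq> 0" and f_att: "M r f \<in> Gam (Suc r)"
  shows "u_r v \<phi> \<gamma> r f \<in> Gam r \<and>
    Hmu (M r) f = Gmul (M r) (Gpow (M r) (Hmu (M r) (\<phi> r)) (s_r v \<phi> \<gamma> r f))
      (Gmul (M r) (Hq (M r) (pp (u_r v \<phi> \<gamma> r f))) (R_at_y v n \<iota>0 \<pi>0 \<phi> \<gamma> r f))"
proof -
  interpret newton "TYPE('g)" "mu_prev v \<phi> \<gamma> r" "\<phi> r" "\<gamma> r" f
    rewrites "augment (mu_prev v \<phi> \<gamma> r) (\<phi> r) (\<gamma> r) = MC v \<phi> \<gamma> r"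
    by unfold_locales (simp_all add: f_nz MC_augment)
  let ?\<mu> = "M r" and ?\<mu>' = "mu_prev v \<phi> \<gamma> r"
  define a where "a s = phi_coeff (\<phi> r) f s" for s
  define s0 s1 where "s0 = Min I" and "s1 = Max I"
  define u where "u = ?\<mu>' (a s0)"
  have s_r: "s_r v \<phi> \<gamma> r f = s0" and u_r: "u_r v \<phi> \<gamma> r f = u" and s'_r: "s'_r v \<phi> \<gamma> r f = s1"
    unfolding s_r_def u_r_def s'_r_def left_end_eq right_end_eq s0_def s1_def u_def a_def by simp_all
  have I: "a s \<noteq> 0" "?\<mu>' (a s) + nsmul s (\<gamma> r) = ?\<mu> f" if "s \<in> I" for s
    using that unfolding I_def a_def by auto
  have deg_a: "degree (a s) < degree (\<phi> r)" for s
    unfolding a_def by (rule degree_phi_coeff[OF top.deg_pos])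
  have mu_a: "?\<mu> (a s) = ?\<mu>' (a s)" if "a s \<noteq> 0" for s
    using top.w_small[OF deg_a that] .
  have degphi0: "degree (\<phi> 0) = 1" using chain by (auto simp: is_MacLane_chain_def)
  have prev_a: "?\<mu>' (a s) \<in> valgroup_prev v \<phi> \<gamma> r" if "a s \<noteq> 0" for s
    unfolding valgroup_prev_eq using that deg_a[of s] degphi0 by (intro imageI) auto
  \<comment> \<open>Here attainability of \<open>f\<close> enters: it places the values of all
    relevant coefficients in the lattice carrying \<open>pp\<close>.\<close>
  have Gam_a: "?\<mu>' (a s) \<in> Gam r" if "s \<in> I" for s
    using Gam_inter[OF prev_a[OF I(1)[OF that]], of s] I(2)[OF that] f_att by simp
  have s0I: "s0 \<in> I" and s1I: "s1 \<in> I" unfolding s0_def s1_def by (rule Min_I, rule Max_I)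
  then have u: "u \<in> Gam r" unfolding u_def by (intro Gam_a)
  have bd: "s0 \<le> s \<and> s \<le> s1" if "s \<in> I" for s
    using that I_finite unfolding s0_def s1_def by simp
  have e_pos: "0 < e r" by (rule e_idx_order) simp
  \<comment> \<open>Equality of the total values at \<open>s\<close> and \<open>s0\<close> makes the
    multiple of \<open>\<gamma> r\<close> by \<open>s - s0\<close> a difference of previous values,
    and \<open>e r\<close> is the order of \<open>\<gamma> r\<close> modulo these.\<close>
  have e_dvd: "e r dvd s - s0" if s: "s \<in> I" for s
  proof -
    have "zsmul (int s - int s0) (\<gamma> r) = ?\<mu>' (a s0) - ?\<mu>' (a s)"
      using I(2)[OF s] I(2)[OF s0I] by (simp add: zmod.scale_left_diff_distrib zsmul_of_nat algebra_simps)
    also have "\<dots> \<in> valgroup_prev v \<phi> \<gamma> r"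
      using prev_a[OF I(1)[OF s]] prev_a[OF I(1)[OF s0I]]
      unfolding valgroup_prev_span[OF order_refl] zspan_eq_span by (intro zmod.span_diff)
    finally have "int (e r) dvd int s - int s0" using e_idx_order(2)[OF order_refl] by simp
    then show ?thesis using bd[OF s] by (simp flip: of_nat_diff)
  qed
  define d where "d = d_r v \<phi> \<gamma> r f"
  have d: "d = (s1 - s0) div e r" unfolding d_def d_r_def s_r s'_r ..
  define sj where "sj j = s0 + j * e r" for j
  have sj_le: "s0 \<le> sj j \<and> sj j \<le> s1" if "j \<le> d" for j
  proof -
    have "j * e r \<le> d * e r" using that by simp
    also have "\<dots> = s1 - s0" using e_dvd[OF s1I] unfolding d by simp
    finally show ?thesis using bd[OF s1I] unfolding sj_def by simp
  qed
  have I_sj: "I = sj ` {j. j \<le> d \<and> sj j \<in> I}"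
  proof safe
    fix s assume s: "s \<in> I"
    define j where "j = (s - s0) div e r"
    have "sj j = s" unfolding sj_def j_def using e_dvd[OF s] bd[OF s] by simp
    moreover have "j \<le> d" unfolding j_def d using bd[OF s] by (intro div_le_mono diff_le_mono) simp
    ultimately show "s \<in> sj ` {j. j \<le> d \<and> sj j \<in> I}" using s by blast
  qed
  have sj_inj: "inj_on sj A" for A using e_pos by (auto simp: inj_on_def sj_def)

  define t where "t s = a s * \<phi> r ^ s" for s
  have mu_t: "t s \<noteq> 0 \<and> ?\<mu> (t s) = ?\<mu>' (a s) + nsmul s (\<gamma> r)" if "a s \<noteq> 0" for s
    using that top.phi_nz top.w_phi by (simp add: t_def top.aug.val_mult top.aug.val_power mu_a)
  obtain N where N: "\<forall>s\<ge>N. a s = 0" using phi_expansion[OF top.deg_pos, of f] unfolding a_def by blast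
  have "f = (\<Sum>s<N. t s)" using sum_phi_coeff[OF top.deg_pos N[unfolded a_def]] by (simp add: t_def a_def)
  also have "\<dots> = (\<Sum>s\<in>I. t s) + (\<Sum>s\<in>{..<N} - I. t s)"
  proof -
    have "I \<subseteq> {..<N}" using I(1) N by (meson lessThan_iff not_le subsetI)
    then show ?thesis by (simp add: sum.subset_diff)
  qed
  also have "(\<Sum>s\<in>I. t s) = (\<Sum>j\<in>{j. j \<le> d \<and> sj j \<in> I}. t (sj j))"
    by (subst I_sj) (simp add: sum.reindex[OF sj_inj])
  \<comment> \<open>Indices off the face are filled with 0, matching the zero coefficients of the
    residual polynomial.\<close>
  also have "\<dots> = (\<Sum>j\<le>d. if sj j \<in> I then t (sj j) else 0)"
    by (simp add: sum.If_cases Int_def)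
  finally have f_eq: "f = (\<Sum>j\<le>d. if sj j \<in> I then t (sj j) else 0) + (\<Sum>s\<in>{..<N} - I. t s)" .
  have "(\<Sum>s\<in>{..<N} - I. t s) \<in> Pgt ?\<mu> (?\<mu> f)"
  proof (rule top.aug.Pgt_sum)
    fix s assume "s \<in> {..<N} - I"
    then have s: "s \<notin> I" by simp
    show "t s \<in> Pgt ?\<mu> (?\<mu> f)"
    proof (cases "a s = 0")
      case False
      then have "?\<mu> f \<noteq> ?\<mu> (t s)" using s mu_t by (auto simp: I_def a_def)
      moreover have "?\<mu> f \<le> ?\<mu> (t s)" using mu_t[OF False] w_le[of s] False by (simp add: a_def)
      ultimately show ?thesis unfolding Pgt_def by (simp add: order.strict_iff_order)
    qed (simp add: t_def)
  qed
  moreover have "x \<in> A \<Longrightarrow> f = g + x \<Longrightarrow> f - g \<in> A" for f g x :: "'k poly" and A by simp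
  ultimately have rest: "f - (\<Sum>j\<le>d. if sj j \<in> I then t (sj j) else 0) \<in> Pgt ?\<mu> (?\<mu> f)"
    using f_eq by blast

  obtain P where P: "top.aug.initial_form (pp u) u P" using pp_form[OF u] .
  have hG: "- h r \<in> Gam r" using h_in by (simp add: Gam_neg)
  obtain Hh where Hh: "top.aug.initial_form (pp (- h r)) (- h r) Hh" using pp_form[OF hG] .
  define Y where "Y = Yfun v n \<iota>0 \<pi>0 \<phi> \<gamma> r"
  have phie: "top.aug.initial_form (Fract (\<phi> r ^ e r) 1) (h r) (\<phi> r ^ e r)"
    using top.aug.initial_form_poly[of "\<phi> r ^ e r"] top.phi_nz top.w_phi by (simp add: top.aug.val_power h_val_def)
  define y where "y = \<phi> r ^ e r * Hh"
  have y: "top.aug.initial_form Y 0 y"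
    using top.aug.initial_form_mult[OF phie Hh] by (simp add: Y_def Yfun_def y_def)
  \<comment> \<open>Polynomial representatives of the unit factors in the coefficients
    \<open>Rcoeff\<close> are chosen for all \<open>j\<close> at once.\<close>
  have "\<forall>j. \<exists>q. sj j \<in> I \<longrightarrow>
      top.aug.initial_form (pp (- ?\<mu>' (a (sj j)))) (- ?\<mu>' (a (sj j))) q"
    using pp_form Gam_neg[OF Gam_a] by blast
  from choice[OF this] obtain q where
    q: "\<And>j. sj j \<in> I \<Longrightarrow> top.aug.initial_form (pp (- ?\<mu>' (a (sj j)))) (- ?\<mu>' (a (sj j))) (q j)"
    by blast
  define c where "c j = (if sj j \<in> I then q j * a (sj j) else 0)" for j
  have c0: "top.aug.initial_form (pp (- ?\<mu>' (a (sj j))) * Fract (a (sj j)) 1) 0 (c j)" if "sj j \<in> I" for j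
    using top.aug.initial_form_mult[OF q[OF that] top.aug.initial_form_poly[OF I(1)[OF that]]] that
    by (simp add: mu_a[OF I(1)[OF that]] c_def)
  have c_Pge: "c j \<in> Pge ?\<mu> 0" for j
    using top.aug.initial_form_Pge[OF c0] by (cases "sj j \<in> I") (auto simp: c_def)
  have y_Pge: "y \<in> Pge ?\<mu> 0" by (rule top.aug.initial_form_Pge[OF y])
  have n0: "nsmul j (0 :: 'g) = 0" for j by (simp add: nsmul_def)
  have yj_Pge: "y ^ j \<in> Pge ?\<mu> 0" for j using top.aug.Pge_power[OF y_Pge, of j] by (simp add: n0)
  \<comment> \<open>The abscissa \<open>sj j\<close> lies between the end points, so the test in
    \<open>Rcoeff\<close> for lying on the polygon amounts to membership in
    \<open>I\<close>.\<close>
  have R: "Rcoeff v n \<iota>0 \<pi>0 \<phi> \<gamma> r f j = top.aug.homog 0 (c j)" if j: "j \<le> d" for j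
  proof (cases "sj j \<in> I")
    case True
    have "Gmul ?\<mu> (Hq ?\<mu> (pp (- ?\<mu>' (a (sj j))))) (Hmu ?\<mu> (a (sj j))) = top.aug.homog 0 (c j)"
      using top.aug.Gmul_homog[OF top.aug.initial_form_Pge[OF q[OF True]] top.aug.Pge_val, of "a (sj j)"] True
      by (simp add: top.aug.Hq_homog[OF q[OF True]] top.aug.Hmu_homog[OF I(1)[OF True]] mu_a[OF I(1)[OF True]] c_def)
    then show ?thesis
      using Npoly_between[of "sj j"] sj_le[OF j] True
      unfolding Rcoeff_def Let_def s_r s0_def s1_def by (simp add: a_def sj_def s0_def)
  next
    case False
    then show ?thesis
      using Npoly_between[of "sj j"] sj_le[OF j]
      unfolding Rcoeff_def Let_def s_r s0_def s1_def
      by (simp add: c_def a_def sj_def s0_def flip: top.aug.Gzero_homog) (metis)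
  qed
  have "R_at_y v n \<iota>0 \<pi>0 \<phi> \<gamma> r f = top.aug.homog 0 (\<Sum>j\<le>d. c j * y ^ j)"
    unfolding R_at_y_def Let_def d_def[symmetric] Y_def[symmetric]
  proof (rule top.aug.Gsum_homog)
    fix j assume "j \<le> d"
    then show "Gmul ?\<mu> (Rcoeff v n \<iota>0 \<pi>0 \<phi> \<gamma> r f j) (Gpow ?\<mu> (Hq ?\<mu> Y) j) = top.aug.homog 0 (c j * y ^ j)"
      using top.aug.Gmul_homog[OF c_Pge yj_Pge, of j j]
      by (simp add: R top.aug.Hq_homog[OF y] top.aug.Gpow_homog[OF y_Pge] n0)
  qed
  moreover have "Hq ?\<mu> (pp u) = top.aug.homog u P" by (rule top.aug.Hq_homog[OF P])
  moreover have phiP: "\<phi> r \<in> Pge ?\<mu> (\<gamma> r)" using top.w_phi by (simp add: Pge_def)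
  have "Gpow ?\<mu> (Hmu ?\<mu> (\<phi> r)) s0 = top.aug.homog (nsmul s0 (\<gamma> r)) (\<phi> r ^ s0)"
    by (simp add: top.aug.Hmu_homog top.phi_nz top.w_phi top.aug.Gpow_homog phiP)
  moreover have sumP: "(\<Sum>j\<le>d. c j * y ^ j) \<in> Pge ?\<mu> 0"
    using top.aug.Pge_mult[OF c_Pge yj_Pge] by (intro top.aug.Pge_sum) simp
  moreover have "nsmul s0 (\<gamma> r) + u = ?\<mu> f" using I(2)[OF s0I] by (simp add: u_def add.commute)
  moreover have "P * (\<Sum>j\<le>d. c j * y ^ j) \<in> Pge ?\<mu> u"
    using top.aug.Pge_mult[OF top.aug.initial_form_Pge[OF P] sumP] by simp
  ultimately have RHS: "Gmul ?\<mu> (Gpow ?\<mu> (Hmu ?\<mu> (\<phi> r)) s0) (Gmul ?\<mu> (Hq ?\<mu> (pp u)) (R_at_y v n \<iota>0 \<pi>0 \<phi> \<gamma> r f)) =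
      top.aug.homog (?\<mu> f) (\<phi> r ^ s0 * (P * (\<Sum>j\<le>d. c j * y ^ j)))"
    by (simp add: top.aug.Gmul_homog top.aug.initial_form_Pge[OF P] top.aug.Pge_power[OF phiP])

  \<comment> \<open>Both polynomials represent the initial form of the same fraction, so their
    congruence follows from \<open>initial_form_unique\<close>.\<close>
  have summand: "t (sj j) - \<phi> r ^ s0 * (P * (c j * y ^ j)) \<in> Pgt ?\<mu> (?\<mu> f)" if j: "sj j \<in> I" for j
  proof -
    let ?b = "?\<mu>' (a (sj j))"
    have F1: "top.aug.initial_form (Fract (\<phi> r ^ s0) 1) (nsmul s0 (\<gamma> r)) (\<phi> r ^ s0)"
      using top.aug.initial_form_poly[of "\<phi> r ^ s0"] top.phi_nz top.w_phi by (simp add: top.aug.val_power)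
    have F: "top.aug.initial_form (Fract (\<phi> r ^ s0) 1 * (pp u * (pp (- ?b) * Fract (a (sj j)) 1 * Y ^ j)))
        (?\<mu> f) (\<phi> r ^ s0 * (P * (c j * y ^ j)))"
      using top.aug.initial_form_mult[OF F1 top.aug.initial_form_mult[OF P top.aug.initial_form_mult[OF c0[OF j] top.aug.initial_form_power[OF y, of j]]]]
        \<open>nsmul s0 (\<gamma> r) + u = ?\<mu> f\<close> by (simp add: n0)
    \<comment> \<open>Since \<open>sj j\<close> exceeds \<open>s0\<close> by \<open>j * e r\<close>,
      equality of the values at these two indices means that the exponents of the rational functions
      cancel.\<close>
    have z: "u + (- ?b + nsmul j (- h r)) = 0"
    proof -
      have "nsmul (sj j) (\<gamma> r) = nsmul s0 (\<gamma> r) + nsmul j (h r)"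
        by (simp add: sj_def nsmul_add nsmul_mult h_val_def)
      then have "u = ?b + nsmul j (h r)"
        using I(2)[OF j] \<open>nsmul s0 (\<gamma> r) + u = ?\<mu> f\<close> by (metis add.left_commute add_left_cancel)
      then show ?thesis by (simp add: nsmul_def sum_negf)
    qed
    have bG: "- ?b \<in> Gam r" and jG: "nsmul j (- h r) \<in> Gam r"
      using Gam_neg[OF Gam_a[OF j]] Gam_zsmul[OF hG, of "int j"] unfolding zsmul_of_nat by blast+
    have "pp u * (pp (- ?b) * pp (- h r) ^ j) = 1"
      unfolding pp_power[OF hG] pp_add[OF bG jG, symmetric] pp_add[OF u Gam_add[OF bG jG], symmetric] z
      by (rule pp_0)
    moreover have "Fract (\<phi> r ^ s0) 1 * (pp u * (pp (- ?b) * Fract (a (sj j)) 1 * Y ^ j)) =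
        Fract (\<phi> r ^ s0) 1 * Fract (a (sj j)) 1 * Fract (\<phi> r ^ e r) 1 ^ j * (pp u * (pp (- ?b) * pp (- h r) ^ j))"
      by (simp add: Y_def Yfun_def power_mult_distrib ac_simps)
    moreover have "Fract (\<phi> r ^ s0) 1 * Fract (a (sj j)) 1 * Fract (\<phi> r ^ e r) 1 ^ j = Fract (t (sj j)) 1"
    proof -
      have "\<phi> r ^ (j * e r) = (\<phi> r ^ e r) ^ j" by (metis mult.commute power_mult)
      then show ?thesis by (simp add: t_def sj_def power_add ac_simps flip: Fract_1_power)
    qed
    ultimately have "top.aug.initial_form (Fract (t (sj j)) 1) (?\<mu> f) (\<phi> r ^ s0 * (P * (c j * y ^ j)))"
      using F by simp
    moreover have "top.aug.initial_form (Fract (t (sj j)) 1) (?\<mu> f) (t (sj j))"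
      using top.aug.initial_form_poly[of "t (sj j)"] mu_t[OF I(1)[OF j]] I(2)[OF j] by simp
    ultimately show ?thesis by (rule top.aug.initial_form_unique(2)[rotated])
  qed
  have "(\<Sum>j\<le>d. (if sj j \<in> I then t (sj j) else 0) - \<phi> r ^ s0 * (P * (c j * y ^ j))) \<in> Pgt ?\<mu> (?\<mu> f)"
    using summand by (intro top.aug.Pgt_sum) (auto simp: c_def)
  then have "(\<Sum>j\<le>d. if sj j \<in> I then t (sj j) else 0) - \<phi> r ^ s0 * (P * (\<Sum>j\<le>d. c j * y ^ j)) \<in> Pgt ?\<mu> (?\<mu> f)"
    by (simp add: sum_subtractf sum_distrib_left)
  with rest have "f - \<phi> r ^ s0 * (P * (\<Sum>j\<le>d. c j * y ^ j)) \<in> Pgt ?\<mu> (?\<mu> f)"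
    by (rule top.aug.Pgt_diff_trans)
  then have "Hmu ?\<mu> f = top.aug.homog (?\<mu> f) (\<phi> r ^ s0 * (P * (\<Sum>j\<le>d. c j * y ^ j)))"
    by (simp add: top.aug.Hmu_homog f_nz top.aug.homog_eq_iff)
  then show ?thesis using u RHS unfolding s_r u_r by simp
qed

end

theorem mainTheorem9:
  fixes v :: "'k::field \<Rightarrow> 'g::linordered_ab_group_add"
    and \<phi> :: "nat \<Rightarrow> 'k poly" and \<gamma> :: "nat \<Rightarrow> 'g" and r :: nat
    and n :: nat and \<iota>0 :: "nat \<Rightarrow> 'g" and \<pi>0 :: "nat \<Rightarrow> 'k"
    and f :: "'k poly"
  assumes div: "divisible_type TYPE('g)"
    and val: "is_valuation_field v"
    and nontriv: "valgroup_K v \<noteq> {0}"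
    and chain: "is_MacLane_chain v \<phi> \<gamma> r"
    and iota_in: "\<forall>j<n. \<iota>0 j \<in> valgroup_K v"
    and iota_indep: "zindep \<iota>0 n"
    and h_in: "\<forall>i\<le>r. h_val v \<phi> \<gamma> i \<in> Gsub \<iota>0 n \<gamma> i"
    and pi0: "\<forall>j<n. \<pi>0 j \<noteq> 0 \<and> v (\<pi>0 j) = \<iota>0 j"
    and f_nz: "f \<noteq> 0"
    and f_att: "MC v \<phi> \<gamma> r f \<in> Gsub \<iota>0 n \<gamma> (Suc r)"
  shows "u_r v \<phi> \<gamma> r f \<in> Gsub \<iota>0 n \<gamma> r \<and>
         Hmu (MC v \<phi> \<gamma> r) f =
           Gmul (MC v \<phi> \<gamma> r) (Gpow (MC v \<phi> \<gamma> r) (Hmu (MC v \<phi> \<gamma> r) (\<phi> r)) (s_r v \<phi> \<gamma> r f))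
             (Gmul (MC v \<phi> \<gamma> r) (Hq (MC v \<phi> \<gamma> r) (pi_pow n \<iota>0 \<pi>0 \<phi> \<gamma> r (u_r v \<phi> \<gamma> r f)))
               (R_at_y v n \<iota>0 \<pi>0 \<phi> \<gamma> r f))"
proof -
  interpret residual_chain v \<phi> \<gamma> r n \<iota>0 \<pi>0
    using div val chain iota_in iota_indep h_in pi0 by unfold_locales
  show ?thesis using f_nz f_att by (rule residual_formula)
qed

end
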